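(* As $r\to\infty$, \[ \langle X_r^2\rangle=\sigma^2\,\frac{\log r}{r}+o\!\left(\frac{\log r}{r}\right), \] where \[ \sigma^2=\frac{18}{\pi^6}\left(\sum_{\mathbf m\in\mathbb Z^2\setminus\{\mathbf 0\}}|\mathbf m|^{-3}\right)\prod_p\left(1-\frac1{(p+1)^2}\right), \] the product being over all primes $p$.
   Context: $|\cdot|$ is the Euclidean norm on $\mathbb R^2$ and $\log$ is the natural logarithm. Let $\mathbb V=\{(n_1,n_2)\in\mathbb Z^2:\gcd(n_1,n_2)=1\}$ and, for $r>0$, $\mathbf x\in\mathbb R^2$, let $G(r;\mathbf x)=\#\{\mathbf n\in\mathbb V:|\mathbf x-\mathbf n|\le r\}$ and \[ X_r(\mathbf x)=\frac{G(r;\mathbf x)}r-\frac{6r}{\pi}. \] For a function $f:\mathbb R^2\to\mathbb C$ its mean is \[ \langle f\rangle=\lim_{R\to\infty}\frac1{\pi R^2}\int_{|\mathbf x|\le R}f(\mathbf x)\,d\mathbf x . \] (The mean $\langle X_r^2\rangle$ exists for every $r>0$.) *)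

theory Defs
  imports
    "HOL-Analysis.Analysis"
    "HOL-Library.Landau_Symbols"
    "HOL-Computational_Algebra.Primes"
begin

text \<open>
  The plane is \<^typ>\<open>real \<times> real\<close>, whose library norm is the Euclidean one and whose
  \<^term>\<open>lborel\<close> is planar Lebesgue measure.
\<close>

definition plane_point :: "int \<times> int \<Rightarrow> real \<times> real" where
  "plane_point n = (real_of_int (fst n), real_of_int (snd n))"

definition visible :: "(int \<times> int) set" where
  "visible = {(n1, n2). gcd n1 n2 = 1}"

definition G :: "real \<Rightarrow> real \<times> real \<Rightarrow> nat" where
  "G r x = card {n \<in> visible. norm (x - plane_point n) \<le> r}"

definition X :: "real \<Rightarrow> real \<times> real \<Rightarrow> real" where
  "X r x = real (G r x) / r - 6 * r / pi"

text \<open>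
  The value type covers both real and complex functions. As usual for \<^term>\<open>Lim\<close>, the value is
  meaningful only when the limit exists.
\<close>

definition plane_mean ::
  "(real \<times> real \<Rightarrow> 'b :: {banach, second_countable_topology}) \<Rightarrow> 'b" where
  "plane_mean f =
     Lim at_top (\<lambda>R::real. (1 / (pi * R\<^sup>2)) *\<^sub>R (LINT x : cball 0 R | lborel. f x))"

definition sigma_sq :: real where
  "sigma_sq =
     18 / pi ^ 6
     * (\<Sum>\<^sub>\<infinity>m \<in> UNIV - {(0, 0)}. norm (plane_point m) powi (- 3))
     * (\<Prod>p. if prime p then 1 - 1 / (real p + 1)\<^sup>2 else 1)"

end

theory Submission imports Defs begin

text \<open>
  By inclusion and exclusion over primes the ordered pairs of visible points at distance vector
  \<open>m\<close> have a density that is an Euler product in \<open>m\<close>, so the mean square is a sum of this density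
  against the area of overlap of two discs of radius \<open>r\<close> with centres \<open>m\<close> apart. Removing the
  primes one at a time turns the variance into \<open>\<Sum> w(g) V(r/g)\<close> over \<open>g \<ge> 1\<close>, where \<open>V\<close> is the
  variance of the number of points of the full lattice in a random disc and \<open>0 \<le> w(g) \<le> 1\<close>.

  Poisson summation expresses \<open>V\<close> through Bessel functions, and their asymptotics give
  \<open>V(\<rho>)/\<rho> = (2\<pi>\<^sup>2)\<^sup>-\<^sup>1 \<Sum> |k|\<^sup>-\<^sup>3 (1 - sin (4\<pi>\<rho>|k|)) + o(1)\<close>. Summed with the weights
  \<open>1/g\<close>, the constant term produces the factor \<open>log r\<close>, while van der Corput's method shows that
  the sums of \<open>sin (c r/g) / g\<close> are \<open>o(log r)\<close>. The weights \<open>w\<close> contribute their mean value.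
\<close>

subsection \<open>Dominated convergence for infinite sums\<close>

text \<open>The obstacle is that the trivial bound for the sum of \<open>sin (c r / g) / g\<close>
  over g up to r is already of order log r, the order of the main term. The range of g is spread
  evenly over the logarithmic scale, and a difference test of one order cancels only for g between
  two consecutive roots of r. Tests of every order are needed, and any fixed number of them leaves a
  small multiple of log r, so the result is a little-o without a rate. Without rates, the sum over k
  is interchanged with the limit by domination with |k|^-3, and the weights are first truncated to
  primes up to P, at a cost O(1/P) r log r uniform in r. The factor log r appears because V grows
  linearly on average, while V(\<rho>) = O(\<rho>^2) makes the terms g > r contribute only O(r). The
  mean of w has local factors 1 - 3/p^2 + 2/p^3 = (1 - 1/p^2)^2 (1 - 1/(p+1)^2); this explains the
  product over primes and the constant 18/pi^6 as 1/(2 pi^2) times (6/pi^2)^2.\<close>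

lemma abs_infsum_le:
  fixes f h :: "'a \<Rightarrow> real"
  assumes h: "h summable_on A" and bd: "\<And>x. x \<in> A \<Longrightarrow> \<bar>f x\<bar> \<le> h x"
  shows "f summable_on A" "\<bar>infsum f A\<bar> \<le> infsum h A"
proof -
  have "(\<lambda>x. norm (f x)) summable_on A"
    by (rule summable_on_comparison_test[OF h]) (use bd in auto)
  thus f: "f summable_on A" by (rule abs_summable_summable)
  show "\<bar>infsum f A\<bar> \<le> infsum h A"
    using norm_infsum_le[OF has_sum_infsum[OF f] has_sum_infsum[OF h]] bd by simp
qed

lemma infsum_diff_finite:
  fixes f :: "'a \<Rightarrow> real"
  assumes f: "f summable_on A" and B: "finite B" "B \<subseteq> A"
  shows "infsum f A = sum f B + infsum f (A - B)"
proof -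
  have "infsum f (B \<union> (A - B)) = infsum f B + infsum f (A - B)"
    using B by (intro infsum_Un_disjoint summable_on_subset_banach[OF f]) auto
  thus ?thesis using B by (simp add: Un_absorb1)
qed

text \<open>The limit inherits the majorant \<open>h\<close>, so one finite set \<open>B\<close>
  carrying all but \<open>e / 4\<close> of the mass of \<open>h\<close> controls the tails on both
  sides, and on \<open>B\<close> convergence is termwise. The filter is arbitrary because limits are
  taken both along natural numbers and along the real radius.\<close>

lemma tannery_infsum:
  fixes f :: "'i \<Rightarrow> 'a \<Rightarrow> real"
  assumes h: "h summable_on A"
    and bd: "\<forall>\<^sub>F n in F. \<forall>x\<in>A. \<bar>f n x\<bar> \<le> h x"
    and lim: "\<And>x. x \<in> A \<Longrightarrow> ((\<lambda>n. f n x) \<longlongrightarrow> g x) F"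
  shows "((\<lambda>n. infsum (f n) A) \<longlongrightarrow> infsum g A) F"
proof (cases "F = bot")
  case False
  have g: "\<bar>g x\<bar> \<le> h x" if "x \<in> A" for x
  proof (rule tendsto_upperbound[OF tendsto_rabs[OF lim[OF that]] _ False])
    show "\<forall>\<^sub>F n in F. \<bar>f n x\<bar> \<le> h x" using bd by eventually_elim (use that in auto)
  qed
  show ?thesis
  proof (rule tendstoI)
    fix e :: real assume e: "0 < e"
    obtain B where B: "finite B" "B \<subseteq> A" "dist (sum h B) (infsum h A) \<le> e / 4"
      using infsum_finite_approximation[OF h, of "e / 4"] e by auto
    have tail: "\<bar>infsum u (A - B)\<bar> \<le> e / 4" "infsum u A = sum u B + infsum u (A - B)"
      if u: "\<And>x. x \<in> A \<Longrightarrow> \<bar>u x\<bar> \<le> h x" for u :: "'a \<Rightarrow> real"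
    proof -
      have hX: "h summable_on (A - B)" using h by (rule summable_on_subset_banach) auto
      have "\<bar>infsum u (A - B)\<bar> \<le> infsum h (A - B)" using u by (intro abs_infsum_le[OF hX]) auto
      thus "\<bar>infsum u (A - B)\<bar> \<le> e / 4"
        using infsum_diff_finite[OF h B(1,2)] B(3) by (simp add: dist_real_def)
      show "infsum u A = sum u B + infsum u (A - B)"
        using abs_infsum_le(1)[OF h u] B by (intro infsum_diff_finite) auto
    qed
    have "((\<lambda>n. sum (f n) B) \<longlongrightarrow> sum g B) F"
      using B by (intro tendsto_sum lim) auto
    hence "\<forall>\<^sub>F n in F. dist (sum (f n) B) (sum g B) < e / 4"
      using e by (intro tendstoD) auto
    with bd show "\<forall>\<^sub>F n in F. dist (infsum (f n) A) (infsum g A) < e"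
    proof eventually_elim
      case (elim n)
      have 1: "\<bar>infsum (f n) (A - B)\<bar> \<le> e / 4" "infsum (f n) A = sum (f n) B + infsum (f n) (A - B)"
        by (rule tail; use elim(1) in blast)+
      have 2: "\<bar>infsum g (A - B)\<bar> \<le> e / 4" "infsum g A = sum g B + infsum g (A - B)"
        by (rule tail; use g in blast)+
      show ?case using elim(2) 1 2 e unfolding dist_real_def by linarith
    qed
  qed
qed simp

text \<open>The exponent is half of 3: a product of two such terms, one per coordinate, dominates
  the inverse cube of the norm in \<open>summable_on_norm_cube\<close>.\<close>

lemma summable_on_int_powr: "(\<lambda>k::int. (1 + real_of_int \<bar>k\<bar>) powr (-3/2)) summable_on UNIV"
proof -
  let ?f = "\<lambda>k::int. (1 + real_of_int \<bar>k\<bar>) powr (-3/2)"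
  have "summable (\<lambda>n. real (Suc n) powr (-3/2))"
    using summable_real_powr_iff[of "-3/2"] by (subst summable_Suc_iff) simp
  hence n: "(\<lambda>n::nat. (1 + real n) powr (-3/2)) summable_on UNIV"
    by (intro norm_summable_imp_summable_on) simp
  have "?f summable_on range int"
    using n by (subst summable_on_reindex) (auto simp: o_def)
  moreover have "?f summable_on range (\<lambda>n. - int n - 1)"
  proof (subst summable_on_reindex)
    show "inj (\<lambda>n. - int n - 1)" by (auto simp: inj_on_def)
    show "(?f \<circ> (\<lambda>n. - int n - 1)) summable_on UNIV"
    proof (rule summable_on_comparison_test[OF n])
      fix x :: nat
      show "(?f \<circ> (\<lambda>n. - int n - 1)) x \<le> (1 + real x) powr (-3/2)"
        by (auto intro!: powr_mono2')
    qed auto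
  qed
  moreover have "range int \<inter> range (\<lambda>n. - int n - 1) = {}" by auto
  ultimately have "?f summable_on (range int \<union> range (\<lambda>n. - int n - 1))"
    by (rule summable_on_Un_disjoint)
  also have "range int \<union> range (\<lambda>n. - int n - 1) = UNIV"
  proof -
    have "k \<in> range int \<union> range (\<lambda>n. - int n - 1)" for k :: int
    proof (cases "k \<ge> 0")
      case True
      hence "k = int (nat k)" by simp
      thus ?thesis by blast
    next
      case False
      hence "k = - int (nat (- k - 1)) - 1" by simp
      thus ?thesis by blast
    qed
    thus ?thesis by blast
  qed
  finally show ?thesis .
qed

subsection \<open>Asymptotics of a Bessel integral\<close>

text \<open>\<open>bes z\<close> is \<open>\<pi> J\<^sub>1(z)/z\<close>.\<close>

definition bes :: "real \<Rightarrow> real" where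
  "bes z = integral {-1..1} (\<lambda>t. sqrt (1 - t\<^sup>2) * cos (z * t))"

text \<open>The derivative of \<open>s * sqrt (2 - s\<^sup>2)\<close>: the amplitude that remains
  after substituting \<open>t = 1 - s\<^sup>2\<close> in \<open>bes\<close> and integrating by
  parts.\<close>

definition bes_amp :: "real \<Rightarrow> real" where
  "bes_amp s = (2 - 2 * s\<^sup>2) / sqrt (2 - s\<^sup>2)"

lemma two_minus_sq_pos: "s \<in> {0..1} \<Longrightarrow> 0 < 2 - s\<^sup>2" for s :: real
proof -
  assume "s \<in> {0..1}"
  hence "s\<^sup>2 \<le> 1" by (simp add: power_le_one)
  thus ?thesis by simp
qed

lemma continuous_on_bes_amp: "continuous_on {0..1} bes_amp"
  unfolding bes_amp_def using two_minus_sq_pos by (force intro!: continuous_intros)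

lemma abs_bes_le: "\<bar>bes z\<bar> \<le> 2"
proof -
  have "norm (integral {-1..1} (\<lambda>t. sqrt (1 - t\<^sup>2) * cos (z * t))) \<le> 1 * (1 - (-1))"
  proof (rule integral_bound)
    fix t :: real assume t: "t \<in> {-1..1}"
    have "sqrt (1 - t\<^sup>2) \<le> 1" by simp
    moreover have "t\<^sup>2 \<le> 1" using t by (simp add: abs_square_le_1 abs_le_iff)
    ultimately have "\<bar>sqrt (1 - t\<^sup>2)\<bar> * \<bar>cos (z * t)\<bar> \<le> 1 * 1" by (intro mult_mono) auto
    thus "norm (sqrt (1 - t\<^sup>2) * cos (z * t)) \<le> 1" by (simp add: abs_mult)
  qed (auto intro!: continuous_intros)
  thus ?thesis by (simp add: bes_def)
qed

lemma bes_half: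
  "bes z = 2 * integral {0..1} (\<lambda>t. sqrt (1 - t\<^sup>2) * cos (z * t))" (is "_ = 2 * integral _ ?f")
proof -
  have int: "?f integrable_on {a..b}" for a b
    by (intro integrable_continuous_real continuous_intros)
  have "bes z = integral {-1..0} ?f + integral {0..1} ?f"
    unfolding bes_def by (rule Henstock_Kurzweil_Integration.integral_combine[symmetric]) (auto intro: int)
  also have "integral {-1..0} ?f = integral {0..1} (\<lambda>t. ?f (- t))"
    using Henstock_Kurzweil_Integration.integral_reflect_real[of 1 0 ?f] by simp
  finally show ?thesis by simp
qed

text \<open>The substitution \<open>t = 1 - s\<^sup>2\<close> removes the square root singularity at
  \<open>t = 1\<close> and turns that endpoint into a stationary point \<open>s = 0\<close> of a
  quadratic phase; integration by parts then gains the factor \<open>1 / z\<close>.\<close>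

lemma bes_eq_amp:
  assumes z: "0 < z"
  shows "bes z = 2 / z * integral {0..1} (\<lambda>s. bes_amp s * sin (z * (1 - s\<^sup>2)))"
proof -
  let ?f = "\<lambda>t. sqrt (1 - t\<^sup>2) * cos (z * t)"
  let ?g = "\<lambda>s::real. 1 - s\<^sup>2"
  have "((\<lambda>s. (- 2 * s) *\<^sub>R ?f (?g s)) has_integral (integral {?g 0..?g 1} ?f - integral {?g 1..?g 0} ?f)) {0..1}"
    by (rule has_integral_substitution_general[of "{}" 0 1 ?g 0 1])
       (auto intro!: continuous_intros derivative_eq_intros simp: power_le_one)
  hence 1: "((\<lambda>s. - 2 * s * ?f (?g s)) has_integral (- integral {0..1} ?f)) {0..1}" by simp
  have der: "((\<lambda>s. - (1 / z) * h s * sin (z * (1 - s\<^sup>2))) has_real_derivative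
       (- (1 / z) * (d * sin (z * (1 - s\<^sup>2))) + 2 * s * h s * cos (z * (1 - s\<^sup>2)))) (at s within A)"
    if "(h has_real_derivative d) (at s within A)" "0 < z" for h d s A
    using that by (auto intro!: derivative_eq_intros simp: field_simps)
  \<comment> \<open>This primitive vanishes at 0 through the factor \<open>s\<close> and at 1
    through the sine, so no boundary term survives.\<close>
  let ?G = "\<lambda>s. - (1 / z) * (s * sqrt (2 - s\<^sup>2)) * sin (z * (1 - s\<^sup>2))"
  have "((\<lambda>s. - (1 / z) * (bes_amp s * sin (z * (1 - s\<^sup>2))) + 2 * s * (s * sqrt (2 - s\<^sup>2)) * cos (z * (1 - s\<^sup>2)))
     has_integral (?G 1 - ?G 0)) {0..1}"
  proof (rule fundamental_theorem_of_calculus)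
    fix s :: real assume s: "s \<in> {0..1}"
    note p = two_minus_sq_pos[OF s]
    have a: "bes_amp s = sqrt (2 - s\<^sup>2) - s * s / sqrt (2 - s\<^sup>2)"
      using p by (simp add: bes_amp_def field_simps power2_eq_square[symmetric])
    have "((\<lambda>s. s * sqrt (2 - s\<^sup>2)) has_real_derivative bes_amp s) (at s within {0..1})"
      unfolding a using p
      by (auto intro!: derivative_eq_intros simp: field_simps)
    hence "(?G has_real_derivative (- (1 / z) * (bes_amp s * sin (z * (1 - s\<^sup>2))) + 2 * s * (s * sqrt (2 - s\<^sup>2)) * cos (z * (1 - s\<^sup>2)))) (at s within {0..1})"
      using z by (rule der)
    thus "(?G has_vector_derivative (- (1 / z) * (bes_amp s * sin (z * (1 - s\<^sup>2))) + 2 * s * (s * sqrt (2 - s\<^sup>2)) * cos (z * (1 - s\<^sup>2)))) (at s within {0..1})"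
      by (simp add: has_real_derivative_iff_has_vector_derivative)
  qed simp
  hence 2: "((\<lambda>s. - (1 / z) * (bes_amp s * sin (z * (1 - s\<^sup>2))) + 2 * s * (s * sqrt (2 - s\<^sup>2)) * cos (z * (1 - s\<^sup>2)))
     has_integral 0) {0..1}" by simp
  have "((\<lambda>s. bes_amp s * sin (z * (1 - s\<^sup>2))) has_integral
      integral {0..1} (\<lambda>s. bes_amp s * sin (z * (1 - s\<^sup>2)))) {0..1}"
    by (intro integrable_integral integrable_continuous_real continuous_intros continuous_on_bes_amp)
  from has_integral_add[OF 2 has_integral_mult_right[OF this, of "1 / z"]]
  have 3: "((\<lambda>s. 2 * s * (s * sqrt (2 - s\<^sup>2)) * cos (z * (1 - s\<^sup>2))) has_integral
      1 / z * integral {0..1} (\<lambda>s. bes_amp s * sin (z * (1 - s\<^sup>2)))) {0..1}"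
    by simp
  have "((\<lambda>s. 2 * s * (s * sqrt (2 - s\<^sup>2)) * cos (z * (1 - s\<^sup>2))) has_integral (integral {0..1} ?f)) {0..1}"
  proof (rule has_integral_eq[OF _ has_integral_neg[OF 1, simplified]])
    fix s :: real assume s: "s \<in> {0..1}"
    have "1 - (1 - s\<^sup>2)\<^sup>2 = s\<^sup>2 * (2 - s\<^sup>2)" by (simp add: power2_eq_square algebra_simps)
    hence "sqrt (1 - (1 - s\<^sup>2)\<^sup>2) = s * sqrt (2 - s\<^sup>2)" using s by (simp add: real_sqrt_mult)
    thus "2 * s * (sqrt (1 - (1 - s\<^sup>2)\<^sup>2) * cos (z * (1 - s\<^sup>2))) = 2 * s * (s * sqrt (2 - s\<^sup>2)) * cos (z * (1 - s\<^sup>2))"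
      by simp
  qed
  with 3 have "integral {0..1} ?f = 1 / z * integral {0..1} (\<lambda>s. bes_amp s * sin (z * (1 - s\<^sup>2)))"
    by (rule has_integral_unique[rotated])
  thus ?thesis unfolding bes_half by simp
qed

text \<open>What is left of the oscillatory integral after the value \<open>cis z\<close> of the
  phase at the stationary point is factored out.\<close>

definition bes_osc :: "real \<Rightarrow> complex" where
  "bes_osc z = integral {0..1} (\<lambda>s. of_real (bes_amp s) * cis (- (z * s\<^sup>2)))"

lemma continuous_on_cis' [continuous_intros]:
  "continuous_on A f \<Longrightarrow> continuous_on A (\<lambda>x. cis (f x))"
  by (simp add: cis_conv_exp continuous_on_exp continuous_on_mult continuous_on_of_real)

lemma bes_eq_osc: "0 < z \<Longrightarrow> bes z = 2 / z * Im (cis z * bes_osc z)"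
proof -
  assume z: "0 < z"
  have "((\<lambda>s. of_real (bes_amp s) * cis (- (z * s\<^sup>2))) has_integral bes_osc z) {0..1}"
    unfolding bes_osc_def
    by (intro integrable_integral integrable_continuous_real continuous_intros continuous_on_bes_amp)
  hence "((\<lambda>s. Im (cis z * (of_real (bes_amp s) * cis (- (z * s\<^sup>2))))) has_integral Im (cis z * bes_osc z)) {0..1}"
    by (intro has_integral_linear[OF has_integral_mult_right bounded_linear_Im, unfolded o_def])
  moreover have "Im (cis z * (of_real (bes_amp s) * cis (- (z * s\<^sup>2)))) = bes_amp s * sin (z * (1 - s\<^sup>2))" for s
  proof -
    have "cis z * (of_real (bes_amp s) * cis (- (z * s\<^sup>2))) = of_real (bes_amp s) * (cis z * cis (- (z * s\<^sup>2)))"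
      by (simp only: mult.left_commute)
    also have "\<dots> = of_real (bes_amp s) * cis (z * (1 - s\<^sup>2))" by (simp add: cis_mult algebra_simps)
    also have "Im \<dots> = bes_amp s * sin (z * (1 - s\<^sup>2))" by simp
    finally show ?thesis .
  qed
  ultimately show ?thesis using bes_eq_amp[OF z] by (simp add: integral_unique)
qed

lemma has_vector_derivative_cis:
  assumes "(f has_real_derivative d) (at x within A)"
  shows "((\<lambda>x. cis (f x)) has_vector_derivative (\<i> * of_real d * cis (f x))) (at x within A)"
proof -
  have "((\<lambda>t. exp (\<i> * of_real t)) has_vector_derivative (\<i> * exp (\<i> * of_real t))) (at t within B)" for t :: real and B
    by (intro has_vector_derivative_real_field) (auto intro!: derivative_eq_intros)
  hence "(cis has_vector_derivative (\<i> * cis (f x))) (at (f x) within f ` A)"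
    by (simp add: cis_conv_exp[abs_def])
  hence "((\<lambda>x. cis (f x)) has_vector_derivative (d *\<^sub>R (\<i> * cis (f x)))) (at x within A)"
    using assms unfolding has_real_derivative_iff_has_vector_derivative
    by (intro vector_diff_chain_within[unfolded o_def])
  thus ?thesis by (simp add: scaleR_conv_of_real algebra_simps)
qed

text \<open>The factor s in the amplitude cancels the stationary point of the phase at 0.\<close>

lemma stationary_phase_small:
  fixes P P' :: "real \<Rightarrow> real"
  assumes der: "\<And>s. s \<in> {0..1} \<Longrightarrow> (P has_real_derivative P' s) (at s within {0..1})"
    and cont: "continuous_on {0..1} P'"
  shows "\<exists>C. \<forall>z>0. norm (integral {0..1} (\<lambda>s. of_real (s * P s) * cis (- (z * s\<^sup>2)))) \<le> C / z"
proof -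
  have contP: "continuous_on {0..1} P" using der by (rule DERIV_continuous_on)
  obtain B where B: "\<And>s. s \<in> {0..1} \<Longrightarrow> \<bar>P' s\<bar> \<le> B"
    using compact_imp_bounded[OF compact_continuous_image[OF cont compact_Icc]]
    unfolding bounded_iff by (metis image_eqI real_norm_def)
  show ?thesis
  proof (intro exI[of _ "(\<bar>P 1\<bar> + \<bar>P 0\<bar> + B) / 2"] allI impI)
    fix z :: real assume z: "0 < z"
    define I where "I = integral {0..1} (\<lambda>s. of_real (s * P s) * cis (- (z * s\<^sup>2)))"
    define K where "K = integral {0..1} (\<lambda>s. of_real (P' s) * cis (- (z * s\<^sup>2)))"
    have I: "((\<lambda>s. of_real (s * P s) * cis (- (z * s\<^sup>2))) has_integral I) {0..1}"
      unfolding I_def by (intro integrable_integral integrable_continuous_real continuous_intros contP)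
    have K: "((\<lambda>s. of_real (P' s) * cis (- (z * s\<^sup>2))) has_integral K) {0..1}"
      unfolding K_def by (intro integrable_integral integrable_continuous_real continuous_intros cont)
    have "norm K \<le> B * (1 - 0)" unfolding K_def
      using B by (intro integral_bound continuous_intros cont) (auto simp: norm_mult)
    hence nK: "norm K \<le> B" by simp
    have "((\<lambda>s. of_real (P' s) * cis (- (z * s\<^sup>2)) + (-2 * \<i> * z) * (of_real (s * P s) * cis (- (z * s\<^sup>2))))
       has_integral (of_real (P 1) * cis (- (z * 1\<^sup>2)) - of_real (P 0) * cis (- (z * 0\<^sup>2)))) {0..1}"
    proof (rule fundamental_theorem_of_calculus)
      fix s :: real assume s: "s \<in> {0..1}"
      have 1: "((\<lambda>s. complex_of_real (P s)) has_vector_derivative of_real (P' s)) (at s within {0..1})"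
        using der[OF s] by (intro has_vector_derivative_of_real) (simp add: has_real_derivative_iff_has_vector_derivative)
      have 2: "((\<lambda>s. cis (- (z * s\<^sup>2))) has_vector_derivative (\<i> * of_real (-2 * z * s) * cis (- (z * s\<^sup>2)))) (at s within {0..1})"
        by (intro has_vector_derivative_cis) (auto intro!: derivative_eq_intros)
      show "((\<lambda>s. of_real (P s) * cis (- (z * s\<^sup>2))) has_vector_derivative
          of_real (P' s) * cis (- (z * s\<^sup>2)) + (-2 * \<i> * z) * (of_real (s * P s) * cis (- (z * s\<^sup>2)))) (at s within {0..1})"
        by (rule has_vector_derivative_eq_rhs[OF has_vector_derivative_mult[OF 1 2]])
           (simp add: scaleR_conv_of_real algebra_simps)
    qed simp
    moreover have "((\<lambda>s. of_real (P' s) * cis (- (z * s\<^sup>2)) + (-2 * \<i> * z) * (of_real (s * P s) * cis (- (z * s\<^sup>2))))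
       has_integral (K + (-2 * \<i> * z) * I)) {0..1}"
      by (intro has_integral_add has_integral_mult_right I K)
    ultimately have "of_real (P 1) * cis (- (z * 1\<^sup>2)) - of_real (P 0) * cis (- (z * 0\<^sup>2)) = K + (-2 * \<i> * z) * I"
      by (rule has_integral_unique)
    hence "(2 * \<i> * z) * I = K - of_real (P 1) * cis (- z) + of_real (P 0)" by (simp add: algebra_simps)
    hence "norm ((2 * \<i> * z) * I) \<le> norm K + norm (of_real (P 1) * cis (- z)) + norm (complex_of_real (P 0))"
      by (simp only:) (rule order.trans[OF norm_triangle_ineq add_right_mono[OF norm_triangle_ineq4]])
    hence "2 * z * norm I \<le> B + \<bar>P 1\<bar> + \<bar>P 0\<bar>" using nK z by (simp add: norm_mult)
    thus "norm I \<le> (\<bar>P 1\<bar> + \<bar>P 0\<bar> + B) / 2 / z" using z by (simp add: field_simps)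
  qed
qed

section \<open>Fresnel integrals\<close>

definition fresnel :: "real \<Rightarrow> complex" where
  "fresnel x = integral {0..x} (\<lambda>t. cis (- (t\<^sup>2)))"

text \<open>The companion integral from the proof of the Gaussian integral by differentiation under
  the integral sign: up to a factor \<i> its derivative is that of the square of
  \<open>fresnel\<close>, which evaluates the Fresnel integral without contours.\<close>

definition fresnel_aux :: "real \<Rightarrow> complex" where
  "fresnel_aux x = integral {0..1} (\<lambda>s. cis (- (x\<^sup>2 * (1 + s\<^sup>2))) / of_real (1 + s\<^sup>2))"

lemma one_plus_sq_ne [simp]: "1 + s\<^sup>2 \<noteq> (0::real)" "1 + (complex_of_real s)\<^sup>2 \<noteq> 0"
proof -
  have "0 < 1 + s\<^sup>2" by (intro add_pos_nonneg) auto
  thus 1: "1 + s\<^sup>2 \<noteq> (0::real)" by simp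
  thus "1 + (complex_of_real s)\<^sup>2 \<noteq> 0"
    by (metis of_real_1 of_real_add of_real_eq_0_iff of_real_power)
qed

lemma fresnel_scale: "0 \<le> x \<Longrightarrow> fresnel x = of_real x * integral {0..1} (\<lambda>s. cis (- (x\<^sup>2 * s\<^sup>2)))"
proof -
  assume x: "0 \<le> x"
  have "((\<lambda>s. x *\<^sub>R cis (- ((x * s)\<^sup>2))) has_integral (integral {x*0..x*1} (\<lambda>t. cis (- (t\<^sup>2))))) {0..1}"
    using x by (intro has_integral_substitution[where c = 0 and d = x])
     (auto intro!: continuous_intros derivative_eq_intros simp: mult_left_le)
  hence "fresnel x = integral {0..1} (\<lambda>s. x *\<^sub>R cis (- ((x * s)\<^sup>2)))"
    unfolding fresnel_def by (intro integral_unique[symmetric]) simp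
  thus ?thesis by (simp add: power_mult_distrib scaleR_conv_of_real)
qed

lemma fresnel_square:
  assumes x: "0 < x"
  shows "(fresnel x)\<^sup>2 = \<i> * fresnel_aux x - \<i> * pi / 4"
proof -
  let ?S = "{0..x}"
  have dh: "(fresnel has_vector_derivative cis (- (y\<^sup>2))) (at y within ?S)" if "y \<in> ?S" for y
    unfolding fresnel_def[abs_def] using that
    by (intro integral_has_vector_derivative continuous_intros)
  have dk: "(fresnel_aux has_vector_derivative
      integral {0..1} (\<lambda>s. -2 * \<i> * y * cis (- (y\<^sup>2 * (1 + s\<^sup>2))))) (at y within ?S)" if "y \<in> ?S" for y
    unfolding fresnel_aux_def[abs_def] box_real[symmetric]
  proof (rule leibniz_rule_vector_derivative)
    fix u s assume "u \<in> cbox 0 x" 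
    have "((\<lambda>u. cis (- (u\<^sup>2 * (1 + s\<^sup>2)))) has_vector_derivative
        (\<i> * of_real (- (2 * u * (1 + s\<^sup>2))) * cis (- (u\<^sup>2 * (1 + s\<^sup>2))))) (at u within cbox 0 x)"
      by (intro has_vector_derivative_cis) (auto intro!: derivative_eq_intros)
    from has_vector_derivative_divide[OF this, of "of_real (1 + s\<^sup>2)"]
    show "((\<lambda>u. cis (- (u\<^sup>2 * (1 + s\<^sup>2))) / of_real (1 + s\<^sup>2)) has_vector_derivative
        -2 * \<i> * u * cis (- (u\<^sup>2 * (1 + s\<^sup>2)))) (at u within cbox 0 x)"
    proof (rule has_vector_derivative_eq_rhs)
      have "of_real (- (2 * u * (1 + s\<^sup>2))) = -2 * of_real u * complex_of_real (1 + s\<^sup>2)" by simp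
      moreover have "complex_of_real (1 + s\<^sup>2) \<noteq> 0" by simp
      ultimately show "\<i> * of_real (- (2 * u * (1 + s\<^sup>2))) * cis (- (u\<^sup>2 * (1 + s\<^sup>2))) / of_real (1 + s\<^sup>2)
        = -2 * \<i> * u * cis (- (u\<^sup>2 * (1 + s\<^sup>2)))"
        by (subst nonzero_divide_eq_eq) (simp_all only: ac_simps not_False_eq_True)
    qed
  next
    fix u :: real
    show "(\<lambda>s. cis (- (u\<^sup>2 * (1 + s\<^sup>2))) / of_real (1 + s\<^sup>2)) integrable_on cbox 0 1"
      by (intro integrable_continuous continuous_intros) auto
  next
    show "continuous_on (cbox 0 x \<times> cbox 0 1) (\<lambda>(u, s). -2 * \<i> * of_real u * cis (- (u\<^sup>2 * (1 + s\<^sup>2))))"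
      unfolding case_prod_unfold by (intro continuous_intros)
  qed (use that in \<open>auto simp: convex_box\<close>)
  have k0: "fresnel_aux 0 = pi / 4"
  proof -
    have "((\<lambda>s::real. 1 / (1 + s\<^sup>2)) has_integral (arctan 1 - arctan 0)) {0..1}"
      by (rule fundamental_theorem_of_calculus)
        (auto simp: has_real_derivative_iff_has_vector_derivative[symmetric] inverse_eq_divide
          intro!: derivative_eq_intros)
    hence "((\<lambda>s::real. 1 / (1 + s\<^sup>2)) has_integral (pi / 4)) {0..1}" by (simp add: arctan_one)
    hence "((\<lambda>s. complex_of_real (1 / (1 + s\<^sup>2))) has_integral complex_of_real (pi / 4)) {0..1}"
      by (rule has_integral_of_real)
    thus ?thesis by (simp add: fresnel_aux_def integral_unique)
  qed
  \<comment> \<open>Scaling \<open>fresnel y\<close> to the unit interval shows that both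
    derivatives contain the same integral and cancel. The constant is read off at 0, where
    \<open>k0\<close> gives an arctangent.\<close>
  have "((\<lambda>x. (fresnel x)\<^sup>2 - \<i> * fresnel_aux x) has_vector_derivative 0) (at y within ?S)" if y: "y \<in> ?S" for y
  proof -
    let ?I = "integral {0..1} (\<lambda>s. cis (- (y\<^sup>2 * s\<^sup>2)))"
    have "(\<lambda>s. -2 * \<i> * y * cis (- (y\<^sup>2 * (1 + s\<^sup>2)))) = (\<lambda>s. (-2 * \<i> * y * cis (- (y\<^sup>2))) * cis (- (y\<^sup>2 * s\<^sup>2)))"
      by (simp add: cis_mult algebra_simps)
    hence I2: "integral {0..1} (\<lambda>s. -2 * \<i> * y * cis (- (y\<^sup>2 * (1 + s\<^sup>2)))) = (-2 * \<i> * y * cis (- (y\<^sup>2))) * ?I"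
      by simp
    have F2: "fresnel y = y * ?I" using y by (intro fresnel_scale) auto
    have e: "fresnel y * cis (- (y\<^sup>2)) + cis (- (y\<^sup>2)) * fresnel y
        - \<i> * integral {0..1} (\<lambda>s. -2 * \<i> * y * cis (- (y\<^sup>2 * (1 + s\<^sup>2)))) = 0"
      unfolding I2 F2 by (simp add: algebra_simps)
    have "((\<lambda>x. fresnel x * fresnel x - \<i> * fresnel_aux x) has_vector_derivative
       (fresnel y * cis (- (y\<^sup>2)) + cis (- (y\<^sup>2)) * fresnel y
         - \<i> * integral {0..1} (\<lambda>s. -2 * \<i> * y * cis (- (y\<^sup>2 * (1 + s\<^sup>2)))))) (at y within ?S)"
      by (intro has_vector_derivative_diff has_vector_derivative_mult has_vector_derivative_mult_right dh dk y)
    thus ?thesis unfolding e by (simp only: power2_eq_square[of "fresnel _"])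
  qed
  then obtain c where c: "\<And>y. y \<in> ?S \<Longrightarrow> (fresnel y)\<^sup>2 - \<i> * fresnel_aux y = c"
    using has_vector_derivative_zero_constant[of ?S "\<lambda>x. (fresnel x)\<^sup>2 - \<i> * fresnel_aux x"]
    by (metis convex_real_interval(5))
  have "c = - \<i> * pi / 4" using c[of 0] x by (simp add: k0 fresnel_def)
  thus ?thesis using c[of x] x by (simp add: algebra_simps)
qed

lemma fresnel_aux_bound: "norm (fresnel_aux x) \<le> 1"
proof -
  have "norm (fresnel_aux x) \<le> 1 * (1 - 0)" unfolding fresnel_aux_def
  proof (rule integral_bound)
    fix s :: real
    have "norm (complex_of_real (1 + s\<^sup>2)) = 1 + s\<^sup>2" unfolding norm_of_real by simp
    thus "norm (cis (- (x\<^sup>2 * (1 + s\<^sup>2))) / complex_of_real (1 + s\<^sup>2)) \<le> 1"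
      by (simp add: norm_divide divide_le_eq add_pos_nonneg del: of_real_add)
  qed (auto intro!: continuous_intros)
  thus ?thesis by simp
qed

lemma fresnel_bound: "0 < x \<Longrightarrow> norm (fresnel x) \<le> 2"
proof -
  assume x: "0 < x"
  have "norm ((fresnel x)\<^sup>2) \<le> norm (\<i> * fresnel_aux x) + norm (\<i> * pi / 4)"
    unfolding fresnel_square[OF x] by (rule norm_triangle_ineq4)
  also have "\<dots> \<le> 1 + pi / 4" using fresnel_aux_bound by (simp add: norm_mult norm_divide)
  also have "\<dots> \<le> 2\<^sup>2" using pi_less_4 by simp
  finally have "(norm (fresnel x))\<^sup>2 \<le> 2\<^sup>2" by (simp add: norm_power)
  thus ?thesis by (rule power2_le_imp_le) simp
qed

text \<open>Writing \<open>1 / (1 + s\<^sup>2)\<close> as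
  \<open>1 - s * (s / (1 + s\<^sup>2))\<close> leaves a Fresnel integral, which is
  \<open>O(1 / x)\<close> by the crude bound \<open>fresnel_bound\<close>, and an integral whose
  factor \<open>s\<close> makes \<open>stationary_phase_small\<close> applicable.\<close>

lemma fresnel_aux_tendsto_0: "(fresnel_aux \<longlongrightarrow> 0) at_top"
proof -
  have "\<exists>C. \<forall>z>0. norm (integral {0..1} (\<lambda>s. of_real (s * (s / (1 + s\<^sup>2))) * cis (- (z * s\<^sup>2)))) \<le> C / z"
  proof (rule stationary_phase_small)
    fix s :: real
    have "((\<lambda>s. s / (1 + s\<^sup>2)) has_real_derivative ((1 * (1 + s\<^sup>2) - s * (0 + 2 * s)) / ((1 + s\<^sup>2) * (1 + s\<^sup>2)))) (at s within {0..1})"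
      by (intro DERIV_divide DERIV_add DERIV_const DERIV_ident) (auto intro!: derivative_eq_intros)
    thus "((\<lambda>s. s / (1 + s\<^sup>2)) has_real_derivative ((1 - s\<^sup>2) / (1 + s\<^sup>2)\<^sup>2)) (at s within {0..1})"
      by (simp add: power2_eq_square)
  qed (auto intro!: continuous_intros)
  then obtain C where C: "\<And>z. z > 0 \<Longrightarrow>
     norm (integral {0..1} (\<lambda>s. of_real (s * (s / (1 + s\<^sup>2))) * cis (- (z * s\<^sup>2)))) \<le> C / z" by blast
  have bd: "norm (fresnel_aux x) \<le> 2 / x + C / x\<^sup>2" if x: "0 < x" for x
  proof -
    let ?J = "integral {0..1} (\<lambda>s. of_real (s * (s / (1 + s\<^sup>2))) * cis (- (x\<^sup>2 * s\<^sup>2)))"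
    let ?I = "integral {0..1} (\<lambda>s. cis (- (x\<^sup>2 * s\<^sup>2)))"
    have e: "cis (- (x\<^sup>2 * (1 + s\<^sup>2))) / of_real (1 + s\<^sup>2) =
       cis (- (x\<^sup>2)) * (cis (- (x\<^sup>2 * s\<^sup>2)) - of_real (s * (s / (1 + s\<^sup>2))) * cis (- (x\<^sup>2 * s\<^sup>2)))" for s
    proof -
      have "cis (- (x\<^sup>2)) * (cis (- (x\<^sup>2 * s\<^sup>2)) - of_real (s * (s / (1 + s\<^sup>2))) * cis (- (x\<^sup>2 * s\<^sup>2)))
        = of_real (1 - s * (s / (1 + s\<^sup>2))) * (cis (- (x\<^sup>2)) * cis (- (x\<^sup>2 * s\<^sup>2)))"
        by (simp add: algebra_simps)
      also have "1 - s * (s / (1 + s\<^sup>2)) = 1 / (1 + s\<^sup>2)"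
        using one_plus_sq_ne(1)[of s] by (simp add: divide_simps power2_eq_square del: one_plus_sq_ne)
      finally show ?thesis by (simp add: cis_mult algebra_simps del: of_real_add)
    qed
    have "fresnel_aux x = cis (- (x\<^sup>2)) * (?I - ?J)"
      unfolding fresnel_aux_def e integral_mult_right
      by (subst integral_diff) (auto intro!: integrable_continuous_real continuous_intros)
    hence "norm (fresnel_aux x) \<le> norm ?I + norm ?J"
      using norm_triangle_ineq4[of ?I ?J] by (simp add: norm_mult)
    moreover have "norm ?I \<le> 2 / x"
      using fresnel_bound[OF x] fresnel_scale[of x] x by (simp add: norm_mult field_simps)
    moreover have "norm ?J \<le> C / x\<^sup>2" using C[of "x\<^sup>2"] x by simp
    ultimately show ?thesis by linarith
  qed
  show ?thesis
  proof (rule Lim_null_comparison[of _ "\<lambda>x. 2 / x + C / x\<^sup>2"])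
    show "\<forall>\<^sub>F x in at_top. norm (fresnel_aux x) \<le> 2 / x + C / x\<^sup>2"
      using eventually_gt_at_top[of 0] by eventually_elim (rule bd)
    have "((\<lambda>x::real. 2 * inverse x + C * (inverse x)\<^sup>2) \<longlongrightarrow> 2 * 0 + C * 0\<^sup>2) at_top"
      by (intro tendsto_intros tendsto_inverse_0_at_top filterlim_ident)
    thus "((\<lambda>x. 2 / x + C / x\<^sup>2) \<longlongrightarrow> 0) at_top" by (simp add: field_simps)
  qed
qed

text \<open>Only the square of \<open>fresnel\<close> is evaluated, so the asymptotics are stated
  for the square of \<open>bes_osc\<close>; the branch of the square root is never determined. The
  amplitude is replaced by its value \<open>sqrt 2\<close> at the stationary point.\<close>

lemma bes_osc_square: "((\<lambda>z. of_real z * (bes_osc z)\<^sup>2) \<longlongrightarrow> - \<i> * pi / 2) at_top"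
proof -
  \<comment> \<open>The difference quotient of the amplitude at 0:
    \<open>bes_amp s = sqrt 2 + s * P s\<close>. Its first term is
    \<open>(sqrt (2 - s\<^sup>2) - sqrt 2) / s\<close> rationalised, so that it is visibly smooth at
    0.\<close>
  define P where "P s = - s / (sqrt (2 - s\<^sup>2) + sqrt 2) - s / sqrt (2 - s\<^sup>2)" for s :: real
  define P' where "P' s = ((- 1) * (sqrt (2 - s\<^sup>2) + sqrt 2) - (- s) * (- s / sqrt (2 - s\<^sup>2) + 0))
        / ((sqrt (2 - s\<^sup>2) + sqrt 2) * (sqrt (2 - s\<^sup>2) + sqrt 2))
        - (1 * sqrt (2 - s\<^sup>2) - s * (- s / sqrt (2 - s\<^sup>2))) / (sqrt (2 - s\<^sup>2) * sqrt (2 - s\<^sup>2))" for s :: real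
  have amp: "bes_amp s = sqrt 2 + s * P s" if s: "s \<in> {0..1}" for s
  proof -
    define q where "q = sqrt (2 - s\<^sup>2)"
    have q: "0 < q" "q\<^sup>2 = 2 - s\<^sup>2" using two_minus_sq_pos[OF s] by (auto simp: q_def)
    have s2: "s * s = 2 - q * q" using q(2) by (simp add: power2_eq_square)
    have "0 < q + sqrt 2" using q by (intro add_pos_pos) auto
    have "s * P s = - (s * s) / (q + sqrt 2) - s * s / q" by (simp add: P_def q_def right_diff_distrib)
    also have "\<dots> = (q - sqrt 2) - s * s / q"
    proof -
      have "(q - sqrt 2) * (q + sqrt 2) = - (s * s)" unfolding s2 by (simp add: algebra_simps)
      thus ?thesis using \<open>0 < q + sqrt 2\<close> by (simp add: field_simps)
    qed
    also have "\<dots> = bes_amp s - sqrt 2"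
      using q by (simp add: bes_amp_def q_def[symmetric] power2_eq_square s2 field_simps)
    finally show ?thesis by simp
  qed
  have "\<exists>C. \<forall>z>0. norm (integral {0..1} (\<lambda>s. of_real (s * P s) * cis (- (z * s\<^sup>2)))) \<le> C / z"
  proof (rule stationary_phase_small[where P' = P'])
    fix s :: real assume s: "s \<in> {0..1}"
    define q where "q = sqrt (2 - s\<^sup>2)"
    have q: "0 < q" using two_minus_sq_pos[OF s] by (auto simp: q_def)
    have qs: "0 < q + sqrt 2" using q by (intro add_pos_pos) auto
    have dq: "((\<lambda>s. sqrt (2 - s\<^sup>2)) has_real_derivative (- s / q)) (at s within {0..1})"
      using two_minus_sq_pos[OF s] by (auto intro!: derivative_eq_intros simp: q_def field_simps)
    show "(P has_real_derivative P' s) (at s within {0..1})"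
      unfolding P_def[abs_def] P'_def using q qs dq unfolding q_def
      by (intro DERIV_diff DERIV_divide DERIV_add DERIV_const DERIV_minus DERIV_ident) auto
  next
    have "sqrt (2 - s\<^sup>2) + sqrt 2 \<noteq> 0" "sqrt (2 - s\<^sup>2) \<noteq> 0" if "s \<in> {0..1}" for s :: real
      using two_minus_sq_pos[OF that] by (auto intro!: less_imp_neq[symmetric] add_pos_pos)
    thus "continuous_on {0..1} P'" unfolding P'_def[abs_def] by (intro continuous_intros) auto
  qed
  then obtain C where C: "\<And>z. z > 0 \<Longrightarrow>
     norm (integral {0..1} (\<lambda>s. of_real (s * P s) * cis (- (z * s\<^sup>2)))) \<le> C / z" by blast
  have contP: "continuous_on {0..1} (\<lambda>s. s * P s)"
  proof -
    have "continuous_on {0..1} (\<lambda>s. bes_amp s - sqrt 2)" by (intro continuous_intros continuous_on_bes_amp)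
    thus ?thesis by (rule continuous_on_eq) (simp add: amp)
  qed
  define R where "R z = integral {0..1} (\<lambda>s. of_real (s * P s) * cis (- (z * s\<^sup>2)))" for z
  have split: "of_real (sqrt z) * bes_osc z = sqrt 2 * fresnel (sqrt z) + sqrt z * R z" if z: "0 < z" for z
  proof -
    have "bes_osc z = integral {0..1} (\<lambda>s. sqrt 2 * cis (- (z * s\<^sup>2)) + of_real (s * P s) * cis (- (z * s\<^sup>2)))"
      unfolding bes_osc_def by (intro integral_cong) (simp add: amp algebra_simps)
    also have "\<dots> = sqrt 2 * integral {0..1} (\<lambda>s. cis (- (z * s\<^sup>2))) + R z"
      unfolding R_def by (subst integral_add) (auto intro!: integrable_continuous_real continuous_intros contP simp del: of_real_mult)
    finally show ?thesis using fresnel_scale[of "sqrt z"] z by (simp add: algebra_simps)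
  qed
  have R0: "((\<lambda>z. sqrt z * R z) \<longlongrightarrow> 0) at_top"
  proof (rule Lim_null_comparison[of _ "\<lambda>z. C * inverse (sqrt z)"])
    show "\<forall>\<^sub>F z in at_top. norm (sqrt z * R z) \<le> C * inverse (sqrt z)"
      using eventually_gt_at_top[of 0]
    proof eventually_elim
      case (elim z)
      have "sqrt z * norm (R z) \<le> sqrt z * (C / z)" using C[OF elim] elim unfolding R_def by (intro mult_left_mono) auto
      also have "\<dots> = C * inverse (sqrt z)" using elim by (simp add: field_simps)
      finally show ?case using elim by (simp add: norm_mult)
    qed
    have "((\<lambda>z. C * inverse (sqrt z)) \<longlongrightarrow> C * 0) at_top"
      by (intro tendsto_intros tendsto_inverse_0_at_top sqrt_at_top)
    thus "((\<lambda>z. C * inverse (sqrt z)) \<longlongrightarrow> 0) at_top" by simp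
  qed
  have F2: "((\<lambda>z. (fresnel (sqrt z))\<^sup>2) \<longlongrightarrow> - \<i> * pi / 4) at_top"
  proof -
    have "((\<lambda>z. \<i> * fresnel_aux (sqrt z) - \<i> * pi / 4) \<longlongrightarrow> \<i> * 0 - \<i> * pi / 4) at_top"
      by (intro tendsto_intros filterlim_compose[OF fresnel_aux_tendsto_0 sqrt_at_top])
    moreover have "\<forall>\<^sub>F z in at_top. \<i> * fresnel_aux (sqrt z) - \<i> * pi / 4 = (fresnel (sqrt z))\<^sup>2"
      using eventually_gt_at_top[of 0] by eventually_elim (simp add: fresnel_square)
    ultimately show ?thesis by (simp add: tendsto_cong)
  qed
  have FR: "((\<lambda>z. fresnel (sqrt z) * (sqrt z * R z)) \<longlongrightarrow> 0) at_top"
  proof (rule Lim_null_comparison[of _ "\<lambda>z. 2 * norm (sqrt z * R z)"])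
    show "\<forall>\<^sub>F z in at_top. norm (fresnel (sqrt z) * (sqrt z * R z)) \<le> 2 * norm (sqrt z * R z)"
      using eventually_gt_at_top[of 0]
    proof eventually_elim
      case (elim z)
      thus ?case using fresnel_bound[of "sqrt z"] by (subst norm_mult) (intro mult_right_mono, auto)
    qed
    show "((\<lambda>z. 2 * norm (sqrt z * R z)) \<longlongrightarrow> 0) at_top"
      using tendsto_mult[OF tendsto_const tendsto_norm[OF R0], of 2] by simp
  qed
  have "((\<lambda>z. 2 * (fresnel (sqrt z))\<^sup>2 + 2 * complex_of_real (sqrt 2) * (fresnel (sqrt z) * (sqrt z * R z)) + (sqrt z * R z)\<^sup>2)
     \<longlongrightarrow> 2 * (- \<i> * pi / 4) + 2 * complex_of_real (sqrt 2) * 0 + 0\<^sup>2) at_top"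
    by (intro tendsto_add tendsto_mult tendsto_const F2 FR tendsto_power R0)
  hence lim: "((\<lambda>z. 2 * (fresnel (sqrt z))\<^sup>2 + 2 * complex_of_real (sqrt 2) * (fresnel (sqrt z) * (sqrt z * R z)) + (sqrt z * R z)\<^sup>2)
     \<longlongrightarrow> - \<i> * pi / 2) at_top" by simp
  have ev: "\<forall>\<^sub>F z in at_top. 2 * (fresnel (sqrt z))\<^sup>2 + 2 * complex_of_real (sqrt 2) * (fresnel (sqrt z) * (sqrt z * R z)) + (sqrt z * R z)\<^sup>2
     = of_real z * (bes_osc z)\<^sup>2"
    using eventually_gt_at_top[of 0]
  proof eventually_elim
    case (elim z)
    have "of_real z * (bes_osc z)\<^sup>2 = (of_real (sqrt z) * bes_osc z)\<^sup>2"
      using elim by (simp add: power_mult_distrib of_real_power[symmetric] del: of_real_power)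
    also have "\<dots> = (complex_of_real (sqrt 2))\<^sup>2 * (fresnel (sqrt z))\<^sup>2 + 2 * complex_of_real (sqrt 2) * (fresnel (sqrt z) * (sqrt z * R z)) + (sqrt z * R z)\<^sup>2"
      unfolding split[OF elim] by (simp add: power2_eq_square algebra_simps)
    also have "(complex_of_real (sqrt 2))\<^sup>2 = 2" by (simp add: of_real_power[symmetric] del: of_real_power)
    finally show ?case by simp
  qed
  show ?thesis using tendsto_cong[OF ev] lim by simp
qed

text \<open>The identity \<open>2 * (Im w)\<^sup>2 = norm (w\<^sup>2) - Re (w\<^sup>2)\<close>
  expresses the square of \<open>bes\<close> through the square of \<open>bes_osc\<close> alone, and
  the limit of the latter can be inserted because \<open>cis (2 * z)\<close> is bounded.\<close>

lemma bes_asymptotics: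
  "((\<lambda>z. z ^ 3 * (bes z)\<^sup>2 - pi * (1 - sin (2 * z))) \<longlongrightarrow> 0) at_top"
proof -
  define Y where "Y z = of_real z * (bes_osc z)\<^sup>2" for z
  have Y: "(Y \<longlongrightarrow> - \<i> * pi / 2) at_top" unfolding Y_def[abs_def] by (rule bes_osc_square)
  have eq: "z ^ 3 * (bes z)\<^sup>2 = 2 * (norm (Y z) - Re (cis (2 * z) * Y z))" if z: "0 < z" for z
  proof -
    let ?w = "cis z * bes_osc z"
    have im: "2 * (Im w)\<^sup>2 = norm (w\<^sup>2) - Re (w\<^sup>2)" for w
      unfolding norm_power cmod_power2 by (simp add: power2_eq_square)
    have "z ^ 3 * (bes z)\<^sup>2 = 2 * z * (2 * (Im ?w)\<^sup>2)"
      unfolding bes_eq_osc[OF z] using z by (simp add: power2_eq_square power3_eq_cube field_simps)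
    also have "\<dots> = 2 * (norm (of_real z * ?w\<^sup>2) - Re (of_real z * ?w\<^sup>2))"
      unfolding im using z by (simp add: norm_mult algebra_simps)
    also have "of_real z * ?w\<^sup>2 = cis (2 * z) * Y z"
      by (simp add: Y_def power_mult_distrib Complex.DeMoivre)
    finally show ?thesis by (simp add: norm_mult)
  qed
  have sin: "2 * (pi / 2 - Re (cis (2 * z) * (- \<i> * pi / 2))) = pi * (1 - sin (2 * z))" for z
    by (simp add: algebra_simps)
  have "((\<lambda>z. norm (Y z) - pi / 2) \<longlongrightarrow> norm (- \<i> * pi / 2) - pi / 2) at_top"
    by (intro tendsto_intros Y)
  hence 1: "((\<lambda>z. norm (Y z) - pi / 2) \<longlongrightarrow> 0) at_top" by (simp add: norm_mult norm_divide)
  have "((\<lambda>z. Y z - (- \<i> * pi / 2)) \<longlongrightarrow> 0) at_top" using Y LIM_zero by blast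
  hence "((\<lambda>z. cis (2 * z) * (Y z - (- \<i> * pi / 2))) \<longlongrightarrow> 0) at_top"
    by (rule Lim_null_comparison[OF always_eventually tendsto_norm_zero, rotated]) (simp add: norm_mult)
  from tendsto_Re[OF this] have 2: "((\<lambda>z. Re (cis (2 * z) * (Y z - (- \<i> * pi / 2)))) \<longlongrightarrow> 0) at_top" by simp
  have "((\<lambda>z. 2 * ((norm (Y z) - pi / 2) - Re (cis (2 * z) * (Y z - (- \<i> * pi / 2))))) \<longlongrightarrow> 2 * (0 - 0)) at_top"
    by (intro tendsto_intros 1 2)
  moreover have "\<forall>\<^sub>F z in at_top. 2 * ((norm (Y z) - pi / 2) - Re (cis (2 * z) * (Y z - (- \<i> * pi / 2))))
     = z ^ 3 * (bes z)\<^sup>2 - pi * (1 - sin (2 * z))"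
    using eventually_gt_at_top[of 0]
  proof eventually_elim
    case (elim z)
    have "Re (cis (2 * z) * (Y z - (- \<i> * pi / 2))) = Re (cis (2 * z) * Y z) - Re (cis (2 * z) * (- \<i> * pi / 2))"
      by (simp only: right_diff_distrib minus_complex.sel)
    thus ?case unfolding eq[OF elim] sin[symmetric] by (simp only: right_diff_distrib)
  qed
  ultimately show ?thesis by (simp add: tendsto_cong)
qed

lemma bes_bound: "\<exists>C. \<forall>z>0. z ^ 3 * (bes z)\<^sup>2 \<le> C"
proof -
  have "\<forall>\<^sub>F z in at_top. norm (z ^ 3 * (bes z)\<^sup>2 - pi * (1 - sin (2 * z))) < 1"
    using tendstoD[OF bes_asymptotics, of 1] by (simp add: dist_norm)
  then obtain Z where Z: "\<And>z. z \<ge> Z \<Longrightarrow> \<bar>z ^ 3 * (bes z)\<^sup>2 - pi * (1 - sin (2 * z))\<bar> < 1"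
    by (auto simp: eventually_at_top_linorder)
  show ?thesis
  proof (intro exI[of _ "max (1 + pi * 2) (Z ^ 3 * 4)"] allI impI)
    fix z :: real assume z: "0 < z"
    show "z ^ 3 * (bes z)\<^sup>2 \<le> max (1 + pi * 2) (Z ^ 3 * 4)"
    proof (cases "z \<ge> Z")
      case True
      have "1 - sin (2 * z) \<le> 2" using sin_ge_minus_one[of "2 * z"] by linarith
      hence "pi * (1 - sin (2 * z)) \<le> pi * 2" by (intro mult_left_mono) auto
      thus ?thesis using Z[OF True] by linarith
    next
      case False
      have "z ^ 3 \<le> Z ^ 3" using False z by (intro power_mono) auto
      moreover have "(bes z)\<^sup>2 \<le> 2\<^sup>2" using abs_bes_le[of z] by (intro abs_le_square_iff[THEN iffD1]) auto
      ultimately have "z ^ 3 * (bes z)\<^sup>2 \<le> Z ^ 3 * 4" using z False by (intro mult_mono) auto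
      thus ?thesis by simp
    qed
  qed
qed

subsection \<open>Exponential sums with reciprocal phase\<close>

text \<open>Abel summation: the decrements of \<open>b\<close> telescope, so every partial sum of
  \<open>a\<close> has to be controlled, not only the full one.\<close>

lemma norm_sum_antimono_weights_le:
  fixes a :: "nat \<Rightarrow> complex" and b :: "nat \<Rightarrow> real"
  assumes b: "\<And>i. b (Suc i) \<le> b i" "\<And>i. 0 \<le> b i"
    and a: "\<And>n. n \<le> N \<Longrightarrow> norm (\<Sum>i<n. a i) \<le> M"
  shows "norm (\<Sum>i<N. of_real (b i) * a i) \<le> M * b 0"
proof -
  define A where "A n = (\<Sum>i<n. a i)" for n
  have eq: "(\<Sum>i<n. of_real (b i) * a i) =
    of_real (b n) * A n + (\<Sum>i<n. of_real (b i - b (Suc i)) * A (Suc i))" for n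
    by (induction n) (simp_all add: A_def algebra_simps)
  have "norm (\<Sum>i<N. of_real (b i - b (Suc i)) * A (Suc i)) \<le> (\<Sum>i<N. (b i - b (Suc i)) * M)"
  proof (rule sum_norm_le)
    fix i assume "i \<in> {..<N}"
    hence "norm (A (Suc i)) \<le> M" using a[of "Suc i"] by (simp add: A_def del: sum.lessThan_Suc)
    thus "norm (of_real (b i - b (Suc i)) * A (Suc i)) \<le> (b i - b (Suc i)) * M"
      using b(1)[of i] by (simp add: norm_mult mult_left_mono del: of_real_diff)
  qed
  also have "\<dots> = (b 0 - b N) * M"
    by (simp add: sum_distrib_right[symmetric] sum_lessThan_telescope')
  finally have 1: "norm (\<Sum>i<N. of_real (b i - b (Suc i)) * A (Suc i)) \<le> (b 0 - b N) * M" .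
  have 2: "norm (of_real (b N) * A N) \<le> b N * M"
    using a[of N] b(2)[of N] by (simp add: norm_mult A_def mult_left_mono)
  show ?thesis unfolding eq
    by (rule order.trans[OF norm_triangle_ineq]) (use 1 2 in \<open>simp add: algebra_simps\<close>)
qed

section \<open>The Kusmin-Landau bound\<close>

definition fwd_diff :: "(nat \<Rightarrow> real) \<Rightarrow> nat \<Rightarrow> real" where
  "fwd_diff u n = u (Suc n) - u n"

text \<open>The closed form -1/2 - (\<i>/2) cot(d/2) of the inverse of \<open>cis d - 1\<close>. Its
  real part does not depend on \<open>d\<close>, so only a monotone cotangent varies.\<close>

lemma inverse_cis_minus_one:
  assumes "0 < d" "d \<le> 1"
  shows "Complex (-1/2) (- (1 / (2 * tan (d/2)))) * (cis d - 1) = 1"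
proof -
  have s: "sin (d/2) \<noteq> 0" using assms pi_gt3 by (intro less_imp_neq[symmetric] sin_gt_zero) auto
  have c: "cos (d/2) \<noteq> 0" using assms pi_gt3 by (intro less_imp_neq[symmetric] cos_gt_zero) auto
  have dd: "cos d = 1 - 2 * (sin (d/2))^2" "sin d = 2 * sin (d/2) * cos (d/2)"
    using cos_double_sin[of "d/2"] sin_double[of "d/2"] by simp_all
  have r: "Re (Complex (-1/2) (- (1 / (2 * tan (d/2)))) * (cis d - 1)) = 1"
    using s c sin_cos_squared_add3[of "d/2"] by (simp add: dd tan_def power2_eq_square field_simps del: sin_cos_squared_add3)
  have i: "Im (Complex (-1/2) (- (1 / (2 * tan (d/2)))) * (cis d - 1)) = 0"
    using s c by (simp add: dd tan_def power2_eq_square field_simps)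
  show ?thesis using r i by (simp add: complex_eq_iff)
qed

lemma inverse_tan_le: "0 < x \<Longrightarrow> x < pi/2 \<Longrightarrow> 1 / tan x \<le> 1 / (x::real)"
proof -
  assume x: "0 < x" "x < pi/2"
  have "x \<le> tan x"
    using arctan_le_self[of "tan x"] arctan_tan[of x] x tan_gt_zero[of x] by simp
  thus ?thesis using x by (simp add: frac_le)
qed

text \<open>Each term is \<open>c n\<close> times an increment of \<open>cis (u n)\<close>. Abel
  summation moves the differences onto \<open>c\<close>; its real part is constant and its imaginary
  part is monotone, so its total variation telescopes. The total is twice 1/2 + 1/lam plus 1/lam,
  which is at most 4/lam because lam is at most 1.\<close>

lemma kusmin_landau:
  assumes mono: "\<And>n. fwd_diff u (Suc n) \<le> fwd_diff u n"
    and lam: "0 < lam" "\<And>n. n < N \<Longrightarrow> lam \<le> fwd_diff u n" and up: "\<And>n. fwd_diff u n \<le> 1"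
  shows "norm (\<Sum>n<N. cis (u n)) \<le> 4 / lam"
proof (cases N)
  case 0 thus ?thesis using lam by simp
next
  case (Suc M)
  define g where "g n = 1 / (2 * tan (fwd_diff u n / 2))" for n
  define c where "c n = Complex (-1/2) (- g n)" for n
  define E where "E n = cis (u n)" for n
  have pos: "0 < fwd_diff u n" if "n < N" for n using lam(2)[OF that] lam(1) by linarith
  have lam1: "lam \<le> 1" using lam(2)[of 0] up[of 0] Suc by force
  have eqn: "E n = c n * (E (Suc n) - E n)" if "n < N" for n
  proof -
    have "E (Suc n) - E n = E n * (cis (fwd_diff u n) - 1)"
      by (simp add: E_def fwd_diff_def cis_mult algebra_simps)
    thus ?thesis using inverse_cis_minus_one[OF pos[OF that] up[of n]]
      by (simp add: c_def g_def mult.left_commute)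
  qed
  have abel: "(\<Sum>n<Suc m. c n * (E (Suc n) - E n)) =
     c m * E (Suc m) - c 0 * E 0 - (\<Sum>n<m. (c (Suc n) - c n) * E (Suc n))" for m
    by (induction m) (simp_all add: algebra_simps)
  have pi4: "pi / 2 > 1" using pi_gt3 by simp
  have g_mono: "g n \<le> g (Suc n)" if "Suc n < N" for n
  proof -
    have "tan (fwd_diff u (Suc n) / 2) \<le> tan (fwd_diff u n / 2)"
      using pos[of "Suc n"] that mono[of n] up[of n] pi4
      by (intro tan_mono_le) auto
    moreover have "0 < tan (fwd_diff u (Suc n) / 2)"
      using pos[of "Suc n"] that up[of "Suc n"] pi4 by (intro tan_gt_zero) auto
    ultimately show ?thesis unfolding g_def by (intro divide_left_mono) auto
  qed
  have g_bd: "0 \<le> g n \<and> g n \<le> 1 / lam" if "n < N" for n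
  proof -
    have "0 < tan (fwd_diff u n / 2)"
      using pos[of n] that up[of n] pi4 by (intro tan_gt_zero) auto
    moreover have "1 / tan (fwd_diff u n / 2) \<le> 1 / (fwd_diff u n / 2)"
      using pos[of n] that up[of n] pi4 by (intro inverse_tan_le) auto
    moreover have "1 / fwd_diff u n \<le> 1 / lam" using lam(2)[OF that] lam(1) by (simp add: frac_le)
    moreover have "g n = (1 / tan (fwd_diff u n / 2)) / 2" by (simp add: g_def)
    ultimately show ?thesis by simp
  qed
  have nE: "norm (E n) = 1" for n by (simp add: E_def)
  have nc: "norm (c n) \<le> 1/2 + 1 / lam" if "n < N" for n
    using cmod_le[of "c n"] g_bd[OF that] by (simp add: c_def) 
  have "norm (\<Sum>n<M. (c (Suc n) - c n) * E (Suc n)) \<le> (\<Sum>n<M. g (Suc n) - g n)"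
  proof (rule sum_norm_le)
    fix n assume "n \<in> {..<M}"
    hence "g n \<le> g (Suc n)" using g_mono[of n] Suc by simp
    moreover have "c (Suc n) - c n = Complex 0 (g n - g (Suc n))"
      by (simp add: c_def complex_eq_iff)
    ultimately show "norm ((c (Suc n) - c n) * E (Suc n)) \<le> g (Suc n) - g n"
      by (simp add: norm_mult nE complex_norm)
  qed
  also have "\<dots> = g M - g 0" by (rule sum_lessThan_telescope)
  also have "\<dots> \<le> 1 / lam" using g_bd[of M] g_bd[of 0] Suc by simp
  finally have 1: "norm (\<Sum>n<M. (c (Suc n) - c n) * E (Suc n)) \<le> 1 / lam" .
  have "(\<Sum>n<N. cis (u n)) = (\<Sum>n<Suc M. c n * (E (Suc n) - E n))"
    unfolding Suc[symmetric] using eqn by (intro sum.cong) (auto simp: E_def)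
  also have "norm \<dots> \<le> norm (c M * E (Suc M)) + norm (c 0 * E 0) + 1 / lam"
    unfolding abel by (rule order.trans[OF norm_triangle_ineq4] add_mono norm_triangle_ineq4 1)+
  also have "\<dots> \<le> (1/2 + 1 / lam) + (1/2 + 1 / lam) + 1 / lam"
    using nc[of M] nc[of 0] Suc by (intro add_mono) (auto simp: norm_mult nE)
  also have "\<dots> \<le> 4 / lam" using lam(1) lam1 by (simp add: field_simps)
  finally show ?thesis .
qed

section \<open>Van der Corput differencing and difference tests of higher order\<close>

lemma norm_sum_shift_le:
  fixes z :: "nat \<Rightarrow> complex"
  assumes "\<And>n. norm (z n) \<le> 1"
  shows "norm ((\<Sum>n<N. z (n + h)) - (\<Sum>n<N. z n)) \<le> 2 * real h"
proof (induction h)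
  case (Suc h)
  have "(\<Sum>n<N. z (n + Suc h)) - (\<Sum>n<N. z (n + h)) = z (N + h) - z h"
    by (induction N) (simp_all add: algebra_simps)
  moreover have "norm (z (N + h) - z h) \<le> 2"
    using norm_triangle_ineq4[of "z (N + h)" "z h"] assms[of "N + h"] assms[of h] by linarith
  ultimately have "norm ((\<Sum>n<N. z (n + Suc h)) - (\<Sum>n<N. z (n + h))) \<le> 2" by simp
  with Suc.IH norm_triangle_ineq[of "(\<Sum>n<N. z (n + Suc h)) - (\<Sum>n<N. z (n + h))"
      "(\<Sum>n<N. z (n + h)) - (\<Sum>n<N. z n)"]
  show ?case by simp
qed simp

text \<open>Average the sum over \<open>H\<close> shifts, apply Cauchy-Schwarz in \<open>n\<close>
  and expand the square. The diagonal gives the term N^2/H, the rest are correlations at distances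
  below \<open>H\<close>, and each change of summation range costs at most \<open>2 * H\<close>
  terms of modulus at most 1.\<close>

lemma van_der_corput_inequality:
  fixes z :: "nat \<Rightarrow> complex" and H N :: nat
  assumes z: "\<And>n. norm (z n) \<le> 1" and H: "1 \<le> H" and B: "0 \<le> B"
    and corr: "\<And>h. 0 < h \<Longrightarrow> h < H \<Longrightarrow> norm (\<Sum>n<N-h. z (n + h) * cnj (z n)) \<le> B"
  shows "norm (\<Sum>n<N. z n) \<le> 2 * real H + sqrt ((real N)\<^sup>2 / H + N * (B + 2 * real H))"
proof -
  define T where "T h h' = (\<Sum>n<N. z (n + h) * cnj (z (n + h')))" for h h'
  define W where "W n = (\<Sum>h<H. z (n + h))" for n
  have diag: "norm (T h h) \<le> N" for h
  proof -
    have "norm (T h h) \<le> (\<Sum>n<N. 1)" unfolding T_def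
    proof (rule sum_norm_le)
      fix n show "norm (z (n + h) * cnj (z (n + h))) \<le> 1"
        using mult_mono[OF z[of "n+h"] z[of "n+h"]] by (simp add: norm_mult)
    qed
    thus ?thesis by simp
  qed
  \<comment> \<open>Moving the range by \<open>h'\<close> costs \<open>2 * h'\<close> and extending
    it from \<open>N - d\<close> to \<open>N\<close> costs \<open>d = h - h'\<close>; together this
    is \<open>h + h'\<close>, below \<open>2 * H\<close>.\<close>
  have off: "norm (T h h') \<le> B + 2 * real H" if hh: "h' < h" "h < H" for h h'
  proof -
    define d where "d = h - h'"
    define y where "y m = z (m + d) * cnj (z m)" for m
    have ny: "norm (y m) \<le> 1" for m
      using mult_mono[OF z[of "m+d"] z[of m]] by (simp add: norm_mult y_def)
    have T_eq: "T h h' = (\<Sum>n<N. y (n + h'))" using hh by (simp add: T_def y_def d_def)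
    have "norm ((\<Sum>n<N. y (n + h')) - (\<Sum>n<N. y n)) \<le> 2 * real h'"
      by (rule norm_sum_shift_le[OF ny])
    moreover have "norm (\<Sum>n<N-d. y n) \<le> B" using corr[of d] hh by (simp add: y_def d_def)
    moreover have "norm ((\<Sum>n<N. y n) - (\<Sum>n<N-d. y n)) \<le> d"
    proof -
      have "(\<Sum>n<N. y n) - (\<Sum>n<N-d. y n) = (\<Sum>n\<in>{..<N} - {..<N-d}. y n)"
        by (subst sum_diff) auto
      also have "norm \<dots> \<le> (\<Sum>n\<in>{..<N} - {..<N-d}. 1)" by (rule sum_norm_le) (rule ny)
      also have "\<dots> = card ({..<N} - {..<N-d})" by simp
      also have "card ({..<N} - {..<N-d}) \<le> d" by (subst card_Diff_subset) auto
      finally show ?thesis by simp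
    qed
    moreover have "norm (\<Sum>n<N. y (n + h')) \<le> norm ((\<Sum>n<N. y (n + h')) - (\<Sum>n<N. y n)) +
        (norm ((\<Sum>n<N. y n) - (\<Sum>n<N-d. y n)) + norm (\<Sum>n<N-d. y n))"
      by (smt (verit) norm_triangle_sub)
    moreover have "2 * real h' + d \<le> 2 * real H" using hh by (simp add: d_def)
    ultimately show ?thesis unfolding T_eq by linarith
  qed
  have cnjT: "norm (T h h') = norm (T h' h)" for h h'
  proof -
    have "cnj (T h h') = T h' h" by (simp add: T_def mult.commute)
    thus ?thesis by (metis complex_mod_cnj)
  qed
  have bd: "norm (T h h') \<le> (if h = h' then real N else 0) + (B + 2 * real H)" if "h < H" "h' < H" for h h'
    using diag[of h] off[of h h'] off[of h' h] cnjT[of h h'] that B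
    by (cases h h' rule: linorder_cases) auto
  have "complex_of_real (\<Sum>n<N. (norm (W n))\<^sup>2) = (\<Sum>n<N. W n * cnj (W n))"
    unfolding of_real_sum by (intro sum.cong refl complex_norm_square)
  also have "\<dots> = (\<Sum>n<N. \<Sum>h<H. \<Sum>h'<H. z (n + h) * cnj (z (n + h')))"
    by (simp add: W_def sum_product cnj_sum)
  also have "\<dots> = (\<Sum>h<H. \<Sum>n<N. \<Sum>h'<H. z (n + h) * cnj (z (n + h')))" by (rule sum.swap)
  also have "\<dots> = (\<Sum>h<H. \<Sum>h'<H. T h h')"
    unfolding T_def by (rule sum.cong[OF refl], rule sum.swap)
  finally have W_eq: "complex_of_real (\<Sum>n<N. (norm (W n))\<^sup>2) = (\<Sum>h<H. \<Sum>h'<H. T h h')" .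
  have "(\<Sum>n<N. (norm (W n))\<^sup>2) = \<bar>\<Sum>n<N. (norm (W n))\<^sup>2\<bar>" by (simp add: sum_nonneg)
  also have "\<dots> = norm (\<Sum>h<H. \<Sum>h'<H. T h h')" unfolding W_eq[symmetric] norm_of_real ..
  also have "\<dots> \<le> (\<Sum>h<H. \<Sum>h'<H. (if h = h' then real N else 0) + (B + 2 * real H))"
    by (intro sum_norm_le bd) auto
  also have "\<dots> = H * N + H * (H * (B + 2 * real H))"
    by (simp add: sum.distrib algebra_simps)
  finally have sq: "(\<Sum>n<N. (norm (W n))\<^sup>2) \<le> H * N + H * (H * (B + 2 * real H))" .
  have "(norm (\<Sum>n<N. W n))\<^sup>2 \<le> (\<Sum>n<N. norm (W n))\<^sup>2"
    by (intro power_mono norm_sum) auto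
  also have "\<dots> \<le> (\<Sum>n<N. (norm (W n))\<^sup>2) * card {..<N}"
    by (rule sum_squared_le_sum_of_squares) 
  also have "\<dots> \<le> (H * N + H * (H * (B + 2 * real H))) * N"
    using sq by (simp add: mult_right_mono)
  also have "\<dots> = (real H)\<^sup>2 * ((real N)\<^sup>2 / H + N * (B + 2 * real H))"
    using H by (simp add: power2_eq_square field_simps)
  finally have "norm (\<Sum>n<N. W n) \<le> sqrt ((real H)\<^sup>2 * ((real N)\<^sup>2 / H + N * (B + 2 * real H)))"
    by (rule real_le_rsqrt)
  hence W: "norm (\<Sum>n<N. W n) \<le> H * sqrt ((real N)\<^sup>2 / H + N * (B + 2 * real H))"
    by (simp add: real_sqrt_mult)
  have "(\<Sum>n<N. W n) - of_nat H * (\<Sum>n<N. z n) = (\<Sum>h<H. (\<Sum>n<N. z (n + h)) - (\<Sum>n<N. z n))"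
    unfolding W_def by (subst sum.swap) (simp add: sum_subtractf)
  also have "norm \<dots> \<le> (\<Sum>h<H. 2 * real H)"
  proof (rule sum_norm_le)
    fix h assume "h \<in> {..<H}"
    thus "norm ((\<Sum>n<N. z (n + h)) - (\<Sum>n<N. z n)) \<le> 2 * real H"
      using order.trans[OF norm_sum_shift_le[where z = z and N = N and h = h, OF z], of "2 * real H"] by simp
  qed
  finally have D: "norm ((\<Sum>n<N. W n) - of_nat H * (\<Sum>n<N. z n)) \<le> H * (2 * real H)" by simp
  have "H * norm (\<Sum>n<N. z n) = norm (of_nat H * (\<Sum>n<N. z n))" by (simp add: norm_mult)
  also have "\<dots> \<le> norm ((\<Sum>n<N. W n) - of_nat H * (\<Sum>n<N. z n)) + norm (\<Sum>n<N. W n)"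
    by (metis norm_triangle_sub norm_minus_commute add.commute)
  also have "\<dots> \<le> H * (2 * real H + sqrt ((real N)\<^sup>2 / H + N * (B + 2 * real H)))"
    using D W by (simp add: algebra_simps)
  finally show ?thesis using H by simp
qed

text \<open>The hypothesis of the difference test of order \<open>k\<close> in scale-free form: the
  differences are at most 1/C, yet so large that they add up to at least \<open>C\<close> over the
  block. As a predicate it can be handed from \<open>u\<close> to the differenced phases in the
  induction.\<close>

definition vdc_cond :: "real \<Rightarrow> nat \<Rightarrow> (nat \<Rightarrow> real) \<Rightarrow> nat \<Rightarrow> real \<Rightarrow> bool" where
  "vdc_cond C k u N lam \<longleftrightarrow> (\<forall>n. (fwd_diff ^^ k) u (Suc n) \<le> (fwd_diff ^^ k) u n) \<and>
     (\<forall>n. (fwd_diff ^^ k) u n \<le> 1 / C) \<and> (\<forall>n<N. lam \<le> (fwd_diff ^^ k) u n) \<and> C \<le> lam * N"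

text \<open>Differencing the phase at distance \<open>h\<close> trades order \<open>k\<close> for a
  sum of \<open>h\<close> differences of order \<open>k + 1\<close>, which keeps monotonicity and
  the lower bound and multiplies the upper bound by at most \<open>h\<close>.\<close>

lemma fwd_diff_shift_diff:
  "(fwd_diff ^^ k) (\<lambda>n. u (n + h) - u n) n = (\<Sum>i<h. (fwd_diff ^^ Suc k) u (n + i))"
proof -
  have "(fwd_diff ^^ k) (\<lambda>n. u (n + h) - u n) = (\<lambda>n. (fwd_diff ^^ k) u (n + h) - (fwd_diff ^^ k) u n)"
    by (induction k) (auto simp: fwd_diff_def fun_eq_iff)
  moreover have "(\<Sum>i<h. (fwd_diff ^^ Suc k) u (n + i)) = (fwd_diff ^^ k) u (n + h) - (fwd_diff ^^ k) u n"
    by (induction h) (auto simp: fwd_diff_def)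
  ultimately show ?thesis by simp
qed

text \<open>Van der Corput's inequality lowers the order of the difference by one; the base case is the Kusmin-Landau bound.\<close>

lemma vdc_small:
  "\<exists>C>0. \<forall>u N lam. vdc_cond C (Suc k) u N lam \<longrightarrow> norm (\<Sum>n<N. cis (u n)) \<le> e * real N"
  if "0 < e" for e :: real
  using that
proof (induction k arbitrary: e)
  case 0
  show ?case
  proof (intro exI[of _ "max 1 (4 / e)"] conjI allI impI)
    fix u N lam assume *: "vdc_cond (max 1 (4 / e)) (Suc 0) u N lam"
    let ?C = "max 1 (4 / e)"
    have NC: "?C \<le> lam * N" and C1: "?C > 0" using * by (auto simp: vdc_cond_def)
    hence "0 < lam * N" by linarith
    hence lam: "0 < lam" by (simp add: zero_less_mult_iff)
    have "1 / ?C \<le> 1" by simp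
    hence up: "fwd_diff u n \<le> 1" for n using * unfolding vdc_cond_def by (auto intro: order.trans)
    have "norm (\<Sum>n<N. cis (u n)) \<le> 4 / lam"
      using * lam up by (intro kusmin_landau) (auto simp: vdc_cond_def)
    also have "\<dots> \<le> e * N"
    proof -
      have "4 / e \<le> lam * N" using NC by linarith
      thus ?thesis using lam 0 by (simp add: field_simps)
    qed
    finally show "norm (\<Sum>n<N. cis (u n)) \<le> e * real N" .
  qed auto
next
  case (Suc k)
  \<comment> \<open>With 1/H and the relative size of the correlations both at most
    \<open>e1\<close>, the radicand is at most \<open>3 * e1 * N\<^sup>2\<close>, hence below the
    square of \<open>e / 2 * N\<close>.\<close>
  define e1 where "e1 = e^2 / 16"
  have e1: "0 < e1" using Suc.prems by (simp add: e1_def)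
  obtain C1 where C1: "C1 > 0" "\<And>u N lam. vdc_cond C1 (Suc k) u N lam \<Longrightarrow> norm (\<Sum>n<N. cis (u n)) \<le> e1 * real N"
    using Suc.IH[OF e1] by blast
  obtain H :: nat where H: "1 \<le> H" "1 / H \<le> e1"
  proof -
    obtain H :: nat where "1 / e1 < H" using reals_Archimedean2 by blast
    moreover hence "0 < real H" using e1 by (meson divide_pos_pos less_trans zero_less_one)
    ultimately have "1 \<le> H" "1 / H \<le> e1" using e1 by (auto simp: field_simps)
    thus ?thesis by (rule that)
  qed
  \<comment> \<open>In order, the entries ensure that \<open>N\<close> is at least \<open>C\<close>,
    that the upper bound survives \<open>h < H\<close> summands, that halving the block keeps
    \<open>lam * N\<close> large, that \<open>N - h\<close> is at least \<open>N / 2\<close>, that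
    \<open>2 * H\<close> is at most \<open>e / 2 * N\<close>, and that \<open>2 * H\<close> is at
    most \<open>e1 * N\<close>.\<close>
  define C where "C = Max {1, H * C1, 2 * C1, 2 * real H, 4 * real H / e, 2 * real H / e1}"
  have C: "1 \<le> C" "H * C1 \<le> C" "2 * C1 \<le> C" "2 * real H \<le> C" "4 * real H / e \<le> C" "2 * real H / e1 \<le> C"
    unfolding C_def by (auto intro!: Max_ge)
  show ?case
  proof (intro exI[of _ C] conjI allI impI)
    show "C > 0" using C by linarith
  next
    fix u N lam assume *: "vdc_cond C (Suc (Suc k)) u N lam"
    have NC: "C \<le> lam * N" using * by (auto simp: vdc_cond_def)
    hence "0 < lam * N" using C by linarith
    hence lam: "0 < lam" "0 < N" by (auto simp: zero_less_mult_iff)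
    have "lam \<le> 1 / C" using * lam unfolding vdc_cond_def by (meson order.trans)
    also have "1 / C \<le> 1" using C(1) by simp
    finally have "lam \<le> 1" .
    hence "lam * N \<le> N" using lam by simp
    hence N: "C \<le> N" using NC by linarith
    have corr: "norm (\<Sum>n<N-h. cis (u (n + h)) * cnj (cis (u n))) \<le> e1 * N" if h: "0 < h" "h < H" for h
    proof -
      have N2: "real (N - h) \<ge> N / 2" using N C(4) h by (simp add: of_nat_diff)
      have "vdc_cond C1 (Suc k) (\<lambda>n. u (n + h) - u n) (N - h) lam"
        unfolding vdc_cond_def fwd_diff_shift_diff
      proof (intro conjI allI impI)
        fix n
        show "(\<Sum>i<h. (fwd_diff ^^ Suc (Suc k)) u (Suc n + i)) \<le> (\<Sum>i<h. (fwd_diff ^^ Suc (Suc k)) u (n + i))"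
          using * unfolding vdc_cond_def by (intro sum_mono) auto
        have "(\<Sum>i<h. (fwd_diff ^^ Suc (Suc k)) u (n + i)) \<le> (\<Sum>i<h. 1 / C)"
          using * unfolding vdc_cond_def by (intro sum_mono) auto
        also have "\<dots> \<le> H * (1 / C)" using h C(1) by (simp add: divide_right_mono)
        also have "\<dots> \<le> 1 / C1" using C(2) C1 C(1) by (simp add: field_simps)
        finally show "(\<Sum>i<h. (fwd_diff ^^ Suc (Suc k)) u (n + i)) \<le> 1 / C1" .
      next
        fix n assume n: "n < N - h"
        have "lam \<le> h * lam" using h lam by simp
        also have "\<dots> = (\<Sum>i<h. lam)" by simp
        also have "\<dots> \<le> (\<Sum>i<h. (fwd_diff ^^ Suc (Suc k)) u (n + i))"
          using * n unfolding vdc_cond_def by (intro sum_mono) auto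
        finally show "lam \<le> (\<Sum>i<h. (fwd_diff ^^ Suc (Suc k)) u (n + i))" .
      next
        have "lam * (N / 2) \<le> lam * real (N - h)" using N2 lam by simp
        moreover have "2 * C1 \<le> lam * N" using C(3) NC by linarith
        ultimately show "C1 \<le> lam * real (N - h)" by simp
      qed
      hence "norm (\<Sum>n<N-h. cis (u (n + h) - u n)) \<le> e1 * real (N - h)" by (rule C1(2))
      also have "\<dots> \<le> e1 * N" using e1 by simp
      finally show ?thesis by (simp add: cis_cnj cis_mult)
    qed
    have "norm (\<Sum>n<N. cis (u n)) \<le> 2 * real H + sqrt ((real N)\<^sup>2 / H + N * (e1 * N + 2 * real H))"
      using H e1 corr by (intro van_der_corput_inequality) auto
    also have "\<dots> \<le> 2 * real H + sqrt ((e / 2 * N)\<^sup>2)"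
    proof -
      have a: "(real N)\<^sup>2 * (1 / H) \<le> (real N)\<^sup>2 * e1" using H(2) by (intro mult_left_mono) auto
      have "2 * real H \<le> e1 * C" using C(6) e1 by (simp add: field_simps)
      also have "\<dots> \<le> e1 * N" using N e1 by simp
      finally have b: "N * (e1 * N + 2 * real H) \<le> N * (2 * (e1 * N))" by (intro mult_left_mono) auto
      have "(real N)\<^sup>2 / H + N * (e1 * N + 2 * real H) \<le> 3 * ((real N)\<^sup>2 * e1)"
        using a b by (simp add: power2_eq_square algebra_simps)
      also have "\<dots> \<le> (e / 2 * N)\<^sup>2" using Suc.prems by (simp add: e1_def power2_eq_square algebra_simps)
      finally show ?thesis by (intro add_left_mono real_sqrt_le_mono)
    qed
    also have "\<dots> = 2 * real H + e / 2 * N" using Suc.prems by simp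
    also have "\<dots> \<le> e * N"
    proof -
      have "4 * real H / e \<le> N" using C(5) N by linarith
      thus ?thesis using Suc.prems by (simp add: field_simps)
    qed
    finally show "norm (\<Sum>n<N. cis (u n)) \<le> e * real N" .
  qed
qed

section \<open>Difference tests for the phase T/n\<close>

lemma fwd_diff_funpow_reciprocal:
  "(fwd_diff ^^ k) (\<lambda>n. T / real (D + n)) n =
     (-1) ^ k * fact k * T / pochhammer (real (D + n)) (Suc k)" if "1 \<le> D"
proof (induction k arbitrary: n)
  case (Suc k)
  define x where "x = real (D + n)"
  have x: "0 < x" using that by (simp add: x_def)
  define p where "p = pochhammer (x + 1) k"
  have p: "0 < p" unfolding p_def using x by (intro pochhammer_pos) simp
  have 1: "pochhammer (x + 1) (Suc k) = p * (x + 1 + real k)"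
    by (simp add: p_def pochhammer_Suc)
  have 2: "pochhammer x (Suc k) = x * p"
    by (simp add: p_def pochhammer_rec)
  have 3: "pochhammer x (Suc (Suc k)) = x * (p * (x + 1 + real k))"
    by (subst pochhammer_rec) (simp only: 1)
  have "(fwd_diff ^^ Suc k) (\<lambda>n. T / real (D + n)) n
     = (-1) ^ k * fact k * T / pochhammer (x + 1) (Suc k) - (-1) ^ k * fact k * T / pochhammer x (Suc k)"
    using Suc.IH[of "Suc n"] Suc.IH[of n] by (simp add: fwd_diff_def[of "(fwd_diff ^^ k) _"] x_def ac_simps)
  also have "\<dots> = (-1) ^ Suc k * fact (Suc k) * T / pochhammer x (Suc (Suc k))"
  proof -
    define a where "a = (-1) ^ k * fact k * T"
    define y where "y = x + 1 + real k"
    have y: "0 < y" using x by (simp add: y_def)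
    have "a / (p * y) - a / (x * p) = a * (x - y) / (x * (p * y))"
      using x p y by (simp add: field_simps)
    also have "a * (x - y) = (-1) ^ Suc k * fact (Suc k) * T"
      by (simp add: y_def a_def algebra_simps)
    finally show ?thesis unfolding 1 2 3 y_def a_def .
  qed
  finally show ?case by (simp add: x_def)
qed simp

lemma pochhammer_bounds:
  fixes x :: real assumes "0 \<le> x"
  shows "x ^ k \<le> pochhammer x k" "pochhammer x k \<le> (x + k) ^ k"
proof -
  have "(\<Prod>i<k. x) \<le> (\<Prod>i<k. x + real i)" using assms by (intro prod_mono) auto
  thus "x ^ k \<le> pochhammer x k" by (simp add: pochhammer_prod atLeast0LessThan)
  have "(\<Prod>i<k. x + real i) \<le> (\<Prod>i<k. x + k)" using assms by (intro prod_mono) auto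
  thus "pochhammer x k \<le> (x + k) ^ k" by (simp add: pochhammer_prod atLeast0LessThan)
qed

lemma pochhammer_le_add_one:
  fixes x :: real assumes "0 \<le> x"
  shows "pochhammer x k \<le> pochhammer (x + 1) k"
proof -
  have "(\<Prod>i<k. x + real i) \<le> (\<Prod>i<k. x + 1 + real i)" using assms by (intro prod_mono) auto
  thus ?thesis by (simp add: pochhammer_prod atLeast0LessThan)
qed

text \<open>For indices between \<open>D\<close> and \<open>2 * D\<close> the k-th difference of the
  phase has size T/D^(k+1) up to constants. The two conditions on \<open>C\<close> say that this is
  small and that its sum over the block, of size T/D^k, is large.\<close>

lemma reciprocal_phase_block:
  fixes e :: real
  assumes k: "1 \<le> k" and e: "0 < e"
  shows "\<exists>C>0. \<forall>D N T. 1 \<le> D \<and> N \<le> D \<and> 0 < T \<and> C * T \<le> real D ^ (k + 1) \<and> C * real D ^ k \<le> T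
     \<longrightarrow> norm (\<Sum>n<N. cis (T / real (D + n))) \<le> e * D"
proof -
  obtain k' where k': "k = Suc k'" using k by (cases k) auto
  obtain C0 where C0: "C0 > 0"
    "\<And>u N lam. vdc_cond C0 k u N lam \<Longrightarrow> norm (\<Sum>n<N. cis (u n)) \<le> e * real N"
    using vdc_small[OF e, of k'] unfolding k' by blast
  \<comment> \<open>Bounds the Pochhammer symbol from above, since \<open>D + n + k + 1\<close> is
    at most \<open>(k + 2) * D\<close> inside the block.\<close>
  define K where "K = (real k + 2) ^ (k + 1)"
  have K: "0 < K" by (simp add: K_def)
  define C where "C = max (fact k * C0) (C0 * K / (e * fact k))"
  have C: "fact k * C0 \<le> C" "C0 * K / (e * fact k) \<le> C" by (simp_all add: C_def)
  have C_pos: "0 < C" using C0 K by (simp add: C_def less_max_iff_disj)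
  show ?thesis
  proof (intro exI[of _ C] conjI allI impI C_pos, elim conjE)
    fix D N :: nat and T :: real
    assume D: "1 \<le> D" "N \<le> D" and T: "0 < T" and 1: "C * T \<le> real D ^ (k + 1)"
      and 2: "C * real D ^ k \<le> T"
    show "norm (\<Sum>n<N. cis (T / real (D + n))) \<le> e * D"
    proof (cases "N < e * D")
      case True
      have "norm (\<Sum>n<N. cis (T / real (D + n))) \<le> (\<Sum>n<N. 1)"
        by (intro sum_norm_le) auto
      thus ?thesis using True by simp
    next
      case False
      \<comment> \<open>The sign of the k-th difference of \<open>T / x\<close>. Negating the phase
        for odd \<open>k\<close> makes the differences positive and decreasing; the sum is only
        conjugated, so its norm is unchanged.\<close>
      define s :: real where "s = (-1) ^ k"
      define u where "u n = (s * T) / real (D + n)" for n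
      define lam where "lam = fact k * T / (K * real D ^ (k + 1))"
      have ss: "s * s = 1" by (simp add: s_def power_mult_distrib[symmetric])
      have du: "(fwd_diff ^^ k) u n = fact k * T / pochhammer (real (D + n)) (Suc k)" for n
      proof -
        have "(fwd_diff ^^ k) u n = s * fact k * (s * T) / pochhammer (real (D + n)) (Suc k)"
          unfolding u_def s_def by (rule fwd_diff_funpow_reciprocal) (rule D)
        also have "s * fact k * (s * T) = (s * s) * (fact k * T)" by (simp only: ac_simps)
        finally show ?thesis by (simp add: ss)
      qed
      have poch: "0 < pochhammer (real (D + n)) (Suc k)" for n
        using D by (intro pochhammer_pos) auto
      have "vdc_cond C0 k u N lam" unfolding vdc_cond_def du
      proof (intro conjI allI impI)
        fix n
        have "pochhammer (real (D + n)) (Suc k) \<le> pochhammer (real (D + Suc n)) (Suc k)"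
          using pochhammer_le_add_one[of "real (D + n)" "Suc k"] by (simp add: ac_simps)
        thus "fact k * T / pochhammer (real (D + Suc n)) (Suc k)
            \<le> fact k * T / pochhammer (real (D + n)) (Suc k)"
          using T poch[of n] poch[of "Suc n"] by (intro divide_left_mono) auto
        have "real D ^ (k + 1) \<le> real (D + n) ^ (k + 1)" by (intro power_mono) auto
        also have "\<dots> \<le> pochhammer (real (D + n)) (Suc k)"
          using pochhammer_bounds(1)[of "real (D + n)" "Suc k"] by simp
        finally have "C * T \<le> pochhammer (real (D + n)) (Suc k)" using 1 by linarith
        moreover have "fact k * C0 * T \<le> C * T" using C(1) T by (intro mult_right_mono) auto
        ultimately show "fact k * T / pochhammer (real (D + n)) (Suc k) \<le> 1 / C0"
          using poch[of n] C0(1) by (simp add: field_simps)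
      next
        fix n assume n: "n < N"
        have "pochhammer (real (D + n)) (Suc k) \<le> (real (D + n) + real (Suc k)) ^ Suc k"
          by (rule pochhammer_bounds(2)) simp
        also have "\<dots> \<le> ((real k + 2) * D) ^ Suc k"
        proof (rule power_mono)
          have "D + n + Suc k \<le> 2 * D + k * 1" using n D by simp
          also have "\<dots> \<le> 2 * D + k * D" using D by (intro add_left_mono mult_left_mono) auto
          finally have "real (D + n + Suc k) \<le> real (2 * D + k * D)" by (simp only: of_nat_le_iff)
          thus "real (D + n) + real (Suc k) \<le> (real k + 2) * D" by (simp add: algebra_simps)
        qed auto
        also have "\<dots> = K * real D ^ (k + 1)" by (simp add: K_def power_mult_distrib)
        finally show "lam \<le> fact k * T / pochhammer (real (D + n)) (Suc k)"
          unfolding lam_def using T poch[of n] K D by (intro divide_left_mono) auto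
      next
        have "C0 * K / (e * fact k) * real D ^ k \<le> T"
          using 2 mult_right_mono[OF C(2), of "real D ^ k"] by simp
        hence "C0 * K * real D ^ k \<le> T * (e * fact k)"
          using e by (simp add: field_simps)
        hence "C0 * K * real D ^ k * D \<le> T * (e * fact k) * D" by (intro mult_right_mono) auto
        hence "C0 \<le> lam * (e * D)" using K D by (simp add: lam_def field_simps)
        also have "\<dots> \<le> lam * N"
          using False T K D by (intro mult_left_mono) (auto simp: lam_def)
        finally show "C0 \<le> lam * N" .
      qed
      hence "norm (\<Sum>n<N. cis (u n)) \<le> e * N" by (rule C0(2))
      moreover have "norm (\<Sum>n<N. cis (T / real (D + n))) = norm (\<Sum>n<N. cis (u n))"
      proof (cases "even k")
        case True thus ?thesis by (simp add: u_def s_def)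
      next
        case False
        have "(\<Sum>n<N. cis (u n)) = cnj (\<Sum>n<N. cis (T / real (D + n)))"
          using False by (simp add: u_def s_def cis_cnj)
        thus ?thesis by (simp only: complex_mod_cnj)
      qed
      moreover have "e * N \<le> e * D" using e D by simp
      ultimately show ?thesis by simp
    qed
  qed
qed

lemma card_nat_in_real_interval:
  assumes "a \<le> b"
  shows "finite {j::nat. a < real j \<and> real j < b}" "real (card {j::nat. a < real j \<and> real j < b}) \<le> b - a + 1"
proof -
  have sub: "{j::nat. a < real j \<and> real j < b} \<subseteq> nat ` {\<lfloor>a\<rfloor> + 1..\<lceil>b\<rceil> - 1}"
  proof
    fix j assume "j \<in> {j::nat. a < real j \<and> real j < b}"
    hence "int j \<in> {\<lfloor>a\<rfloor> + 1..\<lceil>b\<rceil> - 1}" by (auto simp: floor_less_iff less_ceiling_iff le_less_trans) linarith+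
    thus "j \<in> nat ` {\<lfloor>a\<rfloor> + 1..\<lceil>b\<rceil> - 1}" by force
  qed
  thus "finite {j::nat. a < real j \<and> real j < b}" by (rule finite_subset) simp
  have "card {j::nat. a < real j \<and> real j < b} \<le> card {\<lfloor>a\<rfloor> + 1..\<lceil>b\<rceil> - 1}"
    using card_mono[OF _ sub] card_image_le[of "{\<lfloor>a\<rfloor> + 1..\<lceil>b\<rceil> - 1}" nat] by fastforce
  hence "real (card {j::nat. a < real j \<and> real j < b}) \<le> real (nat (\<lceil>b\<rceil> - 1 - \<lfloor>a\<rfloor>))"
    by simp
  also have "\<dots> \<le> b - a + 1"
    using assms by linarith
  finally show "real (card {j::nat. a < real j \<and> real j < b}) \<le> b - a + 1" .
qed

lemma norm_sum_reciprocal_block_le_1: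
  fixes f :: "nat \<Rightarrow> complex"
  assumes "1 \<le> D" "N \<le> D" "\<And>n. norm (f n) \<le> 1"
  shows "norm (\<Sum>n<N. f n / of_nat (D + n)) \<le> 1"
proof -
  have "norm (\<Sum>n<N. f n / of_nat (D + n)) \<le> (\<Sum>n<N. 1 / D)"
  proof (rule sum_norm_le)
    fix n
    have "norm (f n / of_nat (D + n)) \<le> 1 / real (D + n)"
      using assms by (simp add: norm_divide divide_right_mono del: of_nat_add)
    also have "\<dots> \<le> 1 / D" using assms by (intro divide_left_mono) auto
    finally show "norm (f n / of_nat (D + n)) \<le> 1 / D" .
  qed
  also have "\<dots> \<le> 1" using assms by simp
  finally show ?thesis .
qed

text \<open>The weights decrease along the block, so Abel summation applies; this is why
  \<open>reciprocal_phase_block\<close> covers every initial segment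
  \<open>N \<le> D\<close>.\<close>

lemma reciprocal_phase_log_block:
  fixes e :: real
  assumes k: "1 \<le> k" and e: "0 < e"
  shows "\<exists>C>0. \<forall>D T. 1 \<le> D \<and> 0 < T \<and> C * T \<le> real D ^ (k + 1) \<and> C * real D ^ k \<le> T
     \<longrightarrow> norm (\<Sum>n<D. cis (T / real (D + n)) / of_nat (D + n)) \<le> e"
proof -
  obtain C where C: "C > 0" "\<And>D N T. \<lbrakk>1 \<le> D; N \<le> D; 0 < T; C * T \<le> real D ^ (k + 1); C * real D ^ k \<le> T\<rbrakk>
     \<Longrightarrow> norm (\<Sum>n<N. cis (T / real (D + n))) \<le> e * D"
    using reciprocal_phase_block[OF assms] by blast
  show ?thesis
  proof (intro exI[of _ C] conjI allI impI C(1), elim conjE)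
    fix D :: nat and T :: real
    assume *: "1 \<le> D" "0 < T" "C * T \<le> real D ^ (k + 1)" "C * real D ^ k \<le> T"
    have "norm (\<Sum>n<D. of_real (1 / real (D + n)) * cis (T / real (D + n))) \<le> (e * D) * (1 / real (D + 0))"
      using * by (intro norm_sum_antimono_weights_le C(2)) (auto intro!: divide_left_mono)
    thus "norm (\<Sum>n<D. cis (T / real (D + n)) / of_nat (D + n)) \<le> e"
      using * by (simp add: field_simps)
  qed
qed

lemma sum_dyadic:
  fixes a :: "nat \<Rightarrow> complex"
  shows "(\<Sum>n\<in>{1..<2^J}. a n) = (\<Sum>j<J. \<Sum>n<2^j. a (2^j + n))"
proof (induction J)
  case (Suc J)
  have "{1..<(2::nat)^Suc J} = {1..<2^J} \<union> {2^J..<2^Suc J}" by (auto simp: le_less_trans)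
  hence "(\<Sum>n\<in>{1..<2^Suc J}. a n) = (\<Sum>n\<in>{1..<2^J}. a n) + (\<Sum>n\<in>{2^J..<2^Suc J}. a n)"
    by (simp add: sum.union_disjoint)
  also have "(\<Sum>n\<in>{2^J..<2^Suc J}. a n) = (\<Sum>n<2^J. a (2^J + n))"
    by (rule sum.reindex_bij_witness[of _ "\<lambda>n. 2^J + n" "\<lambda>n. n - 2^J"]) auto
  finally show ?case by (simp only: Suc sum.lessThan_Suc)
qed simp

text \<open>
  A dyadic block at \<open>D\<close> with \<open>D\<^sup>k\<close> well below and \<open>D\<close> to the power \<open>k + 1\<close> well above \<open>c r\<close> cancels by
  \<open>k\<close>-th differences. For \<open>k \<le> K\<close> this misses boundedly many blocks near the powers
  \<open>(c r)\<^sup>1\<^sup>/\<^sup>k\<close>, and the small \<open>D\<close>, which carry a share of about \<open>1/K\<close> of \<open>ln r\<close>.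
\<close>

lemma sum_reciprocal_phase:
  fixes c e :: real
  assumes c: "0 < c" and e: "0 < e"
  shows "\<exists>A. \<forall>r\<ge>1. norm (\<Sum>n\<in>{1..nat \<lfloor>r\<rfloor>}. cis (c * r / real n) / of_nat n) \<le> e * ln r + A"
proof -
  define L :: real where "L = ln 2"
  have L: "0 < L" by (simp add: L_def)
  \<comment> \<open>The coefficient \<open>e\<close> is split in halves: at most
    \<open>ln r / L\<close> good blocks cost \<open>e'\<close> each, and the blocks with
    \<open>D ^ (K + 1)\<close> below \<open>C * T\<close>, about \<open>ln r / (L * (K + 1))\<close>
    of them, cost at most 1 each.\<close>
  define e' where "e' = e * L / 2"
  have e': "0 < e'" using e L by (simp add: e'_def)
  obtain K :: nat where K: "2 / (e * L) < K" using reals_Archimedean2 by blast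
  have "\<forall>k\<in>{1..K}. \<exists>C>0. \<forall>D T. 1 \<le> D \<and> 0 < T \<and> C * T \<le> real D ^ (k + 1) \<and> C * real D ^ k \<le> T
     \<longrightarrow> norm (\<Sum>n<D. cis (T / real (D + n)) / of_nat (D + n)) \<le> e'"
    using reciprocal_phase_log_block[OF _ e'] by simp
  then obtain Ck where Ck: "\<And>k. k \<in> {1..K} \<Longrightarrow> Ck k > 0"
    "\<And>k D T. \<lbrakk>k \<in> {1..K}; 1 \<le> D; 0 < T; Ck k * T \<le> real D ^ (k + 1); Ck k * real D ^ k \<le> T\<rbrakk>
     \<Longrightarrow> norm (\<Sum>n<D. cis (T / real (D + n)) / of_nat (D + n)) \<le> e'"
    by (subst (asm) bchoice_iff) blast
  \<comment> \<open>The entry \<open>2 / c\<close> gives \<open>r < C * T\<close>, so a block with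
    \<open>D \<le> r\<close> never satisfies the upper condition with exponent
    \<open>k = 0\<close>.\<close>
  define C where "C = Max (insert 1 (insert (2 / c) (Ck ` {1..K})))"
  have C: "1 \<le> C" "2 / c \<le> C" "\<And>k. k \<in> {1..K} \<Longrightarrow> Ck k \<le> C"
    unfolding C_def by (rule Max_ge; simp)+
  have Cc: "2 \<le> C * c" using C(2) c by (simp add: field_simps)
  have good: "norm (\<Sum>n<D. cis (T / real (D + n)) / of_nat (D + n)) \<le> e'"
    if "k \<in> {1..K}" "1 \<le> D" "0 < T" "C * T \<le> real D ^ (k + 1)" "C * real D ^ k \<le> T" for k D T
  proof (rule Ck(2)[of k])
    have "0 \<le> real D ^ k" by simp
    thus "Ck k * T \<le> real D ^ (k + 1)" "Ck k * real D ^ k \<le> T"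
      using that(3-5) mult_right_mono[OF C(3)[OF that(1)], of T]
        mult_right_mono[OF C(3)[OF that(1)], of "real D ^ k"] by linarith+
  qed (use that in auto)
  define A where "A = (ln (C * c) / L + 2) + K * (2 * ln C / L + 1) + 1"
  show ?thesis
  proof (intro exI[of _ A] allI impI)
    fix r :: real assume r: "1 \<le> r"
    define T where "T = c * r"
    have T: "0 < T" using c r by (simp add: T_def)
    define M where "M = nat \<lfloor>r\<rfloor>"
    have M: "1 \<le> M" "real M \<le> r" using r by (auto simp: M_def le_nat_iff le_floor_iff)
    obtain J where J: "2 ^ J \<le> M" "M < 2 ^ (J + 1)"
      using ex_power_ivl1[of 2 M] M by auto
    have JL: "J * L \<le> ln r"
    proof -
      have "2 ^ J \<le> r" using J(1) M(2) by (metis of_nat_le_iff of_nat_numeral of_nat_power order_trans)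
      hence "ln (2 ^ J) \<le> ln r" using r by (subst ln_le_cancel_iff) auto
      thus ?thesis by (simp add: ln_realpow L_def)
    qed
    define a where "a n = cis (T / real n) / of_nat n" for n
    define b where "b j = (\<Sum>n<2^j. a (2^j + n))" for j
    have "1 \<le> x" if "2 ^ J \<le> x" for x :: nat using that by (cases x) auto
    hence "{1..M} = {1..<2^J} \<union> {2^J..M}" using J(1) by auto
    hence "(\<Sum>n\<in>{1..M}. a n) = (\<Sum>n\<in>{1..<2^J}. a n) + (\<Sum>n\<in>{2^J..M}. a n)"
      by (simp only:) (subst sum.union_disjoint, auto)
    also have "(\<Sum>n\<in>{1..<2^J}. a n) = (\<Sum>j<J. b j)" unfolding b_def by (rule sum_dyadic)
    also have "(\<Sum>n\<in>{2^J..M}. a n) = (\<Sum>n<M + 1 - 2^J. a (2^J + n))"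
      by (rule sum.reindex_bij_witness[of _ "\<lambda>n. 2^J + n" "\<lambda>n. n - 2^J"]) (use J in auto)
    finally have split: "(\<Sum>n\<in>{1..M}. a n) = (\<Sum>j<J. b j) + (\<Sum>n<M + 1 - 2^J. a (2^J + n))" .
    have last: "norm (\<Sum>n<M + 1 - 2^J. a (2^J + n)) \<le> 1"
      unfolding a_def using J by (intro norm_sum_reciprocal_block_le_1) auto
    have b1: "norm (b j) \<le> 1" for j
      unfolding b_def a_def by (intro norm_sum_reciprocal_block_le_1) auto
    \<comment> \<open>The lower end -1 admits \<open>j = 0\<close> and accounts for the 2 in the
      count of \<open>B0\<close>. The sets \<open>Bk k\<close> collect the blocks where
      \<open>D ^ k\<close> lies within a factor \<open>C\<close> of \<open>T\<close>; their number
      is bounded independently of \<open>r\<close>.\<close>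
    define B0 where "B0 = {j::nat. -1 < real j \<and> real j < ln (C * T) / L / (K + 1)}"
    define Bk where "Bk k = {j::nat. ln (T / C) / L / k < real j \<and> real j < ln (C * T) / L / k}" for k :: nat
    define Bad where "Bad = B0 \<union> (\<Union>k\<in>{1..K}. Bk k)"
    have CTr: "r < C * T" using mult_right_mono[OF Cc, of r] r by (simp add: T_def mult.assoc)
    have CT: "0 < ln (C * T)" using CTr r by simp
    have lnC: "0 \<le> ln C" using C by simp
    have lnCT: "ln (C * T) = ln C + ln T" "ln (T / C) = ln T - ln C" 
      using C T by (simp_all add: ln_mult ln_div)
    have card_Bk: "finite (Bk k)" "card (Bk k) \<le> 2 * ln C / L + 1" if "k \<in> {1..K}" for k
    proof -
      have le: "ln (T / C) / L / k \<le> ln (C * T) / L / k" using lnCT lnC L by (intro divide_right_mono) auto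
      show "finite (Bk k)" unfolding Bk_def by (rule card_nat_in_real_interval[OF le])
      have "card (Bk k) \<le> ln (C * T) / L / k - ln (T / C) / L / k + 1"
        unfolding Bk_def by (rule card_nat_in_real_interval[OF le])
      also have "\<dots> = (2 * ln C / L) / k + 1" unfolding lnCT by (simp add: field_simps diff_divide_distrib[symmetric])
      also have "(2 * ln C / L) / k \<le> (2 * ln C / L) / 1"
        using that lnC L by (intro divide_left_mono) auto
      finally show "card (Bk k) \<le> 2 * ln C / L + 1" by simp
    qed
    have "0 \<le> ln (C * T) / L / (K + 1)" using CT L by simp
    hence le0: "-1 \<le> ln (C * T) / L / (K + 1)" by linarith
    have card_B0: "finite B0" "card B0 \<le> ln (C * T) / L / (K + 1) + 2"
      using card_nat_in_real_interval[OF le0] unfolding B0_def by auto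
    have fin: "finite Bad" using card_B0 card_Bk by (auto simp: Bad_def)
    have goodj: "norm (b j) \<le> e'" if j: "j < J" "j \<notin> Bad" for j
    proof -
      define D :: nat where "D = 2 ^ j"
      have D: "1 \<le> D" by (simp add: D_def)
      have lnD: "ln (real D ^ k) = k * j * L" for k by (simp add: D_def ln_realpow L_def)
      have "D \<le> 2 ^ J" using j by (simp add: D_def)
      hence Dr: "real D \<le> r" using J(1) M(2) by linarith
      have "\<not> real j < ln (C * T) / L / (K + 1)" using j by (auto simp: Bad_def B0_def)
      hence "ln (C * T) / L / real (K + 1) \<le> real j" by (simp add: add.commute)
      hence "ln (C * T) \<le> real j * real (K + 1) * L"
        using L by (simp only: pos_divide_le_eq of_nat_0_less_iff zero_less_Suc Suc_eq_plus1[symmetric])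
      hence "ln (C * T) \<le> ln (real D ^ (K + 1))" unfolding lnD by (simp only: ac_simps of_nat_mult)
      hence ex: "C * T \<le> real D ^ (K + 1)" using CTr r D by (subst (asm) ln_le_cancel_iff) auto
      \<comment> \<open>Minimality gives \<open>D ^ k < C * T\<close>; avoiding \<open>Bk k\<close>
        improves this to \<open>C * D ^ k \<le> T\<close>, and the test of order \<open>k\<close>
        applies.\<close>
      define k where "k = (LEAST k. C * T \<le> real D ^ (k + 1))"
      have k: "C * T \<le> real D ^ (k + 1)" unfolding k_def by (rule LeastI[of _ K]) (rule ex)
      have kK: "k \<le> K" unfolding k_def by (rule Least_le) (rule ex)
      have k0: "k \<noteq> 0" using k CTr Dr by (intro notI) simp
      have "\<not> C * T \<le> real D ^ (k - 1 + 1)"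
        using k0 not_less_Least[of "k - 1" "\<lambda>k. C * T \<le> real D ^ (k + 1)"] by (auto simp: k_def)
      hence "real D ^ k < C * T" using k0 by simp
      hence "ln (real D ^ k) < ln (C * T)" using D CTr r by (subst ln_less_cancel_iff) auto
      hence "real j < ln (C * T) / L / k" unfolding lnD using L k0 by (simp add: field_simps)
      moreover have "j \<notin> Bk k" using j k0 kK by (auto simp: Bad_def)
      ultimately have "real j \<le> ln (T / C) / L / k" unfolding Bk_def by auto
      hence "ln (real D ^ k) \<le> ln (T / C)" unfolding lnD using L k0 by (simp add: field_simps)
      hence "real D ^ k \<le> T / C" using D T C(1) by (subst (asm) ln_le_cancel_iff) auto
      hence "C * real D ^ k \<le> T" using C(1) by (simp add: field_simps)
      hence "norm (\<Sum>n<D. cis (T / real (D + n)) / of_nat (D + n)) \<le> e'"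
        using k k0 kK D T by (intro good[of k]) auto
      thus ?thesis by (simp add: b_def a_def D_def)
    qed
    have "norm (\<Sum>j<J. b j) \<le> (\<Sum>j<J. e' + of_bool (j \<in> Bad))"
    proof (rule sum_norm_le)
      fix j assume "j \<in> {..<J}"
      thus "norm (b j) \<le> e' + of_bool (j \<in> Bad)"
        using goodj[of j] b1[of j] e' by (cases "j \<in> Bad") auto
    qed
    also have "\<dots> = J * e' + card ({..<J} \<inter> Bad)"
      by (simp add: sum.distrib Int_def)
    also have "card ({..<J} \<inter> Bad) \<le> card Bad" using fin by (intro card_mono) auto
    also have "card Bad \<le> card B0 + card (\<Union>k\<in>{1..K}. Bk k)" unfolding Bad_def by (rule card_Un_le)
    also have "card (\<Union>k\<in>{1..K}. Bk k) \<le> (\<Sum>k\<in>{1..K}. card (Bk k))" by (rule card_UN_le) simp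
    finally have 1: "norm (\<Sum>j<J. b j) \<le> J * e' + (card B0 + (\<Sum>k\<in>{1..K}. real (card (Bk k))))"
      by simp
    have "(\<Sum>k\<in>{1..K}. real (card (Bk k))) \<le> (\<Sum>k\<in>{1..K}. 2 * ln C / L + 1)"
      using card_Bk by (intro sum_mono) auto
    hence 2: "(\<Sum>k\<in>{1..K}. real (card (Bk k))) \<le> K * (2 * ln C / L + 1)" by simp
    have 3: "J * e' \<le> e / 2 * ln r"
      using mult_left_mono[OF JL, of "e / 2"] e by (simp add: e'_def ac_simps)
    have lnT: "ln (C * T) = ln (C * c) + ln r"
      using C(1) c r unfolding T_def by (simp add: ln_mult)
    have K0: "1 / L / (K + 1) \<le> e / 2"
    proof -
      have "2 \<le> e * L * K" using K e L by (simp add: field_simps)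
      also have "\<dots> \<le> e * L * (K + 1)" using e L by simp
      finally have "1 \<le> e / 2 * (L * real (K + 1))" by simp
      hence "1 / (L * real (K + 1)) \<le> e / 2" using L by (subst pos_divide_le_eq) auto
      thus ?thesis by simp
    qed
    have "ln (C * T) / L / (K + 1) = ln (C * c) / L / (K + 1) + ln r * (1 / L / (K + 1))"
      unfolding lnT by (simp add: add_divide_distrib)
    also have "ln r * (1 / L / (K + 1)) \<le> ln r * (e / 2)" using r K0 by (intro mult_left_mono) auto
    also have "ln (C * c) / L / (K + 1) \<le> ln (C * c) / L / 1"
      using Cc L by (intro divide_left_mono) auto
    finally have 4: "ln (C * T) / L / (K + 1) \<le> ln (C * c) / L + e / 2 * ln r" by (simp add: mult.commute)
    have "norm (\<Sum>n\<in>{1..M}. a n) \<le> norm (\<Sum>j<J. b j) + norm (\<Sum>n<M + 1 - 2^J. a (2^J + n))"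
      unfolding split by (rule norm_triangle_ineq)
    also have "\<dots> \<le> e * ln r + A"
      using 1 2 3 4 last card_B0(2) by (simp add: A_def)
    finally show "norm (\<Sum>n\<in>{1..nat \<lfloor>r\<rfloor>}. cis (c * r / real n) / of_nat n) \<le> e * ln r + A"
      by (simp add: a_def M_def T_def)
  qed
qed

subsection \<open>Overlap of two discs\<close>

lemma lborel_integral_translate:
  fixes f :: "'a::euclidean_space \<Rightarrow> 'b::{banach,second_countable_topology}"
  assumes [measurable]: "f \<in> borel_measurable borel"
  shows "(\<integral>x. f (c + x) \<partial>lborel) = (\<integral>x. f x \<partial>lborel)"
proof -
  have "(\<integral>x. f x \<partial>lborel) = (\<integral>x. f x \<partial>distr lborel borel ((+) c))" by (simp add: lborel_distr_plus)
  also have "\<dots> = (\<integral>x. f (c + x) \<partial>lborel)" by (rule integral_distr) auto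
  finally show ?thesis ..
qed

lemma lborel_integrable_translate:
  fixes f :: "'a::euclidean_space \<Rightarrow> 'b::{banach,second_countable_topology}"
  assumes "integrable lborel f"
  shows "integrable lborel (\<lambda>x. f (c + x))"
  using assms by (intro integrable_distr[of "(+) c" lborel borel f]) (simp_all add: lborel_distr_plus)

lemma emeasure_lborel_vimage_plus:
  "A \<in> sets lborel \<Longrightarrow> emeasure lborel ((\<lambda>x. c + x) -` A) = emeasure lborel (A :: 'a::euclidean_space set)"
  by (subst (2) lborel_distr_plus[of c, symmetric]) (simp add: emeasure_distr)

text \<open>On each slice with fixed second coordinate the shear is a translation, so Fubini reduces
  the claim to one dimension.\<close>

lemma distr_shear_fst: "distr lborel lborel (\<lambda>x::real \<times> real. (fst x + a * snd x, snd x)) = lborel"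
proof (rule measure_eqI)
  fix A :: "(real \<times> real) set" assume "A \<in> sets (distr lborel lborel (\<lambda>x::real \<times> real. (fst x + a * snd x, snd x)))"
  hence A [measurable]: "A \<in> sets borel" by simp
  let ?T = "\<lambda>x::real \<times> real. (fst x + a * snd x, snd x)"
  have T [measurable]: "?T \<in> borel_measurable borel"
    by (intro borel_measurable_continuous_onI continuous_intros)
  have TA: "?T -` A \<in> sets borel" using measurable_sets[OF T A] by simp
  have sl: "(\<lambda>x. (x, y)) -` A \<in> sets lborel" for y
  proof -
    have "(\<lambda>x::real. (x, y)) \<in> borel_measurable borel" by (intro borel_measurable_continuous_onI continuous_intros)
    from measurable_sets[OF this A] show ?thesis by simp
  qed
  have "emeasure (distr lborel lborel ?T) A = emeasure (lborel \<Otimes>\<^sub>M lborel) (?T -` A)"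
    by (simp add: emeasure_distr lborel_prod)
  also have "\<dots> = (\<integral>\<^sup>+y. emeasure lborel ((\<lambda>x. (x, y)) -` (?T -` A)) \<partial>lborel)"
    using TA by (intro lborel_pair.emeasure_pair_measure_alt2) (simp only: lborel_prod sets_lborel)
  also have "\<dots> = (\<integral>\<^sup>+y. emeasure lborel ((\<lambda>x. (x, y)) -` A) \<partial>lborel)"
  proof (intro nn_integral_cong)
    fix y :: real
    have "(\<lambda>x. (x, y)) -` (?T -` A) = (\<lambda>x. a * y + x) -` ((\<lambda>x. (x, y)) -` A)" by (auto simp: add.commute)
    thus "emeasure lborel ((\<lambda>x. (x, y)) -` (?T -` A)) = emeasure lborel ((\<lambda>x. (x, y)) -` A)"
      using emeasure_lborel_vimage_plus[OF sl] by simp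
  qed
  also have "\<dots> = emeasure (lborel \<Otimes>\<^sub>M lborel) A"
    using A by (intro lborel_pair.emeasure_pair_measure_alt2[symmetric]) (simp only: lborel_prod sets_lborel)
  finally show "emeasure (distr lborel lborel ?T) A = emeasure lborel A" by (simp add: lborel_prod)
qed simp

lemma distr_swap_plane: "distr lborel lborel (\<lambda>x::real \<times> real. (snd x, fst x)) = lborel"
proof -
  have "lborel = distr lborel lborel (\<lambda>x::real \<times> real. (snd x, fst x))"
    using lborel_pair.distr_pair_swap by (simp add: lborel_prod case_prod_unfold)
  thus ?thesis by (rule sym)
qed

lemma integral_swap_plane:
  fixes f :: "real \<times> real \<Rightarrow> 'b::{banach,second_countable_topology}"
  assumes [measurable]: "f \<in> borel_measurable borel"
  shows "(\<integral>x. f (snd x, fst x) \<partial>lborel) = (\<integral>x. f x \<partial>lborel)"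
proof -
  have [measurable]: "(\<lambda>x::real \<times> real. (snd x, fst x)) \<in> borel_measurable borel"
    by (intro borel_measurable_continuous_onI continuous_intros)
  show ?thesis
    by (subst (2) distr_swap_plane[symmetric]) (simp add: integral_distr)
qed

lemma integral_shear_fst:
  fixes f :: "real \<times> real \<Rightarrow> 'b::{banach,second_countable_topology}"
  assumes [measurable]: "f \<in> borel_measurable borel"
  shows "(\<integral>x. f (fst x + a * snd x, snd x) \<partial>lborel) = (\<integral>x. f x \<partial>lborel)"
proof -
  have [measurable]: "(\<lambda>x::real \<times> real. (fst x + a * snd x, snd x)) \<in> borel_measurable borel"
    by (intro borel_measurable_continuous_onI continuous_intros)
  show ?thesis
    by (subst (2) distr_shear_fst[of a, symmetric]) (simp add: integral_distr)
qed

lemma integral_shear_snd: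
  fixes f :: "real \<times> real \<Rightarrow> 'b::{banach,second_countable_topology}"
  assumes [measurable]: "f \<in> borel_measurable borel"
  shows "(\<integral>x. f (fst x, snd x + a * fst x) \<partial>lborel) = (\<integral>x. f x \<partial>lborel)"
proof -
  have sw [measurable]: "(\<lambda>x::real \<times> real. (snd x, fst x)) \<in> borel_measurable borel"
    by (intro borel_measurable_continuous_onI continuous_intros)
  have sh [measurable]: "(\<lambda>x::real \<times> real. (fst x, snd x + a * fst x)) \<in> borel_measurable borel"
    by (intro borel_measurable_continuous_onI continuous_intros)
  have m1: "(\<lambda>x. f (snd x, fst x)) \<in> borel_measurable borel" by measurable
  have m2: "(\<lambda>x. f (fst x, snd x + a * fst x)) \<in> borel_measurable borel" by measurable
  have "(\<integral>x. f (fst x, snd x + a * fst x) \<partial>lborel) = (\<integral>x. f (snd x, fst x + a * snd x) \<partial>lborel)"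
    using integral_swap_plane[OF m2] by simp
  also have "\<dots> = (\<integral>x. f (snd x, fst x) \<partial>lborel)" using integral_shear_fst[OF m1, of a] by simp
  also have "\<dots> = (\<integral>x. f x \<partial>lborel)" by (rule integral_swap_plane) fact
  finally show ?thesis .
qed

text \<open>A rotation by an angle other than a multiple of \<open>\<pi>\<close> is a product of three shears.\<close>

lemma integral_rotate:
  fixes f :: "real \<times> real \<Rightarrow> 'b::{banach,second_countable_topology}"
  assumes f: "f \<in> borel_measurable borel" and cs: "c\<^sup>2 + s\<^sup>2 = 1" and s: "s \<noteq> 0"
  shows "(\<integral>x. f (c * fst x + s * snd x, c * snd x - s * fst x) \<partial>lborel) = (\<integral>x. f x \<partial>lborel)"
proof -
  \<comment> \<open>The tangent of half the angle: shearing by \<open>a\<close>, then by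
    \<open>-s\<close> in the other direction, then by \<open>a\<close> again is the
    rotation.\<close>
  define a where "a = (1 - c) / s"
  have as: "a * s = 1 - c" using s by (simp add: a_def)
  have "s * (a * (1 + c)) = (a * s) * (1 + c)" by simp
  also have "\<dots> = (1 - c) * (1 + c)" unfolding as ..
  also have "\<dots> = s * s" using cs by (simp add: power2_eq_square algebra_simps)
  finally have ac: "a * (1 + c) = s" using s by simp
  define f1 where "f1 x = f (fst x + a * snd x, snd x)" for x
  define f2 where "f2 x = f1 (fst x, snd x + (- s) * fst x)" for x
  have sh1: "(\<lambda>x::real \<times> real. (fst x + a * snd x, snd x)) \<in> borel_measurable borel"
    by (intro borel_measurable_continuous_onI continuous_intros)
  have sh2: "(\<lambda>x::real \<times> real. (fst x, snd x + (- s) * fst x)) \<in> borel_measurable borel"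
    by (intro borel_measurable_continuous_onI continuous_intros)
  have m1: "f1 \<in> borel_measurable borel" unfolding f1_def using measurable_compose[OF sh1 f] .
  have m2: "f2 \<in> borel_measurable borel" unfolding f2_def using measurable_compose[OF sh2 m1] .
  have "f2 (fst x + a * snd x, snd x) = f (c * fst x + s * snd x, c * snd x - s * fst x)" for x
  proof -
    have "snd x - s * (fst x + a * snd x) = (1 - a * s) * snd x - s * fst x" by (simp add: algebra_simps)
    hence 1: "snd x - s * (fst x + a * snd x) = c * snd x - s * fst x" unfolding as by simp
    have 2: "fst x + a * snd x + a * (c * snd x - s * fst x) = (1 - a * s) * fst x + (a * (1 + c)) * snd x"
      by (simp add: algebra_simps)
    show ?thesis unfolding f2_def f1_def using 1 2 ac as by simp
  qed
  hence "(\<integral>x. f (c * fst x + s * snd x, c * snd x - s * fst x) \<partial>lborel) = (\<integral>x. f2 (fst x + a * snd x, snd x) \<partial>lborel)"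
    by simp
  also have "\<dots> = (\<integral>x. f2 x \<partial>lborel)" by (rule integral_shear_fst[OF m2])
  also have "\<dots> = (\<integral>x. f1 x \<partial>lborel)" unfolding f2_def by (rule integral_shear_snd[OF m1])
  also have "\<dots> = (\<integral>x. f x \<partial>lborel)" unfolding f1_def by (rule integral_shear_fst[OF f])
  finally show ?thesis .
qed

section \<open>The overlap area and its Fourier transform\<close>

lemma measure_disc: "0 \<le> r \<Longrightarrow> measure lborel (cball (c :: real \<times> real) r) = pi * r\<^sup>2"
  by (simp add: content_cball unit_ball_vol_2 power2_eq_square)

text \<open>The covariogram of the disc, that is, the autocorrelation of its indicator; hence its
  Fourier transform is an absolute square.\<close>

definition lens :: "real \<Rightarrow> real \<times> real \<Rightarrow> real" where
  "lens r x = measure lborel {y. norm y \<le> r \<and> norm (x + y) \<le> r}"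

lemma lens_set_eq: "{y. norm y \<le> r \<and> norm (x + y) \<le> r} = cball 0 r \<inter> cball (- x) r"
  by (auto simp: dist_norm norm_minus_commute add.commute)

lemma lens_eq_integral:
  "lens r x = (\<integral>y. indicat_real (cball 0 r) y * indicat_real (cball 0 r) (x + y) \<partial>lborel)"
proof -
  have "(\<lambda>y. indicat_real (cball 0 r) y * indicat_real (cball 0 r) (x + y))
     = indicat_real {y. norm y \<le> r \<and> norm (x + y) \<le> r}"
    by (auto simp: indicator_def fun_eq_iff)
  thus ?thesis by (simp add: lens_def lens_set_eq)
qed

lemma lens_nonneg: "0 \<le> lens r x" by (simp add: lens_def)

lemma lens_eq_0:
  assumes "2 * r < norm x" shows "lens r x = 0"
proof -
  have "\<not> (norm y \<le> r \<and> norm (x + y) \<le> r)" for y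
  proof
    assume "norm y \<le> r \<and> norm (x + y) \<le> r"
    moreover have "norm x \<le> norm (x + y) + norm y" by norm
    ultimately show False using assms by linarith
  qed
  hence "{y. norm y \<le> r \<and> norm (x + y) \<le> r} = {}" by blast
  thus ?thesis unfolding lens_def by (simp only: measure_empty)
qed

lemma emeasure_cball_finite [simp]: "emeasure lborel (cball c r) < top" "emeasure lborel (cball c r) \<noteq> top"
  for c :: "'a::euclidean_space"
  using emeasure_bounded_finite[of "cball c r"] by simp_all

lemma fmeasurable_cball: "cball c r \<in> fmeasurable lborel" for c :: "'a::euclidean_space"
  by (intro fmeasurableI) auto

lemma lens_le: "0 \<le> r \<Longrightarrow> lens r x \<le> pi * r\<^sup>2"
  unfolding lens_def lens_set_eq measure_disc[of r 0, symmetric]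
  by (rule measure_mono_fmeasurable) (auto simp: fmeasurable_cball)

text \<open>Moving one disc by a distance d can only add points of the annulus of width d around its
  old position.\<close>

lemma lens_le_add:
  assumes r: "0 \<le> r"
  shows "lens r x \<le> lens r x' + pi * (2 * r * norm (x - x') + (norm (x - x'))\<^sup>2)"
proof -
  let ?d = "norm (x - x')"
  let ?A = "cball 0 r \<inter> cball (- x') r" and ?B = "cball (- x') (r + ?d) - cball (- x') r"
  have fm: "?A \<in> fmeasurable lborel" "?B \<in> fmeasurable lborel"
    by (auto intro!: fmeasurable.Int fmeasurable.Diff fmeasurable_cball)
  have "cball 0 r \<inter> cball (- x) r \<subseteq> ?A \<union> ?B"
  proof
    fix y assume y: "y \<in> cball 0 r \<inter> cball (- x) r"
    have "dist (- x') y \<le> dist (- x) y + norm (x - x')"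
      using dist_triangle[of "- x'" y "- x"] by (simp add: dist_norm)
    thus "y \<in> ?A \<union> ?B" using y by auto
  qed
  hence "lens r x \<le> measure lborel (?A \<union> ?B)"
    unfolding lens_def lens_set_eq using fm by (intro measure_mono_fmeasurable) auto
  also have "\<dots> \<le> measure lborel ?A + measure lborel ?B"
    using fm by (intro measure_Un_le) (auto dest: fmeasurableD)
  also have "measure lborel ?B = pi * (r + ?d)\<^sup>2 - pi * r\<^sup>2"
    using r by (subst measure_Diff) (simp_all add: measure_disc subset_cball)
  finally show ?thesis unfolding lens_def lens_set_eq by (simp add: power2_eq_square algebra_simps)
qed

lemma lens_lipschitz:
  assumes r: "0 \<le> r" and d: "norm y \<le> 1"
  shows "\<bar>lens r (x + y) - lens r x\<bar> \<le> pi * (2 * r + 1) * norm y"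
proof -
  have "lens r (x + y) \<le> lens r x + pi * (2 * r * norm y + (norm y)\<^sup>2)"
       "lens r x \<le> lens r (x + y) + pi * (2 * r * norm y + (norm y)\<^sup>2)"
    using lens_le_add[OF r, of "x + y" x] lens_le_add[OF r, of x "x + y"] by auto
  moreover
  have "(norm y)\<^sup>2 \<le> norm y" using d by (simp add: power2_eq_square mult_left_le)
  hence "pi * (2 * r * norm y + (norm y)\<^sup>2) \<le> pi * (2 * r * norm y + norm y)"
    by (intro mult_left_mono) auto
  moreover have "pi * (2 * r + 1) * norm y = pi * (2 * r * norm y + norm y)" by (simp add: algebra_simps)
  ultimately show ?thesis by linarith
qed

lemma continuous_on_lens: "0 \<le> r \<Longrightarrow> continuous_on UNIV (lens r)"
  unfolding continuous_on_iff
proof (intro ballI allI impI)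
  fix x and e :: real assume r: "0 \<le> r" and e: "0 < e"
  define K where "K = pi * (2 * r + 1)"
  have K: "0 < K" using r by (simp add: K_def add_nonneg_pos)
  show "\<exists>d>0. \<forall>x'\<in>UNIV. dist x' x < d \<longrightarrow> dist (lens r x') (lens r x) < e"
  proof (intro exI[of _ "min 1 (e / K)"] conjI ballI impI)
    fix x' assume "dist x' x < min 1 (e / K)"
    hence "norm (x' - x) \<le> 1" "K * norm (x' - x) < e" using K by (auto simp: dist_norm field_simps)
    thus "dist (lens r x') (lens r x) < e"
      using lens_lipschitz[OF r, of "x' - x" x] by (simp add: dist_real_def K_def)
  qed (use e K in auto)
qed

lemma measurable_lens [measurable]: "0 \<le> r \<Longrightarrow> lens r \<in> borel_measurable borel"
  by (rule borel_measurable_continuous_onI) (rule continuous_on_lens)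

definition chr :: "int \<times> int \<Rightarrow> real \<times> real \<Rightarrow> complex" where
  "chr k x = cis (2 * pi * (plane_point k \<bullet> x))"

lemma cnj_chr_mult: "cnj (chr k y) * chr k (x + y) = chr k x"
  by (simp add: chr_def cis_cnj cis_mult inner_add_right algebra_simps)

lemma norm_chr [simp]: "norm (chr k x) = 1" by (simp add: chr_def)

lemma measurable_chr [measurable]: "chr k \<in> borel_measurable borel"
  unfolding chr_def[abs_def] by (intro borel_measurable_continuous_onI continuous_intros)

definition disc_ft :: "real \<Rightarrow> int \<times> int \<Rightarrow> complex" where
  "disc_ft r k = (\<integral>y. indicat_real (cball 0 r) y *\<^sub>R chr k y \<partial>lborel)"

lemma integrable_disc_cis:
  assumes "f \<in> borel_measurable borel"
  shows "integrable lborel (\<lambda>x::real \<times> real. indicat_real (cball 0 r) x *\<^sub>R cis (f x))"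
proof (rule Bochner_Integration.integrable_bound)
  show "integrable lborel (indicat_real (cball (0::real \<times> real) r))"
    by (intro integrable_real_indicator) auto
  have "cis \<in> borel_measurable borel" by (intro borel_measurable_continuous_onI continuous_intros)
  from measurable_compose[OF assms this]
  show "(\<lambda>x::real \<times> real. indicat_real (cball 0 r) x *\<^sub>R cis (f x)) \<in> borel_measurable lborel"
    by (intro borel_measurable_scaleR borel_measurable_indicator) auto
qed (auto simp: indicator_def)

text \<open>The character splits as \<open>chr k x = cnj (chr k y) * chr k (x + y)\<close>; after
  Fubini and a translation the two factors integrate to \<open>cnj (disc_ft r k)\<close> and
  \<open>disc_ft r k\<close>.\<close>

lemma lens_ft:
  "(\<integral>x. lens r x *\<^sub>R chr k x \<partial>lborel) = of_real ((norm (disc_ft r k))\<^sup>2)"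
proof -
  let ?i = "indicat_real (cball (0::real \<times> real) r)"
  define F where "F x y = (?i y * ?i (x + y)) *\<^sub>R chr k x" for x y
  have F_eq: "F x y = ?i y *\<^sub>R cnj (chr k y) * (?i (x + y) *\<^sub>R chr k (x + y))" for x y
  proof -
    have "?i y *\<^sub>R cnj (chr k y) * (?i (x + y) *\<^sub>R chr k (x + y)) = (?i y * ?i (x + y)) *\<^sub>R (cnj (chr k y) * chr k (x + y))"
      by (simp add: scaleR_conv_of_real)
    thus ?thesis by (simp add: F_def cnj_chr_mult)
  qed
  have F_meas: "(\<lambda>(x, y). F x y) \<in> borel_measurable (lborel \<Otimes>\<^sub>M lborel)"
  proof -
    have [measurable]: "(\<lambda>p::(real \<times> real) \<times> real \<times> real. fst p) \<in> borel_measurable borel"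
      "(\<lambda>p::(real \<times> real) \<times> real \<times> real. snd p) \<in> borel_measurable borel"
      "(\<lambda>p::(real \<times> real) \<times> real \<times> real. fst p + snd p) \<in> borel_measurable borel"
      by (intro borel_measurable_continuous_onI continuous_intros)+
    have i [measurable]: "?i \<in> borel_measurable borel"
      by (rule borel_measurable_indicator) auto
    have "(\<lambda>p. (?i (snd p) * ?i (fst p + snd p)) *\<^sub>R chr k (fst p)) \<in> borel_measurable borel"
      by (intro borel_measurable_scaleR borel_measurable_times measurable_compose[OF _ i]
          measurable_compose[OF _ measurable_chr]) measurable
    thus ?thesis unfolding F_def lborel_prod case_prod_unfold by simp
  qed
  have int: "integrable (lborel \<Otimes>\<^sub>M lborel) (\<lambda>(x, y). F x y)"
  proof (rule Bochner_Integration.integrable_bound[OF _ F_meas])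
    show "integrable (lborel \<Otimes>\<^sub>M lborel) (indicat_real (cball (0::real \<times> real) (2 * r) \<times> cball (0::real \<times> real) r))"
      by (intro integrable_real_indicator)
         (auto simp: lborel.emeasure_pair_measure_Times ennreal_mult_less_top)
    have "norm (F x y) \<le> indicat_real (cball (0::real \<times> real) (2 * r) \<times> cball (0::real \<times> real) r) (x, y)" for x y
    proof (cases "norm y \<le> r \<and> norm (x + y) \<le> r")
      case True
      moreover have "norm x \<le> norm (x + y) + norm y" by norm
      ultimately show ?thesis by (auto simp: F_def indicator_def)
    qed (auto simp: F_def indicator_def)
    thus "AE p in lborel \<Otimes>\<^sub>M lborel. norm (case p of (x, y) \<Rightarrow> F x y)
      \<le> norm (indicat_real (cball (0::real \<times> real) (2 * r) \<times> cball (0::real \<times> real) r) p)"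
      by (intro AE_I2) (auto simp: case_prod_unfold)
  qed
  have "(\<integral>x. lens r x *\<^sub>R chr k x \<partial>lborel) = (\<integral>x. (\<integral>y. F x y \<partial>lborel) \<partial>lborel)"
  proof (intro Bochner_Integration.integral_cong refl)
    fix x
    have "(\<lambda>y. ?i y * ?i (x + y)) = indicat_real (cball 0 r \<inter> cball (- x) r)"
      unfolding lens_set_eq[symmetric] by (auto simp: indicator_def fun_eq_iff)
    hence "integrable lborel (\<lambda>y. ?i y * ?i (x + y))"
      using fmeasurable.Int[OF fmeasurable_cball fmeasurable_cball, of 0 r "- x" r]
      by (auto simp: fmeasurable_def intro!: integrable_real_indicator)
    thus "lens r x *\<^sub>R chr k x = (\<integral>y. F x y \<partial>lborel)"
      unfolding F_def lens_eq_integral by (intro integral_scaleR_left[symmetric])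
  qed
  also have "\<dots> = (\<integral>y. (\<integral>x. F x y \<partial>lborel) \<partial>lborel)"
    by (rule lborel_pair.Fubini_integral[OF int, symmetric])
  also have "\<dots> = (\<integral>y. ?i y *\<^sub>R cnj (chr k y) * disc_ft r k \<partial>lborel)"
  proof (intro Bochner_Integration.integral_cong refl)
    fix y
    have m: "(\<lambda>x. ?i x *\<^sub>R chr k x) \<in> borel_measurable borel"
      by (intro borel_measurable_scaleR borel_measurable_indicator measurable_chr) auto
    have "(\<integral>x. F x y \<partial>lborel) = ?i y *\<^sub>R cnj (chr k y) * (\<integral>x. ?i (y + x) *\<^sub>R chr k (y + x) \<partial>lborel)"
      unfolding F_eq add.commute[of _ y] by (rule integral_mult_right_zero)
    also have "(\<integral>x. ?i (y + x) *\<^sub>R chr k (y + x) \<partial>lborel) = disc_ft r k"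
      unfolding disc_ft_def by (rule lborel_integral_translate[OF m])
    finally show "(\<integral>x. F x y \<partial>lborel) = ?i y *\<^sub>R cnj (chr k y) * disc_ft r k" .
  qed
  also have "\<dots> = (\<integral>y. ?i y *\<^sub>R cnj (chr k y) \<partial>lborel) * disc_ft r k"
    by (rule integral_mult_left_zero)
  also have "(\<integral>y. ?i y *\<^sub>R cnj (chr k y) \<partial>lborel) = cnj (disc_ft r k)"
    unfolding disc_ft_def Bochner_Integration.integral_cnj[symmetric] complex_cnj_scaleR ..
  also have "cnj (disc_ft r k) * disc_ft r k = of_real ((norm (disc_ft r k))\<^sup>2)"
    unfolding complex_norm_square by (rule mult.commute)
  finally show ?thesis .
qed

subsection \<open>Fourier coefficients of the disc and Fejer kernels\<close>

lemma norm_plane_le_iff: "0 \<le> r \<Longrightarrow> norm (t, y) \<le> r \<longleftrightarrow> t\<^sup>2 + y\<^sup>2 \<le> r\<^sup>2" for t y r :: real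
proof -
  assume r: "0 \<le> r"
  have "norm (t, y) \<le> r \<longleftrightarrow> (norm (t, y))\<^sup>2 \<le> r\<^sup>2" using r by (simp add: abs_le_square_iff[symmetric])
  thus ?thesis by (simp add: norm_Pair)
qed

lemma slice_disc:
  assumes r: "0 < r"
  shows "(\<integral>y. indicat_real (cball 0 r) (t, y::real) \<partial>lborel) = indicat_real {-r..r} t * (2 * sqrt (r\<^sup>2 - t\<^sup>2))"
proof (cases "t \<in> {-r..r}")
  case True
  define q where "q = sqrt (r\<^sup>2 - t\<^sup>2)"
  have "t\<^sup>2 \<le> r\<^sup>2" using True r by (intro abs_le_square_iff[THEN iffD1]) auto
  hence q: "0 \<le> q" "q\<^sup>2 = r\<^sup>2 - t\<^sup>2" by (auto simp: q_def)
  have "norm (t, y) \<le> r \<longleftrightarrow> y \<in> {-q..q}" for y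
  proof -
    have "norm (t, y) \<le> r \<longleftrightarrow> y\<^sup>2 \<le> q\<^sup>2" using r q by (auto simp: norm_plane_le_iff)
    also have "\<dots> \<longleftrightarrow> \<bar>y\<bar> \<le> \<bar>q\<bar>" by (rule abs_le_square_iff[symmetric])
    finally show ?thesis using q by auto
  qed
  hence "(\<lambda>y::real. indicat_real (cball 0 r) (t, y)) = indicat_real {-q..q}"
    by (auto simp: indicator_def fun_eq_iff)
  hence "(\<integral>y. indicat_real (cball 0 r) (t, y::real) \<partial>lborel) = (\<integral>y. indicat_real {-q..q} y \<partial>lborel)"
    by (simp only:)
  also have "\<dots> = 2 * q" using q by simp
  finally show ?thesis using True by (simp add: q_def)
next
  case False
  have "\<not> norm (t, y) \<le> r" for y :: real
  proof
    assume "norm (t, y) \<le> r"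
    hence "\<bar>t\<bar> \<le> r" using order.trans[OF norm_fst_le[where x = t and y = y]] by simp
    thus False using False by auto
  qed
  thus ?thesis using False by (simp add: indicator_def)
qed

lemma integral_semicircle_cis:
  "(\<integral>s. indicat_real {-1..1} s *\<^sub>R (sqrt (1 - s\<^sup>2) *\<^sub>R cis (w * s)) \<partial>lborel) = of_real (bes w)"
proof -
  let ?h = "\<lambda>s. sqrt (1 - s\<^sup>2) *\<^sub>R cis (w * s)"
  have c: "continuous_on {-1..1} ?h" by (intro continuous_intros)
  have h: "(?h has_integral integral {-1..1} ?h) {-1..1}"
    by (intro integrable_integral integrable_continuous_real c)
  have eq: "(\<integral>s. indicat_real {-1..1} s *\<^sub>R ?h s \<partial>lborel) = integral {-1..1} ?h"
    using set_borel_integral_eq_integral(2)[OF borel_integrable_atLeastAtMost'[OF c]]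
    by (simp add: set_lebesgue_integral_def)
  have "Re (integral {-1..1} ?h) = integral {-1..1} (\<lambda>s. Re (?h s))"
    using has_integral_linear[OF h bounded_linear_Re] by (simp add: o_def integral_unique)
  hence re: "Re (integral {-1..1} ?h) = bes w" by (simp add: bes_def)
  have "Im (integral {-1..1} ?h) = integral {-1..1} (\<lambda>s. Im (?h s))"
    using has_integral_linear[OF h bounded_linear_Im] by (simp add: o_def integral_unique)
  also have "\<dots> = integral {-1..1} (\<lambda>s. sqrt (1 - s\<^sup>2) * sin (w * s))" by simp
  also have "\<dots> = 0"
    using Henstock_Kurzweil_Integration.integral_reflect_real[of 1 "-1" "\<lambda>s. sqrt (1 - s\<^sup>2) * sin (w * s)"] by simp
  finally show ?thesis unfolding eq using re by (simp add: complex_eq_iff)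
qed

text \<open>Integrating over the second coordinate first replaces the disc by its chord lengths, and
  rescaling by \<open>r\<close> yields the defining integral of \<open>bes\<close>.\<close>

lemma disc_ft_axis:
  assumes r: "0 < r"
  shows "(\<integral>x. indicat_real (cball (0::real \<times> real) r) x *\<^sub>R cis (w * fst x) \<partial>lborel) = of_real (2 * r\<^sup>2 * bes (r * w))"
proof -
  have m: "(\<lambda>x::real \<times> real. w * fst x) \<in> borel_measurable borel"
    by (intro borel_measurable_continuous_onI continuous_intros)
  have int: "integrable (lborel \<Otimes>\<^sub>M lborel) (\<lambda>(t::real, y::real). indicat_real (cball 0 r) (t, y) *\<^sub>R cis (w * t))"
    unfolding lborel_prod case_prod_unfold prod.collapse by (rule integrable_disc_cis[OF m])
  have "(\<integral>x. indicat_real (cball (0::real \<times> real) r) x *\<^sub>R cis (w * fst x) \<partial>lborel)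
     = (\<integral>t. (\<integral>y. indicat_real (cball 0 r) (t, y::real) *\<^sub>R cis (w * t) \<partial>lborel) \<partial>lborel)"
    using lborel_pair.integral_fst[OF int, symmetric] by (simp add: lborel_prod case_prod_unfold)
  also have "\<dots> = (\<integral>t. (indicat_real {-r..r} t * (2 * sqrt (r\<^sup>2 - t\<^sup>2))) *\<^sub>R cis (w * t) \<partial>lborel)"
  proof (intro Bochner_Integration.integral_cong refl)
    fix t :: real
    have "integrable lborel (\<lambda>y::real. indicat_real (cball 0 r) (t, y))"
    proof -
      have "(\<lambda>y::real. indicat_real (cball 0 r) (t, y)) = indicat_real ((\<lambda>y::real. (t, y)) -` cball 0 r)"
        by (auto simp: indicator_def fun_eq_iff)
      moreover have "closed ((\<lambda>y::real. (t, y)) -` cball 0 r)"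
        by (intro closed_vimage continuous_intros) auto
      moreover have "(\<lambda>y::real. (t, y)) -` cball 0 r \<subseteq> cball 0 r"
        using order.trans[OF norm_snd_le[where x = t]] by fastforce
      hence "bounded ((\<lambda>y::real. (t, y)) -` cball 0 r)" by (rule bounded_subset[OF bounded_cball])
      ultimately show ?thesis
        using emeasure_bounded_finite by (auto intro!: integrable_real_indicator)
    qed
    thus "(\<integral>y. indicat_real (cball 0 r) (t, y::real) *\<^sub>R cis (w * t) \<partial>lborel)
       = (indicat_real {-r..r} t * (2 * sqrt (r\<^sup>2 - t\<^sup>2))) *\<^sub>R cis (w * t)"
      using slice_disc[OF r, of t] by (subst integral_scaleR_left) auto
  qed
  also have "\<dots> = \<bar>r\<bar> *\<^sub>R (\<integral>s. (indicat_real {-r..r} (0 + r * s) * (2 * sqrt (r\<^sup>2 - (0 + r * s)\<^sup>2))) *\<^sub>R cis (w * (0 + r * s)) \<partial>lborel)"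
    using r by (intro lborel_integral_real_affine) auto
  also have "(\<lambda>s. (indicat_real {-r..r} (0 + r * s) * (2 * sqrt (r\<^sup>2 - (0 + r * s)\<^sup>2))) *\<^sub>R cis (w * (0 + r * s)))
     = (\<lambda>s. (2 * r) *\<^sub>R (indicat_real {-1..1} s *\<^sub>R (sqrt (1 - s\<^sup>2) *\<^sub>R cis (r * w * s))))"
  proof
    fix s :: real
    have "- r \<le> r * s \<longleftrightarrow> -1 \<le> s" "r * s \<le> r \<longleftrightarrow> s \<le> 1"
      using r mult_le_cancel_left_pos[of r "-1" s] mult_le_cancel_left_pos[of r s 1] by simp_all
    hence 1: "indicat_real {-r..r} (r * s) = indicat_real {-1..1} s"
      by (simp add: indicator_def)
    have "r\<^sup>2 - (r * s)\<^sup>2 = r\<^sup>2 * (1 - s\<^sup>2)" by (simp add: power_mult_distrib algebra_simps)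
    hence "sqrt (r\<^sup>2 - (r * s)\<^sup>2) = r * sqrt (1 - s\<^sup>2)" using r by (simp add: real_sqrt_mult)
    thus "(indicat_real {-r..r} (0 + r * s) * (2 * sqrt (r\<^sup>2 - (0 + r * s)\<^sup>2))) *\<^sub>R cis (w * (0 + r * s))
      = (2 * r) *\<^sub>R (indicat_real {-1..1} s *\<^sub>R (sqrt (1 - s\<^sup>2) *\<^sub>R cis (r * w * s)))"
      using 1 by (simp add: mult_ac)
  qed
  finally show ?thesis unfolding integral_scaleR_right integral_semicircle_cis
    using r by (simp add: scaleR_conv_of_real power2_eq_square)
qed

lemma bes_minus: "bes (- z) = bes z"
  by (simp add: bes_def)

text \<open>A rotation takes the frequency to the first axis. Frequencies already on that axis are
  treated apart, because the factorisation into shears divides by the sine; a negative one is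
  covered by the evenness of \<open>bes\<close>.\<close>

lemma disc_ft_eq:
  assumes r: "0 < r"
  shows "disc_ft r k = of_real (2 * r\<^sup>2 * bes (2 * pi * r * norm (plane_point k)))"
proof -
  obtain a b where k: "plane_point k = (a, b)" by (cases "plane_point k") auto
  define n where "n = norm (plane_point k)"
  have n2: "n\<^sup>2 = a\<^sup>2 + b\<^sup>2" by (simp add: n_def k norm_Pair)
  show ?thesis
  proof (cases "b = 0")
    case True
    have "n = \<bar>a\<bar>" by (simp add: n_def k norm_Pair True)
    hence n: "n = a \<or> n = - a" by linarith
    have "disc_ft r k = of_real (2 * r\<^sup>2 * bes (r * (2 * pi * a)))"
      using disc_ft_axis[OF r, of "2 * pi * a"] by (simp add: disc_ft_def chr_def k True inner_prod_def mult_ac)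
    also have "bes (r * (2 * pi * a)) = bes (2 * pi * r * n)"
      using n bes_minus[of "2 * pi * r * a"] by (auto simp: mult_ac)
    finally show ?thesis by (simp add: n_def)
  next
    case False
    hence "0 < n" unfolding n_def k zero_less_norm_iff by (simp add: zero_prod_def)
    define c s where "c = a / n" and "s = b / n"
    have cs: "c\<^sup>2 + s\<^sup>2 = 1" using \<open>0 < n\<close> n2 False by (simp add: c_def s_def power_divide add_divide_distrib[symmetric])
    have s: "s \<noteq> 0" using False \<open>0 < n\<close> by (simp add: s_def)
    define f where "f x = indicat_real (cball 0 r) x *\<^sub>R cis ((2 * pi * n) * fst x)" for x :: "real \<times> real"
    have m: "(\<lambda>x::real \<times> real. (2 * pi * n) * fst x) \<in> borel_measurable borel"
      by (intro borel_measurable_continuous_onI continuous_intros)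
    have f: "f \<in> borel_measurable borel"
      using borel_measurable_integrable[OF integrable_disc_cis[OF m, of r]] by (simp add: f_def[abs_def])
    have "f (c * fst x + s * snd x, c * snd x - s * fst x) = indicat_real (cball 0 r) x *\<^sub>R chr k x" for x
    proof -
      have "(c * fst x + s * snd x)\<^sup>2 + (c * snd x - s * fst x)\<^sup>2 = (c\<^sup>2 + s\<^sup>2) * ((fst x)\<^sup>2 + (snd x)\<^sup>2)"
        by (simp add: power2_eq_square algebra_simps)
      hence "norm (c * fst x + s * snd x, c * snd x - s * fst x) = norm x"
        by (simp add: norm_prod_def cs)
      hence 1: "indicat_real (cball 0 r) (c * fst x + s * snd x, c * snd x - s * fst x) = indicat_real (cball 0 r) x"
        by (simp add: indicator_def)
      have "n * (c * fst x + s * snd x) = a * fst x + b * snd x"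
        using \<open>0 < n\<close> by (simp add: c_def s_def field_simps)
      hence 2: "2 * pi * n * (c * fst x + s * snd x) = 2 * pi * (plane_point k \<bullet> x)"
        by (simp add: k inner_prod_def)
      show ?thesis unfolding f_def chr_def fst_conv 1 2 ..
    qed
    hence "disc_ft r k = (\<integral>x. f (c * fst x + s * snd x, c * snd x - s * fst x) \<partial>lborel)"
      by (simp add: disc_ft_def)
    also have "\<dots> = (\<integral>x. f x \<partial>lborel)" by (rule integral_rotate[OF f cs s])
    also have "\<dots> = of_real (2 * r\<^sup>2 * bes (r * (2 * pi * n)))"
      unfolding f_def by (rule disc_ft_axis[OF r])
    finally show ?thesis by (simp add: n_def mult_ac)
  qed
qed

section \<open>Fejer kernels of period 1\<close>

definition fejer :: "nat \<Rightarrow> real \<Rightarrow> real" where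
  "fejer N x = (norm (\<Sum>j<N. cis (2 * pi * real j * x)))\<^sup>2 / N"

lemma fejer_nonneg: "0 \<le> fejer N x" by (simp add: fejer_def)

lemma fejer_expand:
  "of_real (fejer N x) = (\<Sum>j<N. \<Sum>l<N. cis (2 * pi * of_int (int j - int l) * x)) / of_nat N"
proof -
  have "complex_of_real (fejer N x) = (\<Sum>j<N. cis (2 * pi * real j * x)) * cnj (\<Sum>l<N. cis (2 * pi * real l * x)) / of_nat N"
    by (simp only: fejer_def of_real_divide complex_norm_square of_real_of_nat_eq)
  also have "(\<Sum>j<N. cis (2 * pi * real j * x)) * cnj (\<Sum>l<N. cis (2 * pi * real l * x))
     = (\<Sum>j<N. \<Sum>l<N. cis (2 * pi * of_int (int j - int l) * x))"
    by (simp add: sum_product cis_cnj cis_mult algebra_simps)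
  finally show ?thesis .
qed

lemma fejer_periodic: "fejer N (of_int n + x) = fejer N x"
proof -
  have "cis (2 * pi * real j * (of_int n + x)) = cis (2 * pi * real j * x)" for j
  proof -
    have "cis (2 * pi * real j * (of_int n + x)) = cis (2 * pi * of_int (int j * n)) * cis (2 * pi * real j * x)"
      by (simp add: cis_mult algebra_simps)
    also have "cis (2 * pi * of_int (int j * n)) = 1" by (rule cis_multiple_2pi) simp
    finally show ?thesis by simp
  qed
  thus ?thesis by (simp add: fejer_def)
qed

lemma continuous_on_fejer: "continuous_on A (fejer N)"
  unfolding fejer_def[abs_def] divide_inverse by (intro continuous_intros)

lemma measurable_fejer [measurable]: "fejer N \<in> borel_measurable borel"
  by (rule borel_measurable_continuous_onI) (rule continuous_on_fejer)

text \<open>The geometric sum with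
  \<open>norm (cis (2 * pi * x) - 1) = 2 * \<bar>sin (pi * x)\<bar>\<close>, and the sine increases
  up to pi/2.\<close>

lemma fejer_le: 
  assumes d: "0 < d" "d \<le> \<bar>x\<bar>" "\<bar>x\<bar> \<le> 1/2"
  shows "fejer N x \<le> 1 / (N * (sin (pi * d))\<^sup>2)"
proof -
  have sd: "0 < sin (pi * d)" using d by (intro sin_gt_zero) auto
  have le: "sin (pi * d) \<le> sin (pi * \<bar>x\<bar>)"
    using d by (intro sin_monotone_2pi_le) (auto intro: mult_left_mono order.trans[of _ 0])
  define S where "S = (\<Sum>j<N. cis (2 * pi * real j * x))"
  have "S = (\<Sum>j<N. cis (2 * pi * x) ^ j)"
    unfolding S_def by (intro sum.cong refl) (simp add: Complex.DeMoivre mult_ac)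
  hence "(cis (2 * pi * x) - 1) * S = cis (2 * pi * x) ^ N - 1"
    by (simp add: power_diff_1_eq)
  moreover have "norm (cis (2 * pi * x) ^ N - 1) \<le> 2"
    using norm_triangle_ineq4[of "cis (2 * pi * x) ^ N" 1] by (simp add: norm_power)
  ultimately have 1: "norm (cis (2 * pi * x) - 1) * norm S \<le> 2" by (metis norm_mult)
  have "norm (cis (2 * pi * x) - 1) = 2 * \<bar>sin (pi * x)\<bar>"
  proof -
    have "cis (2 * pi * x) - 1 = cis (pi * x) * (cis (pi * x) - cis (- (pi * x)))"
      by (simp add: cis_mult algebra_simps)
    moreover have "cis (pi * x) - cis (- (pi * x)) = Complex 0 (2 * sin (pi * x))"
      by (simp add: complex_eq_iff)
    ultimately show ?thesis by (simp add: norm_mult complex_norm real_sqrt_mult)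
  qed
  also have "\<bar>sin (pi * x)\<bar> = sin (pi * \<bar>x\<bar>)"
  proof -
    have "0 \<le> sin (pi * \<bar>x\<bar>)" using sd le by linarith
    thus ?thesis by (cases "x \<ge> 0") auto
  qed
  finally have 2: "sin (pi * \<bar>x\<bar>) * norm S \<le> 1" using 1 by simp
  have "sin (pi * d) * norm S \<le> sin (pi * \<bar>x\<bar>) * norm S" by (intro mult_right_mono le) simp
  hence "sin (pi * d) * norm S \<le> 1" using 2 by linarith
  hence "(sin (pi * d) * norm S)\<^sup>2 \<le> 1" using sd by (intro power_le_one) auto
  hence "(norm S)\<^sup>2 \<le> 1 / (sin (pi * d))\<^sup>2" using sd by (simp add: field_simps power_mult_distrib)
  hence "(norm S)\<^sup>2 / N \<le> 1 / (sin (pi * d))\<^sup>2 / N" by (rule divide_right_mono) simp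
  thus ?thesis by (simp add: fejer_def S_def mult.commute)
qed

text \<open>Half-open, so that its integer translates partition the line and every point of the
  plane has exactly one nearest cell in \<open>cell_translate\<close>.\<close>

definition half_box :: "real set" where "half_box = {-1/2..<1/2}"

lemma half_box_sets [measurable]: "half_box \<in> sets borel" by (simp add: half_box_def)

lemma integral_half_closed:
  fixes f :: "real \<Rightarrow> 'b::{banach,second_countable_topology}"
  assumes "f \<in> borel_measurable borel"
  shows "(\<integral>t. indicat_real half_box t *\<^sub>R f t \<partial>lborel) = (\<integral>t. indicat_real {-1/2..1/2} t *\<^sub>R f t \<partial>lborel)"
proof (rule integral_cong_AE)
  show "AE t in lborel. indicat_real half_box t *\<^sub>R f t = indicat_real {-1/2..1/2} t *\<^sub>R f t"
    using AE_lborel_singleton[of "1/2 :: real"] by eventually_elim (auto simp: half_box_def indicator_def)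
qed (use assms in auto)

lemma integrable_half:
  fixes f :: "real \<Rightarrow> 'b::{banach,second_countable_topology}"
  assumes "continuous_on UNIV f"
  shows "integrable lborel (\<lambda>t. indicat_real half_box t *\<^sub>R f t)"
proof -
  have "set_integrable lborel {-1/2..1/2} f"
    by (intro borel_integrable_atLeastAtMost' continuous_on_subset[OF assms]) auto
  hence "set_integrable lborel half_box f" by (rule set_integrable_subset) (auto simp: half_box_def)
  thus ?thesis by (simp add: set_integrable_def)
qed

lemma integral_half_cis:
  "(\<integral>t. indicat_real half_box t *\<^sub>R cis (2 * pi * of_int n * t) \<partial>lborel) = (if n = 0 then 1 else 0)"
proof -
  have m: "(\<lambda>t. cis (2 * pi * of_int n * t)) \<in> borel_measurable borel"
    by (intro borel_measurable_continuous_onI continuous_intros)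
  show ?thesis
  proof (cases "n = 0")
    case True thus ?thesis unfolding integral_half_closed[OF m] by simp
  next
    case False
    define F where "F t = cis (2 * pi * of_int n * t) / (2 * pi * \<i> * of_int n)" for t
    have "(\<integral>t. indicat_real {-1/2..1/2} t *\<^sub>R cis (2 * pi * of_int n * t) \<partial>lborel) = F (1/2) - F (-1/2)"
    proof (rule integral_FTC_atLeastAtMost)
      fix t :: real
      have "((\<lambda>t. cis (2 * pi * of_int n * t)) has_vector_derivative (\<i> * of_real (2 * pi * of_int n) * cis (2 * pi * of_int n * t))) (at t within {-1/2..1/2})"
        by (intro has_vector_derivative_cis) (auto intro!: derivative_eq_intros)
      from has_vector_derivative_divide[OF this, of "2 * pi * \<i> * of_int n"] False
      show "(F has_vector_derivative cis (2 * pi * of_int n * t)) (at t within {-1/2..1/2})"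
        unfolding F_def by (simp add: field_simps)
    qed (auto intro!: continuous_intros)
    also have "F (1/2) = F (-1/2)"
    proof -
      have "cis (pi * of_int n) = cis (2 * pi * of_int n) * cis (- (pi * of_int n))"
        by (subst cis_mult) (simp add: algebra_simps)
      also have "cis (2 * pi * of_int n) = 1" by (rule cis_multiple_2pi) simp
      finally have e: "cis (pi * of_int n) = cis (- (pi * of_int n))" by (simp only: mult_1)
      have "2 * pi * of_int n * (1/2) = pi * of_int n" "2 * pi * of_int n * (-1/2) = - (pi * of_int n)" by simp_all
      hence "cis (2 * pi * of_int n * (1/2)) = cis (2 * pi * of_int n * (-1/2))" using e by metis
      thus ?thesis unfolding F_def by (rule arg_cong)
    qed
    finally show ?thesis using False by (simp add: integral_half_closed[OF m])
  qed
qed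

lemma integral_fejer:
  assumes N: "1 \<le> N"
  shows "(\<integral>t. indicat_real half_box t * fejer N t \<partial>lborel) = 1"
proof -
  have int: "integrable lborel (\<lambda>t. indicat_real half_box t *\<^sub>R cis (2 * pi * of_int n * t))" for n
    by (intro integrable_half continuous_intros)
  have "complex_of_real (\<integral>t. indicat_real half_box t * fejer N t \<partial>lborel)
     = (\<integral>t. complex_of_real (indicat_real half_box t * fejer N t) \<partial>lborel)"
    by (rule integral_complex_of_real[symmetric])
  also have "\<dots> = (\<integral>t. (\<Sum>j<N. \<Sum>l<N. indicat_real half_box t *\<^sub>R cis (2 * pi * of_int (int j - int l) * t)) / of_nat N \<partial>lborel)"
    by (simp only: of_real_mult fejer_expand scaleR_conv_of_real sum_distrib_left times_divide_eq_right)
  also have "\<dots> = (\<Sum>j<N. \<Sum>l<N. if int j - int l = 0 then 1 else 0) / of_nat N"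
  proof -
    have "(\<integral>t. (\<Sum>j<N. \<Sum>l<N. indicat_real half_box t *\<^sub>R cis (2 * pi * of_int (int j - int l) * t)) \<partial>lborel)
       = (\<Sum>j<N. \<integral>t. (\<Sum>l<N. indicat_real half_box t *\<^sub>R cis (2 * pi * of_int (int j - int l) * t)) \<partial>lborel)"
      by (intro Bochner_Integration.integral_sum Bochner_Integration.integrable_sum int)
    also have "\<dots> = (\<Sum>j<N. \<Sum>l<N. \<integral>t. indicat_real half_box t *\<^sub>R cis (2 * pi * of_int (int j - int l) * t) \<partial>lborel)"
      by (intro sum.cong refl Bochner_Integration.integral_sum int)
    finally show ?thesis by (simp only: integral_divide_zero integral_half_cis)
  qed
  also have "\<dots> = 1" using N by simp
  finally show ?thesis by (simp only: of_real_eq_1_iff)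
qed

lemma integrable_half_fejer: "integrable lborel (\<lambda>t. indicat_real half_box t * fejer N t)"
  using integrable_half[OF continuous_on_fejer, of N] by simp

lemma integrable_half_abs_fejer: "integrable lborel (\<lambda>t. indicat_real half_box t * (\<bar>t\<bar> * fejer N t))"
  using integrable_half[of "\<lambda>t. \<bar>t\<bar> * fejer N t"] by (simp add: continuous_intros continuous_on_fejer)

text \<open>The first absolute moment is exactly the error made when the kernel is tested against a
  Lipschitz function. Below \<open>d\<close> the total mass 1 bounds it by \<open>d\<close>; beyond
  \<open>d\<close> the kernel itself is \<open>O(1 / N)\<close>.\<close>

lemma fejer_moment: "(\<lambda>N. \<integral>t. indicat_real half_box t * (\<bar>t\<bar> * fejer N t) \<partial>lborel) \<longlonglongrightarrow> 0"
proof (rule tendstoI)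
  fix e :: real assume e: "0 < e"
  define d where "d = min (e / 2) (1/4)"
  have d: "0 < d" "d \<le> e / 2" "d \<le> 1/4" using e by (auto simp: d_def)
  have sd: "0 < sin (pi * d)" using d by (intro sin_gt_zero) auto
  have bd: "(\<integral>t. indicat_real half_box t * (\<bar>t\<bar> * fejer N t) \<partial>lborel) \<le> d + 1 / (N * (sin (pi * d))\<^sup>2)"
    if N: "1 \<le> N" for N
  proof -
    let ?B = "1 / (N * (sin (pi * d))\<^sup>2)"
    have "(\<integral>t. indicat_real half_box t * (\<bar>t\<bar> * fejer N t) \<partial>lborel)
      \<le> (\<integral>t. d * (indicat_real half_box t * fejer N t) + ?B * indicat_real half_box t \<partial>lborel)"
    proof (rule integral_mono)
      show "integrable lborel (\<lambda>t. d * (indicat_real half_box t * fejer N t) + ?B * indicat_real half_box t)"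
        by (intro Bochner_Integration.integrable_add integrable_mult_right integrable_half_fejer integrable_real_indicator)
          (auto simp: half_box_def)
      fix t :: real
      have B: "0 \<le> ?B" by simp
      show "indicat_real half_box t * (\<bar>t\<bar> * fejer N t) \<le> d * (indicat_real half_box t * fejer N t) + ?B * indicat_real half_box t"
      proof (cases "t \<in> half_box")
        case True
        hence t: "\<bar>t\<bar> \<le> 1/2" by (auto simp: half_box_def)
        show ?thesis
        proof (cases "\<bar>t\<bar> \<le> d")
          case True
          thus ?thesis using \<open>t \<in> half_box\<close> mult_right_mono[OF True fejer_nonneg[of N t]] by (simp add: add_increasing2)
        next
          case False
          have "\<bar>t\<bar> * fejer N t \<le> 1 * ?B"
            using False t d by (intro mult_mono fejer_le fejer_nonneg) auto
          moreover have "0 \<le> d * fejer N t" using d fejer_nonneg by simp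
          ultimately show ?thesis using \<open>t \<in> half_box\<close> by simp
        qed
      qed simp
    qed (rule integrable_half_abs_fejer)
    also have "\<dots> = d * 1 + ?B * measure lborel half_box"
      using integral_fejer[OF N] integrable_half_fejer[of N]
      by (subst Bochner_Integration.integral_add) (auto simp: half_box_def)
    also have "measure lborel half_box = 1" by (simp add: half_box_def)
    finally show ?thesis by simp
  qed
  have "(\<lambda>N. 1 / (real N * (sin (pi * d))\<^sup>2)) \<longlonglongrightarrow> 0"
  proof -
    have "(\<lambda>N. (1 / (sin (pi * d))\<^sup>2) * (1 / real N)) \<longlonglongrightarrow> (1 / (sin (pi * d))\<^sup>2) * 0"
      by (intro tendsto_intros lim_1_over_n)
    thus ?thesis by (simp add: field_simps)
  qed
  hence "\<forall>\<^sub>F N in sequentially. 1 / (real N * (sin (pi * d))\<^sup>2) < e / 2"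
    using e by (intro order_tendstoD) auto
  thus "\<forall>\<^sub>F N in sequentially. dist (\<integral>t. indicat_real half_box t * (\<bar>t\<bar> * fejer N t) \<partial>lborel) 0 < e"
    using eventually_ge_at_top[of 1]
  proof eventually_elim
    case (elim N)
    have "0 \<le> (\<integral>t. indicat_real half_box t * (\<bar>t\<bar> * fejer N t) \<partial>lborel)"
      by (intro Bochner_Integration.integral_nonneg) (simp add: fejer_nonneg)
    thus ?case using elim bd[of N] d by (simp add: dist_real_def)
  qed
qed

subsection \<open>Poisson summation for the overlap\<close>

text \<open>At a nonzero lattice point
  \<open>(1 + x) * (1 + y) \<le> 4 * (x\<^sup>2 + y\<^sup>2)\<close> for the absolute coordinates,
  so the inverse cube is dominated by a product of two summable one-dimensional terms.\<close>

lemma summable_on_norm_cube: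
  "(\<lambda>k. norm (plane_point k) powi (-3)) summable_on (UNIV - {(0, 0)})"
proof -
  let ?a = "\<lambda>k::int. (1 + real_of_int \<bar>k\<bar>) powr (-3/2)"
  define S where "S = infsum ?a UNIV"
  have "(\<lambda>(x, y). ?a x * ?a y) summable_on (SIGMA x:UNIV. UNIV)"
  proof (rule summable_on_SigmaI)
    fix x :: int
    show "((\<lambda>y. case (x, y) of (x, y) \<Rightarrow> ?a x * ?a y) has_sum (?a x * S)) UNIV"
      unfolding S_def using summable_on_int_powr by (auto intro!: has_sum_cmult_right)
    show "(\<lambda>x. ?a x * S) summable_on UNIV" by (rule summable_on_cmult_left[OF summable_on_int_powr])
  qed auto
  hence "(\<lambda>k. 8 * (?a (fst k) * ?a (snd k))) summable_on UNIV"
    by (intro summable_on_cmult_right) (simp add: case_prod_unfold)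
  hence s: "(\<lambda>k. 8 * (?a (fst k) * ?a (snd k))) summable_on (UNIV - {(0, 0)})"
    by (rule summable_on_subset_banach) auto
  show ?thesis
  proof (rule summable_on_comparison_test[OF s])
    fix k :: "int \<times> int" assume "k \<in> UNIV - {(0, 0)}"
    hence k: "fst k \<noteq> 0 \<or> snd k \<noteq> 0" by (cases k) auto
    define x y n where "x = \<bar>fst k\<bar>" and "y = \<bar>snd k\<bar>" and "n = norm (plane_point k)"
    have n2: "n\<^sup>2 = (real_of_int x)\<^sup>2 + (real_of_int y)\<^sup>2"
      by (simp add: n_def x_def y_def plane_point_def norm_Pair)
    have x0: "0 \<le> x" and y0: "0 \<le> y" by (auto simp: x_def y_def)
    have xy: "1 \<le> x \<or> 1 \<le> y" using k by (auto simp: x_def y_def)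
    have index_square: "a \<le> a\<^sup>2" if "0 \<le> a" for a :: int
      using that by (cases "a = 0") (simp_all add: power2_eq_square)
    have "(1 + x) * (1 + y) \<le> 4 * (x\<^sup>2 + y\<^sup>2)"
    proof -
      have "2 * (x * y) \<le> x\<^sup>2 + y\<^sup>2" using sum_squares_ge_zero[of "x - y" 0]
        by (simp add: power2_eq_square algebra_simps)
      moreover have "1 \<le> x\<^sup>2 + y\<^sup>2"
        using xy index_square[OF x0] index_square[OF y0] x0 y0 by linarith
      ultimately show ?thesis using index_square[OF x0] index_square[OF y0] x0 y0 by (simp add: algebra_simps)
    qed
    hence "real_of_int ((1 + x) * (1 + y)) \<le> real_of_int (4 * (x\<^sup>2 + y\<^sup>2))" by (simp only: of_int_le_iff)
    hence le: "(1 + real_of_int x) * (1 + real_of_int y) \<le> 4 * n\<^sup>2" by (simp add: n2)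
    have n: "0 < n" using k by (auto simp: n_def plane_point_def zero_prod_def)
    have "norm (plane_point k) powi (-3) = 8 * (4 * n\<^sup>2) powr (-3/2)"
    proof -
      have "(4 * n\<^sup>2) powr (-3/2) = ((2 * n)\<^sup>2) powr (-3/2)" by (simp add: power_mult_distrib)
      also have "(2 * n)\<^sup>2 = (2 * n) powr 2" using n by simp
      also have "\<dots> powr (-3/2) = (2 * n) powr (2 * (-3/2))" by (rule powr_powr)
      also have "\<dots> = (2 * n) powr (-3)" by simp
      also have "\<dots> = 1 / (8 * n ^ 3)" using n by (simp add: powr_minus_divide power_mult_distrib)
      finally show ?thesis using n by (simp add: n_def power_int_minus field_simps)
    qed
    also have "(4 * n\<^sup>2) powr (-3/2) \<le> ((1 + real_of_int x) * (1 + real_of_int y)) powr (-3/2)"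
      using x0 y0 le by (intro powr_mono2') (auto intro!: mult_pos_pos)
    also have "\<dots> = ?a (fst k) * ?a (snd k)"
      using x0 y0 by (simp add: powr_mult x_def y_def)
    finally show "norm (plane_point k) powi (-3) \<le> 8 * (?a (fst k) * ?a (snd k))" by simp
  qed simp
qed

lemma integrable_lens_scaleR:
  fixes f :: "real \<times> real \<Rightarrow> 'b::{banach, second_countable_topology}"
  assumes r: "0 \<le> r" and f: "continuous_on UNIV f"
  shows "integrable lborel (\<lambda>x. lens r x *\<^sub>R f x)"
proof -
  have "integrable lborel (\<lambda>x. indicator (cball 0 (2 * r)) x *\<^sub>R (lens r x *\<^sub>R f x))"
    by (intro borel_integrable_compact compact_cball continuous_intros
        continuous_on_subset[OF continuous_on_lens[OF r]] continuous_on_subset[OF f]) auto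
  also have "(\<lambda>x. indicator (cball 0 (2 * r)) x *\<^sub>R (lens r x *\<^sub>R f x)) = (\<lambda>x. lens r x *\<^sub>R f x)"
  proof
    fix x show "indicator (cball 0 (2 * r)) x *\<^sub>R (lens r x *\<^sub>R f x) = lens r x *\<^sub>R f x"
      using lens_eq_0[of r x] by (cases "2 * r < norm x") (auto simp: indicator_def)
  qed
  finally show ?thesis .
qed

lemma continuous_on_chr: "continuous_on A (chr k)"
  unfolding chr_def[abs_def] by (intro continuous_intros)

section \<open>The frequency side of Poisson summation\<close>

definition fejer2 :: "nat \<Rightarrow> real \<times> real \<Rightarrow> real" where
  "fejer2 N x = fejer N (fst x) * fejer N (snd x)"

lemma fejer2_nonneg: "0 \<le> fejer2 N x" by (simp add: fejer2_def fejer_nonneg)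

lemma continuous_on_fejer2: "continuous_on A (fejer2 N)"
  unfolding fejer2_def[abs_def]
  by (intro continuous_intros continuous_on_compose2[OF continuous_on_fejer[of UNIV]]) auto

lemma fejer2_periodic: "fejer2 N (plane_point m + x) = fejer2 N x"
  by (simp add: fejer2_def plane_point_def fejer_periodic)

definition index_square :: "nat \<Rightarrow> (nat \<times> nat) set" where "index_square N = {..<N} \<times> {..<N}"

definition index_diff :: "nat \<times> nat \<Rightarrow> int" where "index_diff p = int (fst p) - int (snd p)"

lemma fejer2_expand:
  "of_real (fejer2 N x) = (\<Sum>p\<in>index_square N. \<Sum>q\<in>index_square N. chr (index_diff p, index_diff q) x) / (of_nat N)\<^sup>2"
proof -
  have 1: "of_real (fejer N t) = (\<Sum>p\<in>index_square N. cis (2 * pi * of_int (index_diff p) * t)) / of_nat N" for t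
    unfolding fejer_expand index_square_def sum.cartesian_product index_diff_def case_prod_unfold ..
  have "of_real (fejer2 N x) = (\<Sum>p\<in>index_square N. cis (2 * pi * of_int (index_diff p) * fst x)) * (\<Sum>p\<in>index_square N. cis (2 * pi * of_int (index_diff p) * snd x)) / (of_nat N)\<^sup>2"
    unfolding fejer2_def of_real_mult 1 by (simp add: power2_eq_square)
  also have "(\<Sum>p\<in>index_square N. cis (2 * pi * of_int (index_diff p) * fst x)) * (\<Sum>p\<in>index_square N. cis (2 * pi * of_int (index_diff p) * snd x))
    = (\<Sum>p\<in>index_square N. \<Sum>q\<in>index_square N. chr (index_diff p, index_diff q) x)"
    unfolding sum_product
    by (intro sum.cong refl) (simp add: chr_def plane_point_def inner_prod_def cis_mult algebra_simps)
  finally show ?thesis .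
qed

text \<open>The kernel is a trigonometric polynomial, so for fixed \<open>N\<close> this is a finite
  identity; every coefficient on the right is a nonnegative square.\<close>

lemma lens_fejer2_fourier:
  assumes r: "0 \<le> r"
  shows "(\<integral>x. lens r x * fejer2 N x \<partial>lborel) = (\<Sum>p\<in>index_square N. \<Sum>q\<in>index_square N. (norm (disc_ft r (index_diff p, index_diff q)))\<^sup>2) / (real N)\<^sup>2"
proof -
  have int: "integrable lborel (\<lambda>x. lens r x *\<^sub>R chr k x)" for k
    by (intro integrable_lens_scaleR r continuous_on_chr)
  have "complex_of_real (\<integral>x. lens r x * fejer2 N x \<partial>lborel) = (\<integral>x. complex_of_real (lens r x * fejer2 N x) \<partial>lborel)"
    by (rule integral_complex_of_real[symmetric])
  also have "\<dots> = (\<integral>x. (\<Sum>p\<in>index_square N. \<Sum>q\<in>index_square N. lens r x *\<^sub>R chr (index_diff p, index_diff q) x) / (of_nat N)\<^sup>2 \<partial>lborel)"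
    by (simp only: of_real_mult fejer2_expand scaleR_conv_of_real sum_distrib_left times_divide_eq_right)
  also have "\<dots> = (\<integral>x. (\<Sum>p\<in>index_square N. \<Sum>q\<in>index_square N. lens r x *\<^sub>R chr (index_diff p, index_diff q) x) \<partial>lborel) / (of_nat N)\<^sup>2"
    by (rule integral_divide_zero)
  also have "(\<integral>x. (\<Sum>p\<in>index_square N. \<Sum>q\<in>index_square N. lens r x *\<^sub>R chr (index_diff p, index_diff q) x) \<partial>lborel)
     = (\<Sum>p\<in>index_square N. \<integral>x. (\<Sum>q\<in>index_square N. lens r x *\<^sub>R chr (index_diff p, index_diff q) x) \<partial>lborel)"
    by (intro Bochner_Integration.integral_sum Bochner_Integration.integrable_sum int)
  also have "\<dots> = (\<Sum>p\<in>index_square N. \<Sum>q\<in>index_square N. \<integral>x. lens r x *\<^sub>R chr (index_diff p, index_diff q) x \<partial>lborel)"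
    by (intro sum.cong refl Bochner_Integration.integral_sum int)
  also have "\<dots> / (of_nat N)\<^sup>2 = complex_of_real ((\<Sum>p\<in>index_square N. \<Sum>q\<in>index_square N. (norm (disc_ft r (index_diff p, index_diff q)))\<^sup>2) / (real N)\<^sup>2)"
    by (simp add: lens_ft)
  finally show ?thesis by (simp only: of_real_eq_iff)
qed

lemma card_dif2_eq: "k \<in> {- int N..int N} \<Longrightarrow> int (card {p \<in> index_square N. index_diff p = k}) = int N - \<bar>k\<bar>"
proof (cases "k \<ge> 0")
  case True
  assume k: "k \<in> {- int N..int N}"
  have "{p \<in> index_square N. index_diff p = k} = (\<lambda>l. (l + nat k, l)) ` {..<N - nat k}"
    using True k by (auto simp: index_square_def index_diff_def image_iff)
  moreover have "inj_on (\<lambda>l. (l + nat k, l)) {..<N - nat k}" by (auto simp: inj_on_def)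
  ultimately show ?thesis using True k by (simp add: card_image of_nat_diff nat_le_iff)
next
  case False
  assume k: "k \<in> {- int N..int N}"
  have "{p \<in> index_square N. index_diff p = k} = (\<lambda>l. (l, l + nat (- k))) ` {..<N - nat (- k)}"
    using False k by (auto simp: index_square_def index_diff_def image_iff)
  moreover have "inj_on (\<lambda>l. (l, l + nat (- k))) {..<N - nat (- k)}" by (auto simp: inj_on_def)
  ultimately show ?thesis using False k by (simp add: card_image of_nat_diff nat_le_iff)
qed

lemma sum_sq_dif2:
  fixes F :: "int \<Rightarrow> real"
  shows "(\<Sum>p\<in>index_square N. F (index_diff p)) = (\<Sum>k\<in>{- int N..int N}. (real N - \<bar>k\<bar>) * F k)"
proof -
  have "(\<Sum>p\<in>index_square N. F (index_diff p)) = (\<Sum>k\<in>{- int N..int N}. \<Sum>p\<in>{p\<in>index_square N. index_diff p = k}. F (index_diff p))"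
    by (rule sum.group[symmetric]) (auto simp: index_square_def index_diff_def)
  also have "\<dots> = (\<Sum>k\<in>{- int N..int N}. (real N - \<bar>k\<bar>) * F k)"
  proof (rule sum.cong[OF refl])
    fix k assume k: "k \<in> {- int N..int N}"
    have "(\<Sum>p\<in>{p\<in>index_square N. index_diff p = k}. F (index_diff p)) = (\<Sum>p\<in>{p\<in>index_square N. index_diff p = k}. F k)" by (intro sum.cong) auto
    also have "\<dots> = real (card {p\<in>index_square N. index_diff p = k}) * F k" by simp
    also have "real (card {p\<in>index_square N. index_diff p = k}) = real_of_int (int N - \<bar>k\<bar>)"
      unfolding card_dif2_eq[OF k, symmetric] by simp
    finally show "(\<Sum>p\<in>{p\<in>index_square N. index_diff p = k}. F (index_diff p)) = (real N - \<bar>k\<bar>) * F k" by simp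
  qed
  finally show ?thesis .
qed

definition cesaro :: "nat \<Rightarrow> int \<Rightarrow> real" where
  "cesaro N k = max 0 (1 - real_of_int \<bar>k\<bar> / N)"

lemma cesaro_tendsto: "(\<lambda>N. cesaro N k) \<longlonglongrightarrow> 1"
proof -
  have "(\<lambda>N. max 0 (1 - real_of_int \<bar>k\<bar> * (1 / N))) \<longlonglongrightarrow> max 0 (1 - real_of_int \<bar>k\<bar> * 0)"
    by (intro tendsto_intros lim_1_over_n)
  thus ?thesis by (simp add: cesaro_def)
qed

lemma cesaro_bounds: "0 \<le> cesaro N k" "cesaro N k \<le> 1"
  by (auto simp: cesaro_def)

text \<open>Exactly \<open>N - \<bar>k\<bar>\<close> index pairs have difference \<open>k\<close>.
  Writing the average as an infinite sum with weights tending to 1 prepares it for dominated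
  convergence.\<close>

lemma sum_sq_cesaro:
  fixes F :: "int \<times> int \<Rightarrow> real"
  assumes N: "1 \<le> N"
  shows "(\<Sum>p\<in>index_square N. \<Sum>q\<in>index_square N. F (index_diff p, index_diff q)) / (real N)\<^sup>2 = (\<Sum>\<^sub>\<infinity>k. cesaro N (fst k) * cesaro N (snd k) * F k)"
proof -
  let ?I = "{- int N..int N}"
  have w: "(real N - \<bar>k\<bar>) / N = cesaro N k" if "k \<in> ?I" for k
    using that N by (auto simp: cesaro_def field_simps max_def)
  have w0: "cesaro N k = 0" if "k \<notin> ?I" for k
  proof -
    have "int N \<le> \<bar>k\<bar>" using that by auto
    hence "real N \<le> real_of_int \<bar>k\<bar>" by linarith
    thus ?thesis using N by (simp add: cesaro_def field_simps)
  qed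
  have "(\<Sum>p\<in>index_square N. \<Sum>q\<in>index_square N. F (index_diff p, index_diff q)) = (\<Sum>a\<in>?I. (real N - \<bar>a\<bar>) * (\<Sum>b\<in>?I. (real N - \<bar>b\<bar>) * F (a, b)))"
  proof -
    have "(\<Sum>q\<in>index_square N. F (a, index_diff q)) = (\<Sum>b\<in>?I. (real N - \<bar>b\<bar>) * F (a, b))" for a
      by (rule sum_sq_dif2[where F = "\<lambda>b. F (a, b)"])
    thus ?thesis using sum_sq_dif2[where F = "\<lambda>a. \<Sum>b\<in>?I. (real N - \<bar>b\<bar>) * F (a, b)"] by simp
  qed
  also have "\<dots> / (real N)\<^sup>2 = (\<Sum>a\<in>?I. \<Sum>b\<in>?I. ((real N - \<bar>a\<bar>) / N) * ((real N - \<bar>b\<bar>) / N) * F (a, b))"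
    by (simp add: sum_divide_distrib sum_distrib_left power2_eq_square mult.assoc)
  also have "\<dots> = (\<Sum>a\<in>?I. \<Sum>b\<in>?I. cesaro N a * cesaro N b * F (a, b))"
    by (intro sum.cong refl) (simp only: w)
  also have "\<dots> = (\<Sum>k\<in>?I \<times> ?I. cesaro N (fst k) * cesaro N (snd k) * F k)"
    by (simp add: sum.cartesian_product case_prod_unfold)
  also have "\<dots> = (\<Sum>\<^sub>\<infinity>k\<in>?I \<times> ?I. cesaro N (fst k) * cesaro N (snd k) * F k)" by simp
  also have "\<dots> = (\<Sum>\<^sub>\<infinity>k. cesaro N (fst k) * cesaro N (snd k) * F k)"
  proof (rule infsum_cong_neutral)
    fix k :: "int \<times> int" assume "k \<in> UNIV - ?I \<times> ?I"
    hence "fst k \<notin> ?I \<or> snd k \<notin> ?I" by (cases k) auto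
    thus "cesaro N (fst k) * cesaro N (snd k) * F k = 0" using w0 by auto
  qed auto
  finally show ?thesis .
qed

section \<open>The lattice side of Poisson summation\<close>

lemma integral_plane_prod:
  fixes f g :: "real \<Rightarrow> real"
  assumes f: "integrable lborel f" and g: "integrable lborel g"
  shows "integrable lborel (\<lambda>x. f (fst x) * g (snd x))"
    "(\<integral>x. f (fst x) * g (snd x) \<partial>lborel) = (\<integral>t. f t \<partial>lborel) * (\<integral>t. g t \<partial>lborel)"
proof -
  have int: "integrable (lborel \<Otimes>\<^sub>M lborel) (\<lambda>(x, y). f x * g y)"
  proof (rule lborel_pair.Fubini_integrable)
    have [measurable]: "f \<in> borel_measurable borel" "g \<in> borel_measurable borel"
      using borel_measurable_integrable[OF f] borel_measurable_integrable[OF g] by auto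
    show "(\<lambda>(x, y). f x * g y) \<in> borel_measurable (lborel \<Otimes>\<^sub>M lborel)" by measurable
    have "integrable lborel (\<lambda>x. norm (f x) * (\<integral>y. norm (g y) \<partial>lborel))"
      by (intro integrable_mult_left integrable_norm f)
    thus "integrable lborel (\<lambda>x. \<integral>y. norm (case (x, y) of (x, y) \<Rightarrow> f x * g y) \<partial>lborel)"
      by (simp add: norm_mult abs_mult)
    show "AE x in lborel. integrable lborel (\<lambda>y. case (x, y) of (x, y) \<Rightarrow> f x * g y)"
      using g by simp
  qed
  thus "integrable lborel (\<lambda>x. f (fst x) * g (snd x))"
    by (simp add: lborel_prod case_prod_unfold)
  show "(\<integral>x. f (fst x) * g (snd x) \<partial>lborel) = (\<integral>t. f t \<partial>lborel) * (\<integral>t. g t \<partial>lborel)"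
    using lborel_pair.integral_fst[OF int] by (simp add: lborel_prod case_prod_unfold)
qed

definition cell :: "real \<times> real \<Rightarrow> real" where
  "cell x = indicat_real half_box (fst x) * indicat_real half_box (snd x)"

lemma measurable_cell [measurable]: "cell \<in> borel_measurable borel"
proof -
  have h: "indicat_real half_box \<in> borel_measurable borel" by simp
  have f: "(fst :: real \<times> real \<Rightarrow> real) \<in> borel_measurable borel" and s: "(snd :: real \<times> real \<Rightarrow> real) \<in> borel_measurable borel"
    by (intro borel_measurable_continuous_onI continuous_intros)+
  show ?thesis unfolding cell_def[abs_def]
    by (rule borel_measurable_times[OF measurable_compose[OF f h] measurable_compose[OF s h]])
qed

lemma cell_nonneg: "0 \<le> cell x" by (simp add: cell_def)

definition round_plane :: "real \<times> real \<Rightarrow> int \<times> int" where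
  "round_plane x = (\<lfloor>fst x + 1/2\<rfloor>, \<lfloor>snd x + 1/2\<rfloor>)"

lemma cell_translate: "cell (- plane_point m + x) = of_bool (m = round_plane x)"
proof -
  have "- real_of_int a + t \<in> half_box \<longleftrightarrow> a = \<lfloor>t + 1/2\<rfloor>" for a t
    unfolding half_box_def by (auto simp: floor_eq_iff eq_commute[of a])
  thus ?thesis by (cases m) (auto simp: cell_def plane_point_def round_plane_def indicator_def)
qed

definition lattice_box :: "nat \<Rightarrow> (int \<times> int) set" where
  "lattice_box B = {- int B..int B} \<times> {- int B..int B}"

text \<open>The translated unit cells form a partition of unity. The overlap vanishes beyond
  distance \<open>2 * r\<close>, so finitely many cells suffice; the extra 1 in the bound on
  \<open>B\<close> absorbs the rounding.\<close>

lemma lens_sum_cell: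
  assumes r: "0 \<le> r" and B: "2 * r + 1 \<le> B"
  shows "lens r x * g = (\<Sum>m\<in>lattice_box B. lens r x * g * cell (- plane_point m + x))"
proof (cases "2 * r < norm x")
  case True thus ?thesis by (simp add: lens_eq_0)
next
  case False
  have "\<bar>fst x\<bar> \<le> 2 * r" "\<bar>snd x\<bar> \<le> 2 * r"
    using False norm_fst_le[of "fst x" "snd x"] norm_snd_le[of "snd x" "fst x"] by auto
  hence "round_plane x \<in> lattice_box B"
    using B by (auto simp: round_plane_def lattice_box_def floor_le_iff le_floor_iff)
  thus ?thesis unfolding cell_translate by (simp add: sum.delta lattice_box_def)
qed

text \<open>Translating by \<open>m\<close> and using periodicity moves the cell to the origin,
  where the kernel has mass 1. The Lipschitz bound for the overlap turns the deviation into first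
  moments, one for each coordinate, whence the factor 2.\<close>

lemma lens_fejer2_cell:
  assumes r: "0 \<le> r" and N: "1 \<le> N"
  shows "\<bar>(\<integral>x. lens r x * fejer2 N x * cell (- plane_point m + x) \<partial>lborel) - lens r (plane_point m)\<bar>
     \<le> 2 * (pi * (2 * r + 1)) * (\<integral>t. indicat_real half_box t * (\<bar>t\<bar> * fejer N t) \<partial>lborel)"
proof -
  let ?C = "pi * (2 * r + 1)" and ?h = "\<lambda>t. indicat_real half_box t * fejer N t"
    and ?k = "\<lambda>t. indicat_real half_box t * (\<bar>t\<bar> * fejer N t)"
  define K where "K y = cell y * fejer2 N y" for y
  have K_eq: "K y = ?h (fst y) * ?h (snd y)" for y
    by (simp add: K_def cell_def fejer2_def)
  have K: "integrable lborel K" "(\<integral>y. K y \<partial>lborel) = 1"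
    unfolding K_eq[abs_def] using integral_plane_prod[OF integrable_half_fejer integrable_half_fejer, of N N]
      integral_fejer[OF N] by auto
  have K0: "0 \<le> K y" for y by (simp add: K_def cell_nonneg fejer2_nonneg)
  have Km: "K \<in> borel_measurable borel" using borel_measurable_integrable[OF K(1)] by simp
  have lm: "(\<lambda>y. lens r (plane_point m + y)) \<in> borel_measurable borel"
    by (intro borel_measurable_continuous_onI continuous_on_compose2[OF continuous_on_lens[OF r]] continuous_intros) auto
  have fm: "fejer2 N \<in> borel_measurable borel"
    by (intro borel_measurable_continuous_onI continuous_on_fejer2)
  have cm: "(\<lambda>x. cell (- plane_point m + x)) \<in> borel_measurable borel"
    by (intro measurable_compose[OF _ measurable_cell] borel_measurable_continuous_onI continuous_intros)
  have "(\<integral>x. lens r x * fejer2 N x * cell (- plane_point m + x) \<partial>lborel)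
     = (\<integral>x. lens r (plane_point m + x) * fejer2 N (plane_point m + x) * cell (- plane_point m + (plane_point m + x)) \<partial>lborel)"
    by (intro lborel_integral_translate[symmetric] borel_measurable_times measurable_lens r fm cm)
  also have "\<dots> = (\<integral>x. lens r (plane_point m + x) * K x \<partial>lborel)"
    by (simp add: fejer2_periodic K_def mult_ac)
  finally have 1: "(\<integral>x. lens r x * fejer2 N x * cell (- plane_point m + x) \<partial>lborel) = (\<integral>x. lens r (plane_point m + x) * K x \<partial>lborel)" .
  have int: "integrable lborel (\<lambda>x. lens r (plane_point m + x) * K x)"
  proof (rule Bochner_Integration.integrable_bound)
    show "integrable lborel (\<lambda>x. (pi * r\<^sup>2) * K x)" using K by simp
    show "(\<lambda>x. lens r (plane_point m + x) * K x) \<in> borel_measurable lborel" using lm Km by simp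
    show "AE x in lborel. norm (lens r (plane_point m + x) * K x) \<le> norm (pi * r\<^sup>2 * K x)"
      using lens_le[OF r] lens_nonneg[of r] K0 by (intro AE_I2) (simp add: abs_mult mult_right_mono)
  qed
  have "(\<integral>x. lens r (plane_point m + x) * K x \<partial>lborel) - lens r (plane_point m)
     = (\<integral>x. lens r (plane_point m + x) * K x - lens r (plane_point m) * K x \<partial>lborel)"
    using K int by (subst Bochner_Integration.integral_diff) auto
  also have "\<bar>\<dots>\<bar> \<le> (\<integral>x. \<bar>lens r (plane_point m + x) * K x - lens r (plane_point m) * K x\<bar> \<partial>lborel)"
    by (rule integral_abs_bound)
  also have "\<dots> \<le> (\<integral>x. ?C * (?k (fst x) * ?h (snd x) + ?h (fst x) * ?k (snd x)) \<partial>lborel)"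
  proof (rule integral_mono)
    show "integrable lborel (\<lambda>x. \<bar>lens r (plane_point m + x) * K x - lens r (plane_point m) * K x\<bar>)"
      using int K by (intro integrable_abs Bochner_Integration.integrable_diff) auto
    show "integrable lborel (\<lambda>x. ?C * (?k (fst x) * ?h (snd x) + ?h (fst x) * ?k (snd x)))"
      by (intro integrable_mult_right Bochner_Integration.integrable_add integral_plane_prod(1) integrable_half_fejer integrable_half_abs_fejer)
    fix x :: "real \<times> real"
    show "\<bar>lens r (plane_point m + x) * K x - lens r (plane_point m) * K x\<bar> \<le> ?C * (?k (fst x) * ?h (snd x) + ?h (fst x) * ?k (snd x))"
    proof (cases "fst x \<in> half_box \<and> snd x \<in> half_box")
      case True
      have n: "norm x \<le> \<bar>fst x\<bar> + \<bar>snd x\<bar>" using norm_Pair_le[of "fst x" "snd x"] by simp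
      moreover have "\<bar>fst x\<bar> \<le> 1/2" "\<bar>snd x\<bar> \<le> 1/2" using True by (auto simp: half_box_def)
      ultimately have "norm x \<le> 1" by linarith
      hence "\<bar>lens r (plane_point m + x) - lens r (plane_point m)\<bar> \<le> ?C * norm x" by (rule lens_lipschitz[OF r])
      also have "\<dots> \<le> ?C * (\<bar>fst x\<bar> + \<bar>snd x\<bar>)" using n r by (intro mult_left_mono) auto
      finally have "\<bar>lens r (plane_point m + x) - lens r (plane_point m)\<bar> * K x \<le> ?C * (\<bar>fst x\<bar> + \<bar>snd x\<bar>) * K x"
        by (intro mult_right_mono K0)
      also have "\<dots> = ?C * (?k (fst x) * ?h (snd x) + ?h (fst x) * ?k (snd x))"
        using True by (simp add: K_eq algebra_simps)
      finally show ?thesis using K0[of x] by (simp add: left_diff_distrib[symmetric] abs_mult)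
    next
      case False
      have "K x = 0" using False by (auto simp: K_eq)
      thus ?thesis using r False by auto
    qed
  qed
  also have "\<dots> = ?C * ((\<integral>x. ?k (fst x) * ?h (snd x) \<partial>lborel) + (\<integral>x. ?h (fst x) * ?k (snd x) \<partial>lborel))"
    unfolding integral_mult_right_zero
    by (subst Bochner_Integration.integral_add)
       (intro integral_plane_prod(1) integrable_half_fejer integrable_half_abs_fejer refl)+
  also have "\<dots> = 2 * ?C * (\<integral>t. ?k t \<partial>lborel)"
    unfolding integral_plane_prod(2)[OF integrable_half_abs_fejer integrable_half_fejer]
      integral_plane_prod(2)[OF integrable_half_fejer integrable_half_abs_fejer] integral_fejer[OF N] by simp
  finally show ?thesis unfolding 1 .
qed

lemma lens_fejer2_tendsto:
  assumes r: "0 \<le> r"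
  shows "(\<lambda>N. \<integral>x. lens r x * fejer2 N x \<partial>lborel) \<longlonglongrightarrow> (\<Sum>\<^sub>\<infinity>m. lens r (plane_point m))"
proof -
  obtain B :: nat where B: "2 * r + 1 \<le> B" using real_arch_simple by blast
  let ?M = "lattice_box B"
  have out: "lens r (plane_point m) = 0" if "m \<notin> ?M" for m
  proof (rule lens_eq_0)
    have "int B < \<bar>fst m\<bar> \<or> int B < \<bar>snd m\<bar>" using that by (cases m) (auto simp: lattice_box_def)
    hence "real B < \<bar>real_of_int (fst m)\<bar> \<or> real B < \<bar>real_of_int (snd m)\<bar>" by linarith
    moreover have "\<bar>real_of_int (fst m)\<bar> \<le> norm (plane_point m)" "\<bar>real_of_int (snd m)\<bar> \<le> norm (plane_point m)"
      using norm_fst_le[of "real_of_int (fst m)" "real_of_int (snd m)"]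
        norm_snd_le[of "real_of_int (snd m)" "real_of_int (fst m)"] by (auto simp: plane_point_def)
    ultimately show "2 * r < norm (plane_point m)" using B by linarith
  qed
  have S: "(\<Sum>\<^sub>\<infinity>m. lens r (plane_point m)) = (\<Sum>m\<in>?M. lens r (plane_point m))"
  proof -
    have "(\<Sum>\<^sub>\<infinity>m. lens r (plane_point m)) = (\<Sum>\<^sub>\<infinity>m\<in>?M. lens r (plane_point m))"
      by (rule infsum_cong_neutral) (use out in auto)
    thus ?thesis by (simp add: lattice_box_def)
  qed
  define I where "I N m = (\<integral>x. lens r x * fejer2 N x * cell (- plane_point m + x) \<partial>lborel)" for N m
  have int: "integrable lborel (\<lambda>x. lens r x * fejer2 N x * cell (- plane_point m + x))" for N m
  proof (rule Bochner_Integration.integrable_bound)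
    show i: "integrable lborel (\<lambda>x. lens r x * fejer2 N x)"
      using integrable_lens_scaleR[OF r continuous_on_fejer2, of N] by simp
    have "(\<lambda>x. cell (- plane_point m + x)) \<in> borel_measurable borel"
      by (intro measurable_compose[OF _ measurable_cell] borel_measurable_continuous_onI continuous_intros)
    thus "(\<lambda>x. lens r x * fejer2 N x * cell (- plane_point m + x)) \<in> borel_measurable lborel"
      using borel_measurable_integrable[OF i] by simp
    have "cell y \<le> 1" for y by (auto simp: cell_def indicator_def)
    thus "AE x in lborel. norm (lens r x * fejer2 N x * cell (- plane_point m + x)) \<le> norm (lens r x * fejer2 N x)"
      by (intro AE_I2) (simp add: abs_mult mult_left_le cell_nonneg)
  qed
  have "(\<integral>x. lens r x * fejer2 N x \<partial>lborel) = (\<Sum>m\<in>?M. I N m)" for N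
    unfolding I_def by (subst lens_sum_cell[OF r B]) (rule Bochner_Integration.integral_sum, rule int)
  moreover have "(\<lambda>N. I N m) \<longlonglongrightarrow> lens r (plane_point m)" for m
  proof (rule LIM_zero_cancel, rule Lim_null_comparison)
    show "\<forall>\<^sub>F N in sequentially. norm (I N m - lens r (plane_point m))
       \<le> 2 * (pi * (2 * r + 1)) * (\<integral>t. indicat_real half_box t * (\<bar>t\<bar> * fejer N t) \<partial>lborel)"
      using eventually_ge_at_top[of 1]
      by eventually_elim (use lens_fejer2_cell[OF r] in \<open>simp add: I_def\<close>)
    show "(\<lambda>N. 2 * (pi * (2 * r + 1)) * (\<integral>t. indicat_real half_box t * (\<bar>t\<bar> * fejer N t) \<partial>lborel)) \<longlonglongrightarrow> 0"
      using tendsto_mult[OF tendsto_const fejer_moment, of "2 * (pi * (2 * r + 1))"] by simp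
  qed
  hence "(\<lambda>N. \<Sum>m\<in>?M. I N m) \<longlonglongrightarrow> (\<Sum>m\<in>?M. lens r (plane_point m))" by (rule tendsto_sum)
  ultimately show ?thesis unfolding S by simp
qed

text \<open>The Fourier coefficient of the unit disc at frequency 0 is its area.\<close>

lemma bes_0: "bes 0 = pi / 2"
proof -
  have "complex_of_real (2 * 1\<^sup>2 * bes (2 * pi * 1 * norm (plane_point (0, 0)))) = disc_ft 1 (0, 0)"
    by (rule disc_ft_eq[symmetric]) simp
  also have "\<dots> = (\<integral>y. indicat_real (cball (0 :: real \<times> real) 1) y *\<^sub>R 1 \<partial>lborel)"
    by (simp add: disc_ft_def chr_def plane_point_def zero_prod_def[symmetric])
  also have "\<dots> = of_real (\<integral>y. indicat_real (cball (0 :: real \<times> real) 1) y \<partial>lborel)"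
    by (simp add: scaleR_conv_of_real)
  also have "(\<integral>y. indicat_real (cball (0 :: real \<times> real) 1) y \<partial>lborel) = pi"
    using measure_disc[of 1 0] by simp
  finally have "2 * 1\<^sup>2 * bes (2 * pi * 1 * norm (plane_point (0, 0))) = pi" by (simp only: of_real_eq_iff)
  thus ?thesis by (simp add: plane_point_def zero_prod_def[symmetric])
qed

text \<open>
  Testing the periodised overlap against Fejer kernels gives a finite identity. Its two sides converge
  because the overlap is Lipschitz and the Fourier coefficients are nonnegative and summable.
\<close>

theorem lens_poisson:
  assumes r: "0 < r"
  shows "(\<lambda>k. 4 * r ^ 4 * (bes (2 * pi * r * norm (plane_point k)))\<^sup>2) summable_on (UNIV - {(0, 0)})"
    "(\<Sum>\<^sub>\<infinity>m. lens r (plane_point m)) = (pi * r\<^sup>2)\<^sup>2 +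
       (\<Sum>\<^sub>\<infinity>k\<in>UNIV - {(0, 0)}. 4 * r ^ 4 * (bes (2 * pi * r * norm (plane_point k)))\<^sup>2)"
proof -
  define D where "D k = 4 * r ^ 4 * (bes (2 * pi * r * norm (plane_point k)))\<^sup>2" for k
  have D: "(norm (disc_ft r k))\<^sup>2 = D k" for k
    unfolding disc_ft_eq[OF r] norm_of_real power2_abs D_def by (simp add: power_mult_distrib flip: power_mult)
  obtain C where C: "\<And>z. z > 0 \<Longrightarrow> z ^ 3 * (bes z)\<^sup>2 \<le> C" using bes_bound by blast
  \<comment> \<open>The decay of \<open>bes\<close> makes the coefficients \<open>O(|k|^-3)\<close>,
    which is summable over the lattice in two dimensions.\<close>
  have bd: "D k \<le> (4 * r ^ 4 * C / (2 * pi * r) ^ 3) * norm (plane_point k) powi (-3)" if k: "k \<noteq> (0, 0)" for k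
  proof -
    have n: "0 < norm (plane_point k)" using k by (cases k) (auto simp: plane_point_def zero_prod_def)
    have "(2 * pi * r * norm (plane_point k)) ^ 3 * (bes (2 * pi * r * norm (plane_point k)))\<^sup>2 \<le> C"
      using r n by (intro C) auto
    hence "(bes (2 * pi * r * norm (plane_point k)))\<^sup>2 \<le> C / ((2 * pi * r) ^ 3 * norm (plane_point k) ^ 3)"
      using r n by (subst pos_le_divide_eq) (auto simp: power_mult_distrib mult_ac)
    hence "D k \<le> 4 * r ^ 4 * (C / ((2 * pi * r) ^ 3 * norm (plane_point k) ^ 3))"
      unfolding D_def using r by (intro mult_left_mono) auto
    also have "\<dots> = (4 * r ^ 4 * C / (2 * pi * r) ^ 3) * norm (plane_point k) powi (-3)"
      by (simp add: power_int_minus divide_inverse mult_ac)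
    finally show ?thesis .
  qed
  have D0: "0 \<le> D k" for k by (simp add: D_def)
  have s1: "D summable_on (UNIV - {(0, 0)})"
  proof (rule summable_on_comparison_test)
    show "(\<lambda>k. (4 * r ^ 4 * C / (2 * pi * r) ^ 3) * norm (plane_point k) powi (-3)) summable_on (UNIV - {(0, 0)})"
      by (rule summable_on_cmult_right[OF summable_on_norm_cube])
  qed (use bd D0 in blast)+
  thus "(\<lambda>k. 4 * r ^ 4 * (bes (2 * pi * r * norm (plane_point k)))\<^sup>2) summable_on (UNIV - {(0, 0)})"
    by (simp add: D_def[abs_def])
  have s2: "D summable_on UNIV"
    using summable_on_Un_disjoint[OF s1, of "{(0, 0)}"] by (simp add: insert_absorb)
  have "(\<lambda>N. \<Sum>\<^sub>\<infinity>k. cesaro N (fst k) * cesaro N (snd k) * D k) \<longlonglongrightarrow> (\<Sum>\<^sub>\<infinity>k. D k)"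
  proof (rule tannery_infsum[OF s2])
    show "\<forall>\<^sub>F N in sequentially. \<forall>k\<in>UNIV. \<bar>cesaro N (fst k) * cesaro N (snd k) * D k\<bar> \<le> D k"
    proof (intro always_eventually allI ballI)
      fix N k
      have "cesaro N (fst k) * cesaro N (snd k) \<le> 1 * 1"
        by (intro mult_mono cesaro_bounds) auto
      hence "cesaro N (fst k) * cesaro N (snd k) * D k \<le> 1 * D k" by (intro mult_right_mono D0) simp
      thus "\<bar>cesaro N (fst k) * cesaro N (snd k) * D k\<bar> \<le> D k"
        using cesaro_bounds D0 by (simp add: abs_mult)
    qed
    fix k
    show "(\<lambda>N. cesaro N (fst k) * cesaro N (snd k) * D k) \<longlonglongrightarrow> D k"
      using tendsto_mult[OF tendsto_mult[OF cesaro_tendsto cesaro_tendsto] tendsto_const, of "fst k" "snd k" "D k"] by simp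
  qed
  moreover have "\<forall>\<^sub>F N in sequentially. (\<Sum>\<^sub>\<infinity>k. cesaro N (fst k) * cesaro N (snd k) * D k) = (\<integral>x. lens r x * fejer2 N x \<partial>lborel)"
    using eventually_ge_at_top[of 1]
  proof eventually_elim
    case (elim N)
    show ?case using lens_fejer2_fourier[of r N] r sum_sq_cesaro[OF elim, of D] by (simp add: D)
  qed
  ultimately have "(\<lambda>N. \<integral>x. lens r x * fejer2 N x \<partial>lborel) \<longlonglongrightarrow> (\<Sum>\<^sub>\<infinity>k. D k)"
    by (simp add: tendsto_cong)
  hence "(\<Sum>\<^sub>\<infinity>m. lens r (plane_point m)) = (\<Sum>\<^sub>\<infinity>k. D k)"
    using lens_fejer2_tendsto[of r] r LIMSEQ_unique by fastforce
  also have "\<dots> = D (0, 0) + (\<Sum>\<^sub>\<infinity>k\<in>UNIV - {(0, 0)}. D k)"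
    using infsum_diff_finite[OF s2, of "{(0, 0)}"] by simp
  also have "D (0, 0) = (pi * r\<^sup>2)\<^sup>2"
    by (simp add: D_def plane_point_def zero_prod_def[symmetric] bes_0 power_mult_distrib power_divide)
  finally show "(\<Sum>\<^sub>\<infinity>m. lens r (plane_point m)) = (pi * r\<^sup>2)\<^sup>2 +
       (\<Sum>\<^sub>\<infinity>k\<in>UNIV - {(0, 0)}. 4 * r ^ 4 * (bes (2 * pi * r * norm (plane_point k)))\<^sup>2)"
    by (simp add: D_def)
qed

subsection \<open>Lattice means\<close>

definition dvd_point :: "nat \<Rightarrow> int \<times> int \<Rightarrow> bool" where
  "dvd_point d n \<longleftrightarrow> int d dvd fst n \<and> int d dvd snd n"

definition disk :: "real \<Rightarrow> (int \<times> int) set" where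
  "disk R = {n. norm (plane_point n) \<le> R}"

lemma plane_point_diff: "plane_point (m - n) = plane_point m - plane_point n"
  by (simp add: plane_point_def)

lemma abs_coord_le_norm:
  "\<bar>real_of_int (fst n)\<bar> \<le> norm (plane_point n)" "\<bar>real_of_int (snd n)\<bar> \<le> norm (plane_point n)"
  using norm_fst_le[of "real_of_int (fst n)" "real_of_int (snd n)"]
    norm_snd_le[of "real_of_int (snd n)" "real_of_int (fst n)"] by (auto simp: plane_point_def)

lemma finite_disk [simp]: "finite (disk R)"
proof (rule finite_subset)
  show "disk R \<subseteq> {- \<lfloor>R\<rfloor>..\<lfloor>R\<rfloor>} \<times> {- \<lfloor>R\<rfloor>..\<lfloor>R\<rfloor>}"
  proof
    fix n assume "n \<in> disk R"
    hence "\<bar>real_of_int (fst n)\<bar> \<le> R" "\<bar>real_of_int (snd n)\<bar> \<le> R"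
      using abs_coord_le_norm[of n] by (auto simp: disk_def)
    thus "n \<in> {- \<lfloor>R\<rfloor>..\<lfloor>R\<rfloor>} \<times> {- \<lfloor>R\<rfloor>..\<lfloor>R\<rfloor>}"
      by (cases n) (auto simp: le_floor_iff abs_le_iff minus_le_iff)
  qed
qed simp

lemma disk_mono: "R \<le> R' \<Longrightarrow> disk R \<subseteq> disk R'" by (auto simp: disk_def)

text \<open>Squares attached to their lower left corners; the corners in one coset of the lattice of
  multiples of \<open>d\<close> give a tiling of the plane, so counting lattice points becomes
  measuring area.\<close>

definition tile :: "nat \<Rightarrow> int \<times> int \<Rightarrow> (real \<times> real) set" where
  "tile d n = {real_of_int (fst n)..<real_of_int (fst n) + d} \<times> {real_of_int (snd n)..<real_of_int (snd n) + d}"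

lemma tile_sets: "tile d n \<in> sets lborel"
  unfolding tile_def by (simp add: borel_prod[symmetric])

lemma emeasure_tile: "emeasure lborel (tile d n) = ennreal ((real d)\<^sup>2)"
proof -
  have "emeasure lborel (tile d n) = emeasure (lborel \<Otimes>\<^sub>M lborel) (tile d n)" by (simp add: lborel_prod)
  also have "\<dots> = ennreal (real d) * ennreal (real d)"
    unfolding tile_def by (subst lborel.emeasure_pair_measure_Times) auto
  finally show ?thesis by (simp add: power2_eq_square ennreal_mult)
qed

lemma measure_tile: "measure lborel (tile d n) = (real d)\<^sup>2"
  by (simp add: measure_def emeasure_tile)

lemma tile_dist: "x \<in> tile d n \<Longrightarrow> norm (x - plane_point n) \<le> 2 * d"
proof -
  assume x: "x \<in> tile d n"
  have "norm (x - plane_point n) \<le> \<bar>fst x - fst n\<bar> + \<bar>snd x - snd n\<bar>"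
    using norm_Pair_le[of "fst x - fst n" "snd x - snd n"] by (simp add: plane_point_def minus_prod_def)
  also have "\<dots> \<le> 2 * d" using x by (auto simp: tile_def)
  finally show ?thesis .
qed

lemma tile_coord_eq:
  fixes a b :: int
  assumes "int d dvd a - b" "real_of_int a \<le> t" "t < real_of_int a + d" "real_of_int b \<le> t" "t < real_of_int b + d"
  shows "a = b"
proof -
  have "\<bar>a - b\<bar> < int d" using assms(2-) by linarith
  thus ?thesis using assms(1) zdvd_not_zless[of "\<bar>a - b\<bar>" "int d"] by (cases "a = b") auto
qed

lemma tile_disjoint:
  "disjoint_family_on (tile d) {n. dvd_point d (n - c)}"
  unfolding disjoint_family_on_def
proof (intro ballI impI)
  fix m n assume mn: "m \<in> {n. dvd_point d (n - c)}" "n \<in> {n. dvd_point d (n - c)}" "m \<noteq> n"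
  have "int d dvd fst m - fst n" "int d dvd snd m - snd n"
    using mn dvd_diff[of "int d" "fst m - fst c" "fst n - fst c"] dvd_diff[of "int d" "snd m - snd c" "snd n - snd c"]
    by (auto simp: dvd_point_def)
  thus "tile d m \<inter> tile d n = {}"
    using mn(3) tile_coord_eq[of d "fst m" "fst n"] tile_coord_eq[of d "snd m" "snd n"]
    by (force simp: tile_def prod_eq_iff)
qed

lemma measure_tiles:
  "measure lborel (\<Union>n\<in>{n\<in>disk R. dvd_point d (n - c)}. tile d n) = (real d)\<^sup>2 * card {n\<in>disk R. dvd_point d (n - c)}"
proof -
  have "measure lborel (\<Union>n\<in>{n\<in>disk R. dvd_point d (n - c)}. tile d n) = (\<Sum>n\<in>{n\<in>disk R. dvd_point d (n - c)}. measure lborel (tile d n))"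
  proof (rule measure_finite_Union)
    show "disjoint_family_on (tile d) {n \<in> disk R. dvd_point d (n - c)}"
      by (rule disjoint_family_on_mono[OF _ tile_disjoint[of d c]]) auto
  qed (auto simp: emeasure_tile tile_sets image_subset_iff simp del: sets_lborel)
  thus ?thesis by (simp add: measure_tile)
qed

lemma tiles_sets: "(\<Union>n\<in>{n\<in>disk R. dvd_point d (n - c)}. tile d n) \<in> sets lborel"
  using tile_sets by (intro sets.finite_UN) auto

text \<open>The tiles are disjoint and each stays within \<open>2 * d\<close> of its corner, so they
  all fit into a slightly larger disc. The lower bound \<open>card_coset_ge\<close> uses that they
  cover a slightly smaller one.\<close>

lemma card_coset_le:
  assumes R: "0 \<le> R"
  shows "(real d)\<^sup>2 * card {n\<in>disk R. dvd_point d (n - c)} \<le> pi * (R + 2 * d)\<^sup>2"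
proof -
  have "(\<Union>n\<in>{n\<in>disk R. dvd_point d (n - c)}. tile d n) \<subseteq> cball 0 (R + 2 * d)"
  proof
    fix x assume "x \<in> (\<Union>n\<in>{n\<in>disk R. dvd_point d (n - c)}. tile d n)"
    then obtain n where n: "n \<in> disk R" "x \<in> tile d n" by auto
    have "norm x \<le> norm (x - plane_point n) + norm (plane_point n)" by (metis add.commute norm_triangle_sub)
    thus "x \<in> cball 0 (R + 2 * d)" using tile_dist[OF n(2)] n(1) by (auto simp: disk_def)
  qed
  hence "measure lborel (\<Union>n\<in>{n\<in>disk R. dvd_point d (n - c)}. tile d n) \<le> measure lborel (cball (0::real \<times> real) (R + 2 * d))"
    by (intro measure_mono_fmeasurable tiles_sets fmeasurable_cball)
  thus ?thesis using R by (simp add: measure_tiles measure_disc)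
qed

lemma card_coset_ge:
  assumes d: "1 \<le> d" and R: "2 * real d \<le> R"
  shows "pi * (R - 2 * d)\<^sup>2 \<le> (real d)\<^sup>2 * card {n\<in>disk R. dvd_point d (n - c)}"
proof -
  have sub: "cball 0 (R - 2 * d) \<subseteq> (\<Union>n\<in>{n\<in>disk R. dvd_point d (n - c)}. tile d n)"
  proof
    fix x :: "real \<times> real" assume x: "x \<in> cball 0 (R - 2 * d)"
    \<comment> \<open>The largest number congruent to \<open>c\<close> modulo \<open>d\<close> that
      does not exceed \<open>t\<close>: the corner of the tile containing \<open>t\<close>.\<close>
    define f where "f c t = c + int d * \<lfloor>(t - real_of_int c) / d\<rfloor>" for c :: int and t :: real
    have f: "real_of_int (f c t) \<le> t" "t < real_of_int (f c t) + d" for c t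
    proof -
      define u where "u = (t - real_of_int c) / d"
      have t: "t = c + d * u" using d by (simp add: u_def)
      have 1: "real_of_int \<lfloor>u\<rfloor> \<le> u" "u < real_of_int \<lfloor>u\<rfloor> + 1" by linarith+
      have "real d * real_of_int \<lfloor>u\<rfloor> \<le> real d * u" "real d * u < real d * (real_of_int \<lfloor>u\<rfloor> + 1)"
        using 1 d by (intro mult_left_mono mult_strict_left_mono; simp)+
      thus "real_of_int (f c t) \<le> t" "t < real_of_int (f c t) + d"
        unfolding f_def u_def[symmetric] using t by (simp_all add: algebra_simps)
    qed
    define n where "n = (f (fst c) (fst x), f (snd c) (snd x))"
    have n: "dvd_point d (n - c)" by (simp add: dvd_point_def n_def f_def)
    have xt: "x \<in> tile d n" using f by (cases x) (auto simp: tile_def n_def)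
    have "norm (plane_point n) \<le> norm (x - plane_point n) + norm x"
      by (metis add.commute norm_minus_commute norm_triangle_sub)
    hence "n \<in> disk R" using tile_dist[OF xt] x by (auto simp: disk_def)
    thus "x \<in> (\<Union>n\<in>{n\<in>disk R. dvd_point d (n - c)}. tile d n)" using n xt by blast
  qed
  have "measure lborel (cball (0::real \<times> real) (R - 2 * d)) \<le> measure lborel (\<Union>n\<in>{n\<in>disk R. dvd_point d (n - c)}. tile d n)"
  proof (rule measure_mono_fmeasurable[OF sub])
    show "(\<Union>n\<in>{n\<in>disk R. dvd_point d (n - c)}. tile d n) \<in> fmeasurable lborel"
    proof (rule fmeasurableI2[OF fmeasurable_cball _ tiles_sets])
      show "(\<Union>n\<in>{n\<in>disk R. dvd_point d (n - c)}. tile d n) \<subseteq> cball 0 (R + 2 * d)"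
      proof
        fix x assume "x \<in> (\<Union>n\<in>{n\<in>disk R. dvd_point d (n - c)}. tile d n)"
        then obtain n where n: "n \<in> disk R" "x \<in> tile d n" by auto
        have "norm x \<le> norm (x - plane_point n) + norm (plane_point n)" by (metis add.commute norm_triangle_sub)
        thus "x \<in> cball 0 (R + 2 * d)" using tile_dist[OF n(2)] n(1) by (auto simp: disk_def)
      qed
    qed
  qed auto
  thus ?thesis using R by (simp add: measure_tiles measure_disc)
qed

section \<open>Densities of weights on the lattice and sieving by finitely many primes\<close>

definition lat_sum :: "(int \<times> int \<Rightarrow> real) \<Rightarrow> real \<Rightarrow> real" where
  "lat_sum a R = (\<Sum>n\<in>disk R. a n)"

text \<open>Normalised by area and not by the number of lattice points, to match
  \<open>plane_mean\<close>.\<close>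

definition lat_mean :: "(int \<times> int \<Rightarrow> real) \<Rightarrow> real \<Rightarrow> bool" where
  "lat_mean a \<alpha> \<longleftrightarrow> ((\<lambda>R. lat_sum a R / (pi * R\<^sup>2)) \<longlongrightarrow> \<alpha>) at_top"

lemma lat_mean_add: "lat_mean a \<alpha> \<Longrightarrow> lat_mean b \<beta> \<Longrightarrow> lat_mean (\<lambda>n. a n + b n) (\<alpha> + \<beta>)"
  unfolding lat_mean_def lat_sum_def sum.distrib add_divide_distrib by (rule tendsto_add)

lemma lat_mean_diff: "lat_mean a \<alpha> \<Longrightarrow> lat_mean b \<beta> \<Longrightarrow> lat_mean (\<lambda>n. a n - b n) (\<alpha> - \<beta>)"
  unfolding lat_mean_def lat_sum_def sum_subtractf diff_divide_distrib by (rule tendsto_diff)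

lemma lat_mean_cmult: "lat_mean a \<alpha> \<Longrightarrow> lat_mean (\<lambda>n. c * a n) (c * \<alpha>)"
  unfolding lat_mean_def lat_sum_def sum_distrib_left[symmetric] times_divide_eq_right[symmetric]
  by (rule tendsto_mult_left)

lemma tendsto_shifted_square: "((\<lambda>R. ((R + c) / R)\<^sup>2) \<longlongrightarrow> 1) at_top" for c :: real
proof -
  have "((\<lambda>R. (1 + c * inverse R)\<^sup>2) \<longlongrightarrow> (1 + c * 0)\<^sup>2) at_top"
    by (intro tendsto_intros tendsto_inverse_0_at_top filterlim_ident)
  moreover have "\<forall>\<^sub>F R in at_top. (1 + c * inverse R)\<^sup>2 = ((R + c) / R)\<^sup>2"
    using eventually_gt_at_top[of 0] by eventually_elim (simp add: field_simps)
  ultimately show ?thesis by (simp add: tendsto_cong)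
qed

lemma lat_mean_coset:
  assumes d: "1 \<le> d"
  shows "lat_mean (\<lambda>n. of_bool (dvd_point d (n - c))) (1 / (real d)\<^sup>2)"
proof -
  have S: "lat_sum (\<lambda>n. of_bool (dvd_point d (n - c))) R = card {n\<in>disk R. dvd_point d (n - c)}" for R
    by (simp add: lat_sum_def Int_def)
  have "((\<lambda>R::real. ((R + (- 2 * real d)) / R)\<^sup>2 * (1 / (real d)\<^sup>2)) \<longlongrightarrow> 1 * (1 / (real d)\<^sup>2)) at_top"
    "((\<lambda>R::real. ((R + 2 * real d) / R)\<^sup>2 * (1 / (real d)\<^sup>2)) \<longlongrightarrow> 1 * (1 / (real d)\<^sup>2)) at_top"
    by (intro tendsto_mult tendsto_const tendsto_shifted_square)+
  moreover have "\<forall>\<^sub>F R in at_top. ((R + (- 2 * real d)) / R)\<^sup>2 * (1 / (real d)\<^sup>2) \<le> card {n\<in>disk R. dvd_point d (n - c)} / (pi * R\<^sup>2)"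
    using eventually_ge_at_top[of "2 * real d"]
  proof eventually_elim
    case (elim R)
    have dR: "0 < (real d)\<^sup>2" "0 < pi * R\<^sup>2" using d elim by auto
    have "pi * (R - 2 * real d)\<^sup>2 / ((real d)\<^sup>2 * (pi * R\<^sup>2)) \<le> ((real d)\<^sup>2 * card {n\<in>disk R. dvd_point d (n - c)}) / ((real d)\<^sup>2 * (pi * R\<^sup>2))"
      using card_coset_ge[OF d elim, of c] dR by (intro divide_right_mono) auto
    thus ?case using dR by (simp add: power_divide mult.commute)
  qed
  moreover have "\<forall>\<^sub>F R in at_top. card {n\<in>disk R. dvd_point d (n - c)} / (pi * R\<^sup>2) \<le> ((R + 2 * real d) / R)\<^sup>2 * (1 / (real d)\<^sup>2)"
    using eventually_gt_at_top[of 0]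
  proof eventually_elim
    case (elim R)
    have dR: "0 < (real d)\<^sup>2" "0 < pi * R\<^sup>2" using d elim by auto
    have "((real d)\<^sup>2 * card {n\<in>disk R. dvd_point d (n - c)}) / ((real d)\<^sup>2 * (pi * R\<^sup>2)) \<le> pi * (R + 2 * real d)\<^sup>2 / ((real d)\<^sup>2 * (pi * R\<^sup>2))"
      using card_coset_le[of R d c] dR elim by (intro divide_right_mono) auto
    thus ?case using dR by (simp add: power_divide mult.commute)
  qed
  ultimately have "((\<lambda>R. card {n\<in>disk R. dvd_point d (n - c)} / (pi * R\<^sup>2)) \<longlongrightarrow> 1 * (1 / (real d)\<^sup>2)) at_top"
    by (rule tendsto_sandwich[rotated 2])
  thus ?thesis unfolding lat_mean_def S by simp
qed

text \<open>For \<open>d \<le> R\<close> the radius \<open>R + 2 * d\<close> is at most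
  \<open>3 * R\<close>, whence the 9; for larger \<open>d\<close> the only multiple in the disc is
  the origin, which is excluded. The bound is therefore free of an additive error and can be summed
  over \<open>d\<close>.\<close>

lemma card_multiples_le:
  assumes d: "1 \<le> d" and R: "0 \<le> R"
  shows "card {n\<in>disk R. n \<noteq> 0 \<and> dvd_point d n} \<le> 9 * pi * R\<^sup>2 / (real d)\<^sup>2"
proof (cases "real d \<le> R")
  case True
  have "card {n\<in>disk R. n \<noteq> 0 \<and> dvd_point d n} \<le> card {n\<in>disk R. dvd_point d (n - 0)}"
    by (intro card_mono) auto
  hence "real (card {n\<in>disk R. n \<noteq> 0 \<and> dvd_point d n}) \<le> real (card {n\<in>disk R. dvd_point d (n - 0)})" by simp
  hence "(real d)\<^sup>2 * card {n\<in>disk R. n \<noteq> 0 \<and> dvd_point d n} \<le> pi * (R + 2 * d)\<^sup>2"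
    using card_coset_le[OF R, of d 0] mult_left_mono[of _ _ "(real d)\<^sup>2"] by (meson order.trans zero_le_power2)
  also have "\<dots> \<le> pi * (3 * R)\<^sup>2" using True by (intro mult_left_mono power_mono) auto
  finally show ?thesis using d by (simp add: field_simps)
next
  case False
  have "{n\<in>disk R. n \<noteq> 0 \<and> dvd_point d n} = {}"
  proof -
    have "n = 0" if "n \<in> disk R" "dvd_point d n" for n
    proof -
      have "\<bar>real_of_int (fst n)\<bar> < real d" "\<bar>real_of_int (snd n)\<bar> < real d"
        using that abs_coord_le_norm[of n] False by (auto simp: disk_def)
      hence "\<bar>fst n\<bar> < int d" "\<bar>snd n\<bar> < int d" by linarith+
      thus ?thesis using that(2) dvd_imp_le_int[of "fst n" "int d"] dvd_imp_le_int[of "snd n" "int d"]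
        by (auto simp: dvd_point_def prod_eq_iff)
    qed
    thus ?thesis by blast
  qed
  thus ?thesis by (simp only: card.empty) (simp add: R)
qed

lemma sum_inverse_squares_le:
  assumes "1 \<le> P" shows "(\<Sum>q\<in>{P<..N}. 1 / (real q)\<^sup>2) \<le> 1 / P"
proof -
  have "(\<Sum>q\<in>{P<..N}. 1 / (real q)\<^sup>2) \<le> 1 / P - 1 / N" if "P \<le> N" for N
    using that
  proof (induction N rule: dec_induct)
    case (step N)
    have "{P<..Suc N} = insert (Suc N) {P<..N}" using step by auto
    hence "(\<Sum>q\<in>{P<..Suc N}. 1 / (real q)\<^sup>2) = 1 / (real (Suc N))\<^sup>2 + (\<Sum>q\<in>{P<..N}. 1 / (real q)\<^sup>2)" by simp
    also have "1 / (real (Suc N))\<^sup>2 \<le> 1 / N - 1 / Suc N"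
    proof -
      have N: "0 < real N" using step assms by simp
      have "1 / (real (Suc N))\<^sup>2 \<le> 1 / (real N * real (Suc N))"
        using N by (intro divide_left_mono) (auto simp: power2_eq_square)
      also have "\<dots> = 1 / N - 1 / Suc N" using N by (simp add: field_simps)
      finally show ?thesis .
    qed
    finally show ?case using step by simp
  qed simp
  from this[of N] show ?thesis by (cases "P \<le> N") (auto intro: order.trans[of _ "1 / P - 1 / N"])
qed

text \<open>A union bound over all moduli above \<open>P\<close>. The proportion
  \<open>O(1 / P)\<close> holds for every radius, so the sieve can be truncated before the radius
  grows.\<close>

lemma card_large_multiples_le:
  fixes P :: nat
  assumes P: "1 \<le> P" and R: "0 \<le> R"
  shows "card {n\<in>disk R. n \<noteq> 0 \<and> (\<exists>q>P. dvd_point q n)} \<le> 9 * pi * R\<^sup>2 / P"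
proof -
  obtain N :: nat where N: "R \<le> N" using real_arch_simple by blast
  have "{n\<in>disk R. n \<noteq> 0 \<and> (\<exists>q>P. dvd_point q n)} \<subseteq> (\<Union>q\<in>{P<..N}. {n\<in>disk R. n \<noteq> 0 \<and> dvd_point q n})"
  proof
    fix n assume n: "n \<in> {n\<in>disk R. n \<noteq> 0 \<and> (\<exists>q>P. dvd_point q n)}"
    then obtain q where q: "q > P" "dvd_point q n" by auto
    have "q \<le> N"
    proof (rule ccontr)
      assume "\<not> q \<le> N"
      hence "\<bar>real_of_int (fst n)\<bar> < real q" "\<bar>real_of_int (snd n)\<bar> < real q"
        using n abs_coord_le_norm[of n] N by (auto simp: disk_def)
      hence "\<bar>fst n\<bar> < int q" "\<bar>snd n\<bar> < int q" by linarith+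
      hence "n = 0" using q(2) dvd_imp_le_int[of "fst n" "int q"] dvd_imp_le_int[of "snd n" "int q"]
        by (auto simp: dvd_point_def prod_eq_iff)
      thus False using n by simp
    qed
    thus "n \<in> (\<Union>q\<in>{P<..N}. {n\<in>disk R. n \<noteq> 0 \<and> dvd_point q n})" using q n by auto
  qed
  hence "card {n\<in>disk R. n \<noteq> 0 \<and> (\<exists>q>P. dvd_point q n)} \<le> card (\<Union>q\<in>{P<..N}. {n\<in>disk R. n \<noteq> 0 \<and> dvd_point q n})"
    by (intro card_mono) auto
  also have "\<dots> \<le> (\<Sum>q\<in>{P<..N}. card {n\<in>disk R. n \<noteq> 0 \<and> dvd_point q n})" by (rule card_UN_le) simp
  finally have "real (card {n\<in>disk R. n \<noteq> 0 \<and> (\<exists>q>P. dvd_point q n)}) \<le> (\<Sum>q\<in>{P<..N}. real (card {n\<in>disk R. n \<noteq> 0 \<and> dvd_point q n}))"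
    by (simp only: of_nat_le_iff of_nat_sum[symmetric])
  also have "\<dots> \<le> (\<Sum>q\<in>{P<..N}. 9 * pi * R\<^sup>2 * (1 / (real q)\<^sup>2))"
    using card_multiples_le[OF _ R] by (intro sum_mono) auto
  also have "\<dots> = 9 * pi * R\<^sup>2 * (\<Sum>q\<in>{P<..N}. 1 / (real q)\<^sup>2)" by (simp add: sum_distrib_left)
  also have "\<dots> \<le> 9 * pi * R\<^sup>2 * (1 / P)" by (intro mult_left_mono sum_inverse_squares_le P) simp
  finally show ?thesis by simp
qed

text \<open>Each factor is the proportion of classes of \<open>n\<close> modulo \<open>p\<close> in
  which neither \<open>n\<close> nor \<open>n - m\<close> is divisible by \<open>p\<close>: two
  classes are removed, and they coincide when \<open>p\<close> divides \<open>m\<close>.\<close>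

definition pair_density :: "nat set \<Rightarrow> int \<times> int \<Rightarrow> real" where
  "pair_density S m = (\<Prod>p\<in>S. 1 - 2 / (real p)\<^sup>2 + of_bool (dvd_point p m) / (real p)\<^sup>2)"

text \<open>The Chinese remainder theorem in each coordinate. Intersections of cosets are again
  cosets, which keeps the sieve induction closed.\<close>

lemma crt_pair:
  assumes "coprime d p"
  shows "\<exists>c''. \<forall>n. dvd_point d (n - c) \<and> dvd_point p (n - c') \<longleftrightarrow> dvd_point (d * p) (n - c'')"
proof -
  have cop: "coprime (int d) (int p)" using assms by simp
  obtain u v where uv: "u * int d + v * int p = 1"
    using bezout_int[of "int d" "int p"] cop by auto
  have one: "\<exists>e. \<forall>t. int d dvd (t - a) \<and> int p dvd (t - b) \<longleftrightarrow> int (d * p) dvd (t - e)" for a b :: int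
  proof -
    define e where "e = a + u * int d * (b - a)"
    have ea: "int d dvd e - a" by (simp add: e_def)
    have "e - b = (b - a) * (u * int d - 1)" by (simp add: e_def algebra_simps)
    also have "u * int d - 1 = - (v * int p)" using uv by linarith
    finally have eb: "int p dvd e - b" by simp
    have "int d dvd (t - a) \<and> int p dvd (t - b) \<longleftrightarrow> int (d * p) dvd (t - e)" for t
    proof -
      have "int d dvd (t - a) \<longleftrightarrow> int d dvd (t - e)"
        using ea dvd_add_right_iff[of "int d" "e - a" "t - e"] by (simp add: algebra_simps)
      moreover have "int p dvd (t - b) \<longleftrightarrow> int p dvd (t - e)"
        using eb dvd_add_right_iff[of "int p" "e - b" "t - e"] by (simp add: algebra_simps)
      moreover have "int d dvd (t - e) \<and> int p dvd (t - e) \<longleftrightarrow> int (d * p) dvd (t - e)"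
        using cop by (auto simp: divides_mult intro: dvd_mult_left dvd_mult_right)
      ultimately show ?thesis by blast
    qed
    thus ?thesis by blast
  qed
  obtain e1 where e1: "\<And>t. int d dvd (t - fst c) \<and> int p dvd (t - fst c') \<longleftrightarrow> int (d * p) dvd (t - e1)"
    using one by blast
  obtain e2 where e2: "\<And>t. int d dvd (t - snd c) \<and> int p dvd (t - snd c') \<longleftrightarrow> int (d * p) dvd (t - e2)"
    using one by blast
  show ?thesis
  proof (rule exI[of _ "(e1, e2)"], intro allI)
    fix n
    show "dvd_point d (n - c) \<and> dvd_point p (n - c') \<longleftrightarrow> dvd_point (d * p) (n - (e1, e2))"
      unfolding dvd_point_def fst_diff snd_diff fst_conv snd_conv e1[symmetric] e2[symmetric] by blast
  qed
qed

text \<open>The coset condition modulo \<open>d\<close> generalises the claim for the induction. A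
  new prime enters by inclusion and exclusion as
  \<open>1 - [p | n] - [p | n - m] + [p | m][p | n]\<close>, and \<open>crt_pair\<close> absorbs
  each bracket depending on \<open>n\<close> into the modulus \<open>d * p\<close>.\<close>

lemma lat_mean_pair_sieve:
  assumes S: "finite S" "\<And>p. p \<in> S \<Longrightarrow> prime p" and d: "1 \<le> d" "\<And>p. p \<in> S \<Longrightarrow> coprime d p"
  shows "lat_mean (\<lambda>n. of_bool (dvd_point d (n - c)) * (\<Prod>p\<in>S. of_bool (\<not> dvd_point p n \<and> \<not> dvd_point p (n - m))))
    (pair_density S m / (real d)\<^sup>2)"
  using S d
proof (induction S arbitrary: d c rule: finite_induct)
  case empty
  thus ?case using lat_mean_coset[of d c] by (simp add: pair_density_def)
next
  case (insert p S)
  define b where "b n = (\<Prod>p\<in>S. of_bool (\<not> dvd_point p n \<and> \<not> dvd_point p (n - m)) :: real)" for n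
  have p: "prime p" "coprime d p" using insert by auto
  have IH: "lat_mean (\<lambda>n. of_bool (dvd_point e (n - c)) * b n) (pair_density S m / (real e)\<^sup>2)"
    if "1 \<le> e" "\<And>q. q \<in> S \<Longrightarrow> coprime e q" for e c
    using insert.IH[of e c] insert.prems that by (simp add: b_def)
  have cop: "coprime (d * p) q" if "q \<in> S" for q
    using insert.prems insert.hyps that by (auto intro!: primes_coprime)
  have dp: "1 \<le> d * p" using insert.prems(2) prime_gt_0_nat[OF p(1)] by simp
  obtain c1 where c1: "\<And>n. dvd_point d (n - c) \<and> dvd_point p (n - 0) \<longleftrightarrow> dvd_point (d * p) (n - c1)"
    using crt_pair[OF p(2)] by blast
  obtain c2 where c2: "\<And>n. dvd_point d (n - c) \<and> dvd_point p (n - m) \<longleftrightarrow> dvd_point (d * p) (n - c2)"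
    using crt_pair[OF p(2)] by blast
  have both: "dvd_point p n \<and> dvd_point p (n - m) \<longleftrightarrow> dvd_point p m \<and> dvd_point p n" for n
    using dvd_diff[of "int p" "fst n" "fst n - fst m"] dvd_diff[of "int p" "snd n" "snd n - snd m"]
    by (auto simp: dvd_point_def)
  have 1: "lat_mean (\<lambda>n. of_bool (dvd_point d (n - c)) * b n) (pair_density S m / (real d)\<^sup>2)"
    using insert.prems by (intro IH) auto
  have 2: "lat_mean (\<lambda>n. of_bool (dvd_point (d * p) (n - c')) * b n) (pair_density S m / (real (d * p))\<^sup>2)" for c'
    by (intro IH dp cop)
  have "lat_mean (\<lambda>n. of_bool (dvd_point d (n - c)) * b n - of_bool (dvd_point (d * p) (n - c1)) * b n
      - of_bool (dvd_point (d * p) (n - c2)) * b n + of_bool (dvd_point p m) * (of_bool (dvd_point (d * p) (n - c1)) * b n))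
    (pair_density S m / (real d)\<^sup>2 - pair_density S m / (real (d * p))\<^sup>2 - pair_density S m / (real (d * p))\<^sup>2
      + of_bool (dvd_point p m) * (pair_density S m / (real (d * p))\<^sup>2))"
    by (intro lat_mean_add lat_mean_diff lat_mean_cmult 1 2)
  moreover have "of_bool (dvd_point d (n - c)) * b n - of_bool (dvd_point (d * p) (n - c1)) * b n
      - of_bool (dvd_point (d * p) (n - c2)) * b n + of_bool (dvd_point p m) * (of_bool (dvd_point (d * p) (n - c1)) * b n)
    = of_bool (dvd_point d (n - c)) * (\<Prod>p\<in>insert p S. of_bool (\<not> dvd_point p n \<and> \<not> dvd_point p (n - m)))" for n
  proof -
    have "(\<Prod>p\<in>insert p S. of_bool (\<not> dvd_point p n \<and> \<not> dvd_point p (n - m))) = of_bool (\<not> dvd_point p n \<and> \<not> dvd_point p (n - m)) * b n"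
      using insert.hyps by (simp add: b_def)
    moreover have "dvd_point (d * p) (n - c1) \<longleftrightarrow> dvd_point d (n - c) \<and> dvd_point p n" using c1[of n] by simp
    moreover note c2[of n, symmetric] both[of n]
    ultimately show ?thesis by (auto simp del: prod.insert)
  qed
  moreover have "pair_density S m / (real d)\<^sup>2 - pair_density S m / (real (d * p))\<^sup>2 - pair_density S m / (real (d * p))\<^sup>2
      + of_bool (dvd_point p m) * (pair_density S m / (real (d * p))\<^sup>2) = pair_density (insert p S) m / (real d)\<^sup>2"
  proof -
    define Q x y where "Q = pair_density S m" and "x = (real p)\<^sup>2" and "y = (real d)\<^sup>2"
    have nz: "x \<noteq> 0" "y \<noteq> 0" using insert.prems(2) prime_gt_0_nat[OF p(1)] by (auto simp: x_def y_def)
    have pd: "pair_density (insert p S) m = (1 - 2 / x + of_bool (dvd_point p m) / x) * Q"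
      using insert.hyps by (simp add: pair_density_def Q_def x_def)
    have dp2: "(real (d * p))\<^sup>2 = y * x" by (simp add: x_def y_def power_mult_distrib)
    show ?thesis unfolding pd dp2 Q_def[symmetric] y_def[symmetric] using nz
      by (simp add: field_simps)
  qed
  ultimately show ?case by simp
qed

subsection \<open>Pair density of visible points\<close>

lemma lat_mean_approx:
  assumes "\<And>e. 0 < e \<Longrightarrow> \<exists>b \<beta>. lat_mean b \<beta> \<and> \<bar>\<beta> - \<alpha>\<bar> \<le> e \<and>
    (\<forall>\<^sub>F R in at_top. \<bar>lat_sum a R - lat_sum b R\<bar> \<le> e * (pi * R\<^sup>2))"
  shows "lat_mean a \<alpha>"
  unfolding lat_mean_def
proof (rule tendstoI)
  fix e :: real assume e: "0 < e"
  obtain b \<beta> where b: "lat_mean b \<beta>" "\<bar>\<beta> - \<alpha>\<bar> \<le> e / 4"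
    "\<forall>\<^sub>F R in at_top. \<bar>lat_sum a R - lat_sum b R\<bar> \<le> e / 4 * (pi * R\<^sup>2)"
    using assms[of "e / 4"] e by auto
  have "\<forall>\<^sub>F R in at_top. dist (lat_sum b R / (pi * R\<^sup>2)) \<beta> < e / 4"
    using b(1) e unfolding lat_mean_def by (intro tendstoD) auto
  with b(3) eventually_gt_at_top[of 0] show "\<forall>\<^sub>F R in at_top. dist (lat_sum a R / (pi * R\<^sup>2)) \<alpha> < e"
  proof eventually_elim
    case (elim R)
    have pos: "0 < pi * R\<^sup>2" using elim by simp
    have "\<bar>lat_sum a R / (pi * R\<^sup>2) - lat_sum b R / (pi * R\<^sup>2)\<bar> = \<bar>lat_sum a R - lat_sum b R\<bar> / (pi * R\<^sup>2)"
      using pos by (simp add: diff_divide_distrib[symmetric] abs_divide)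
    also have "\<dots> \<le> e / 4" using elim(1) pos by (subst pos_divide_le_eq) auto
    finally show ?case using elim(3) b(2) e unfolding dist_real_def by linarith
  qed
qed

definition primes_upto :: "nat \<Rightarrow> nat set" where
  "primes_upto P = {p. prime p \<and> p \<le> P}"

lemma finite_primes_upto [simp]: "finite (primes_upto P)"
  by (rule finite_subset[of _ "{..P}"]) (auto simp: primes_upto_def)

lemma prime_inverse_square_le: "prime p \<Longrightarrow> 1 / (real p)\<^sup>2 \<le> 1 / 4"
proof -
  assume "prime p"
  hence p: "2 \<le> real p" using prime_ge_2_nat by force
  hence "2\<^sup>2 \<le> (real p)\<^sup>2" by (intro power_mono) auto
  thus ?thesis using p by (intro divide_left_mono) auto
qed

lemma pair_density_factor:
  assumes "prime p"
  shows "0 \<le> 1 - 2 / (real p)\<^sup>2 + of_bool b / (real p)\<^sup>2" "1 - 2 / (real p)\<^sup>2 + of_bool b / (real p)\<^sup>2 \<le> 1"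
  using prime_inverse_square_le[OF assms] by (cases b; simp)+

lemma pair_density_bounds:
  assumes "\<And>p. p \<in> S \<Longrightarrow> prime p"
  shows "0 \<le> pair_density S m" "pair_density S m \<le> 1"
  unfolding pair_density_def using pair_density_factor assms
  by (auto intro!: prod_nonneg prod_le_1)

lemma pair_density_antimono:
  assumes "finite S'" "S \<subseteq> S'" "\<And>p. p \<in> S' \<Longrightarrow> prime p"
  shows "pair_density S' m \<le> pair_density S m"
proof -
  have "pair_density S' m = pair_density (S' - S) m * pair_density S m"
    unfolding pair_density_def using assms by (intro prod.subset_diff) auto
  also have "\<dots> \<le> 1 * pair_density S m"
    using assms by (intro mult_right_mono pair_density_bounds) auto
  finally show ?thesis by simp
qed

definition pair_limit :: "int \<times> int \<Rightarrow> real" where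
  "pair_limit m = lim (\<lambda>P. pair_density (primes_upto P) m)"

lemma pair_limit: "(\<lambda>P. pair_density (primes_upto P) m) \<longlonglongrightarrow> pair_limit m"
proof -
  have "decseq (\<lambda>P. pair_density (primes_upto P) m)"
    unfolding decseq_def by (intro allI impI pair_density_antimono) (auto simp: primes_upto_def)
  moreover have "0 \<le> pair_density (primes_upto P) m" for P
    by (intro pair_density_bounds) (auto simp: primes_upto_def)
  ultimately obtain L where "(\<lambda>P. pair_density (primes_upto P) m) \<longlonglongrightarrow> L"
    using decseq_convergent[of "\<lambda>P. pair_density (primes_upto P) m" 0] by blast
  thus ?thesis unfolding pair_limit_def by (simp add: limI)
qed

lemma visible_iff: "n \<in> visible \<longleftrightarrow> \<not> (\<exists>p. prime p \<and> dvd_point p n)"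
proof -
  obtain a b where n: "n = (a, b)" by (cases n)
  have dvd_point: "dvd_point p n \<longleftrightarrow> p dvd nat (gcd a b)" for p
  proof -
    have "dvd_point p n \<longleftrightarrow> int p dvd gcd a b" by (simp add: dvd_point_def n)
    also have "\<dots> \<longleftrightarrow> int p dvd int (nat (gcd a b))" by simp
    finally show ?thesis by (simp only: int_dvd_int_iff)
  qed
  have "n \<in> visible \<longleftrightarrow> nat (gcd a b) = 1" by (simp add: visible_def n nat_eq_iff)
  also have "\<dots> \<longleftrightarrow> \<not> (\<exists>p. prime p \<and> p dvd nat (gcd a b))"
    using prime_factor_nat[of "nat (gcd a b)"] by (auto simp: not_prime_1)
  finally show ?thesis by (simp add: dvd_point)
qed

text \<open>Sieving by primes up to \<open>P\<close> goes wrong only where \<open>n\<close> or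
  \<open>n - m\<close> is a nonzero multiple of some number above \<open>P\<close>, and such points
  have density \<open>O(1 / P)\<close>.\<close>

lemma lat_mean_visible_pair:
  "lat_mean (\<lambda>n. of_bool (n \<in> visible \<and> n - m \<in> visible)) (pair_limit m)"
proof (rule lat_mean_approx)
  fix e :: real assume e: "0 < e"
  have "\<forall>\<^sub>F P in sequentially. dist (pair_density (primes_upto P) m) (pair_limit m) < e"
    using pair_limit e by (rule tendstoD)
  \<comment> \<open>Here 45 = 9 + 4 * 9: the points \<open>n\<close> are counted in radius
    \<open>R\<close>, the points \<open>n - m\<close> in a radius of at most
    \<open>2 * R\<close>.\<close>
  moreover have "\<forall>\<^sub>F P in sequentially. 45 / e \<le> real P"
    using filterlim_real_sequentially unfolding filterlim_at_top by blast
  \<comment> \<open>The prime 2 has to be among those sieved, so that the origin is removed and does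
    not enter the exceptional set.\<close>
  moreover have "\<forall>\<^sub>F P in sequentially. (2::nat) \<le> P" by (rule eventually_ge_at_top)
  ultimately have "\<forall>\<^sub>F P in sequentially. dist (pair_density (primes_upto P) m) (pair_limit m) < e \<and> 45 / e \<le> real P \<and> 2 \<le> P"
    by eventually_elim simp
  then obtain P where P: "dist (pair_density (primes_upto P) m) (pair_limit m) < e" "45 / e \<le> real P" "2 \<le> P"
    by (auto simp: eventually_sequentially)
  define b :: "int \<times> int \<Rightarrow> real" where
    "b n = of_bool (dvd_point 1 (n - 0)) * (\<Prod>p\<in>primes_upto P. of_bool (\<not> dvd_point p n \<and> \<not> dvd_point p (n - m)))" for n
  define a :: "int \<times> int \<Rightarrow> real" where "a n = of_bool (n \<in> visible \<and> n - m \<in> visible)" for n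
  define T where "T = {n. n \<noteq> 0 \<and> (\<exists>q>P. dvd_point q n)}"
  have "lat_mean b (pair_density (primes_upto P) m / (real 1)\<^sup>2)"
    unfolding b_def by (rule lat_mean_pair_sieve) (auto simp: primes_upto_def)
  hence b: "lat_mean b (pair_density (primes_upto P) m)" by simp
  have b_eq: "b n = of_bool (\<forall>p\<in>primes_upto P. \<not> dvd_point p n \<and> \<not> dvd_point p (n - m))" for n
  proof -
    have "(\<Prod>p\<in>S. of_bool (Q p) :: real) = of_bool (\<forall>p\<in>S. Q p)" if "finite S" for S :: "nat set" and Q
      using that by (induction S rule: finite_induct) auto
    thus ?thesis by (simp add: b_def dvd_point_def)
  qed
  have nv: "n \<in> T" if nvis: "n \<notin> visible" and ndv: "\<forall>p\<in>primes_upto P. \<not> dvd_point p n" for n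
  proof -
    obtain q where q: "prime q" "dvd_point q n" using nvis visible_iff by blast
    hence "q \<notin> primes_upto P" using ndv by blast
    hence "q > P" using q by (auto simp: primes_upto_def)
    moreover have "n \<noteq> 0"
    proof
      assume "n = 0"
      hence "dvd_point 2 n" by (simp add: dvd_point_def)
      moreover have "2 \<in> primes_upto P" using P(3) by (simp add: primes_upto_def)
      ultimately show False using ndv by blast
    qed
    ultimately show ?thesis using q by (auto simp: T_def)
  qed
  have ab: "\<bar>a n - b n\<bar> \<le> of_bool (n \<in> T) + of_bool (n - m \<in> T)" for n
  proof (cases "b n = 1")
    case True
    hence "\<forall>p\<in>primes_upto P. \<not> dvd_point p n \<and> \<not> dvd_point p (n - m)" by (simp add: b_eq split: if_splits)
    thus ?thesis using True nv[of n] nv[of "n - m"] by (auto simp: a_def)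
  next
    case False
    hence b0: "b n = 0" by (simp add: b_eq)
    then obtain p where "p \<in> primes_upto P" "dvd_point p n \<or> dvd_point p (n - m)" by (auto simp: b_eq)
    hence "a n = 0" unfolding a_def visible_iff primes_upto_def by auto
    thus ?thesis using b0 by simp
  qed
  have "\<forall>\<^sub>F R in at_top. \<bar>lat_sum a R - lat_sum b R\<bar> \<le> e * (pi * R\<^sup>2)"
    using eventually_ge_at_top[of "norm (plane_point m)"] eventually_gt_at_top[of 0]
  proof eventually_elim
    case (elim R)
    let ?R = "R + norm (plane_point m)"
    have "lat_sum a R - lat_sum b R = (\<Sum>n\<in>disk R. a n - b n)" by (simp add: lat_sum_def sum_subtractf)
    also have "\<bar>\<dots>\<bar> \<le> (\<Sum>n\<in>disk R. \<bar>a n - b n\<bar>)" by (rule sum_abs)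
    also have "\<dots> \<le> (\<Sum>n\<in>disk R. of_bool (n \<in> T) + of_bool (n - m \<in> T))" by (intro sum_mono ab)
    also have "\<dots> = real (card {n\<in>disk R. n \<in> T}) + real (card {n\<in>disk R. n - m \<in> T})"
      by (simp add: sum.distrib Int_def)
    also have "card {n\<in>disk R. n - m \<in> T} \<le> card {n\<in>disk ?R. n \<in> T}"
    proof (rule card_inj_on_le[of "\<lambda>n. n - m"])
      show "(\<lambda>n. n - m) ` {n\<in>disk R. n - m \<in> T} \<subseteq> {n\<in>disk ?R. n \<in> T}"
      proof (intro subsetI, elim imageE)
        fix n k assume "n = k - m" "k \<in> {n\<in>disk R. n - m \<in> T}"
        thus "n \<in> {n\<in>disk ?R. n \<in> T}"
          using norm_triangle_ineq4[of "plane_point k" "plane_point m"] by (simp add: disk_def plane_point_diff)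
      qed
    qed (auto simp: inj_on_def)
    also have "real (card {n\<in>disk R. n \<in> T}) \<le> 9 * pi * R\<^sup>2 / P"
      using card_large_multiples_le[of P R] P(3) elim by (simp add: T_def)
    also have "real (card {n\<in>disk ?R. n \<in> T}) \<le> 9 * pi * ?R\<^sup>2 / P"
      using card_large_multiples_le[of P ?R] P(3) elim by (simp add: T_def)
    also have "9 * pi * ?R\<^sup>2 / P \<le> 9 * pi * (2 * R)\<^sup>2 / P"
      using elim by (intro divide_right_mono mult_left_mono power_mono) auto
    also have "9 * pi * R\<^sup>2 / P + 9 * pi * (2 * R)\<^sup>2 / P = (45 / P) * (pi * R\<^sup>2)"
      by (simp add: power_mult_distrib add_divide_distrib[symmetric])
    also have "\<dots> \<le> e * (pi * R\<^sup>2)"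
      using P(2,3) e by (intro mult_right_mono) (auto simp: field_simps)
    finally show ?case by simp
  qed
  thus "\<exists>b \<beta>. lat_mean b \<beta> \<and> \<bar>\<beta> - pair_limit m\<bar> \<le> e \<and>
    (\<forall>\<^sub>F R in at_top. \<bar>lat_sum (\<lambda>n. of_bool (n \<in> visible \<and> n - m \<in> visible)) R - lat_sum b R\<bar> \<le> e * (pi * R\<^sup>2))"
    using b P(1) unfolding a_def[abs_def] dist_real_def by (intro exI[of _ b] exI[of _ "pair_density (primes_upto P) m"]) auto
qed

section \<open>From lattice densities to means over the plane\<close>

definition lat_conv :: "(int \<times> int \<Rightarrow> real) \<Rightarrow> (real \<times> real) set \<Rightarrow> real \<times> real \<Rightarrow> real" where
  "lat_conv a K x = (\<Sum>n\<in>{n. x - plane_point n \<in> K}. a n)"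

lemma lat_sum_shift:
  assumes "lat_mean a \<alpha>" shows "((\<lambda>R. lat_sum a (R + c) / (pi * R\<^sup>2)) \<longlongrightarrow> \<alpha>) at_top"
proof -
  have "filterlim (\<lambda>R. R + c) at_top at_top"
    unfolding filterlim_at_top
  proof
    fix Z
    show "\<forall>\<^sub>F R in at_top. Z \<le> R + c" using eventually_ge_at_top[of "Z - c"] by eventually_elim simp
  qed
  hence "((\<lambda>R. lat_sum a (R + c) / (pi * (R + c)\<^sup>2)) \<longlongrightarrow> \<alpha>) at_top"
    using assms unfolding lat_mean_def by (rule filterlim_compose[rotated])
  from tendsto_mult[OF this tendsto_shifted_square[of c]]
  have "((\<lambda>R. lat_sum a (R + c) / (pi * (R + c)\<^sup>2) * ((R + c) / R)\<^sup>2) \<longlongrightarrow> \<alpha>) at_top" by simp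
  moreover have "\<forall>\<^sub>F R in at_top. lat_sum a (R + c) / (pi * (R + c)\<^sup>2) * ((R + c) / R)\<^sup>2 = lat_sum a (R + c) / (pi * R\<^sup>2)"
    using eventually_gt_at_top[of "\<bar>c\<bar>"] by eventually_elim (simp add: power_divide)
  ultimately show ?thesis by (simp add: tendsto_cong)
qed

text \<open>Every lattice point contributes a translate of \<open>K\<close>. Those within
  \<open>R - \<rho>\<close> contribute the full area and those beyond \<open>R + \<rho>\<close>
  nothing; since the weights are nonnegative, the integral lies between two shifted lattice sums
  with the same mean.\<close>

lemma mean_lat_conv:
  assumes K: "K \<in> sets borel" "K \<subseteq> cball 0 \<rho>" and \<rho>: "0 \<le> \<rho>"
    and a: "\<And>n. 0 \<le> a n" and mean: "lat_mean a \<alpha>"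
  shows "set_integrable lborel (cball 0 R) (lat_conv a K)"
    "((\<lambda>R. (1 / (pi * R\<^sup>2)) * (LINT x:cball 0 R|lborel. lat_conv a K x)) \<longlongrightarrow> \<alpha> * measure lborel K) at_top"
proof -
  have iK: "integrable lborel (indicat_real K)"
    using fmeasurableI2[OF fmeasurable_cball K(2)] K(1) by (intro integrable_real_indicator) (auto simp: fmeasurable_def)
  define u where "u R n x = indicat_real (cball 0 R) x * indicat_real K (- plane_point n + x)" for R n x
  have mKn: "(\<lambda>x. indicat_real K (- plane_point n + x)) \<in> borel_measurable borel" for n
    using K(1) by (intro measurable_compose[OF _ borel_measurable_indicator] borel_measurable_continuous_onI continuous_intros) auto
  have eqn: "indicat_real (cball 0 R) x * lat_conv a K x = (\<Sum>n\<in>disk (R + \<rho>). a n * u R n x)" for R x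
  proof (cases "x \<in> cball 0 R")
    case True
    have sub: "{n. x - plane_point n \<in> K} \<subseteq> disk (R + \<rho>)"
    proof
      fix n assume "n \<in> {n. x - plane_point n \<in> K}"
      hence "norm (x - plane_point n) \<le> \<rho>" using K(2) by auto
      moreover have "norm (plane_point n) \<le> norm (x - plane_point n) + norm x"
        by (metis add.commute norm_minus_commute norm_triangle_sub)
      ultimately show "n \<in> disk (R + \<rho>)" using True by (simp add: disk_def)
    qed
    have "lat_conv a K x = (\<Sum>n\<in>disk (R + \<rho>). if x - plane_point n \<in> K then a n else 0)"
    proof -
      have "{n. x - plane_point n \<in> K} = {n\<in>disk (R + \<rho>). x - plane_point n \<in> K}" using sub by auto
      thus ?thesis unfolding lat_conv_def by (simp only: sum.inter_filter[OF finite_disk])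
    qed
    also have "\<dots> = (\<Sum>n\<in>disk (R + \<rho>). a n * u R n x)"
      using True by (intro sum.cong) (auto simp: u_def indicator_def)
    finally show ?thesis using True by simp
  qed (simp add: u_def)
  have iu: "integrable lborel (u R n)" for R n
  proof (rule Bochner_Integration.integrable_bound[of _ "indicat_real (cball (0 :: real \<times> real) R)"])
    have "u R n \<in> borel_measurable borel"
      unfolding u_def[abs_def] by (intro borel_measurable_times mKn borel_measurable_indicator) auto
    thus "u R n \<in> borel_measurable lborel" by simp
  qed (auto simp: u_def indicator_def intro!: integrable_real_indicator)
  have int: "integrable lborel (\<lambda>x. indicat_real (cball 0 R) x * lat_conv a K x)" for R
    unfolding eqn using iu by (intro Bochner_Integration.integrable_sum integrable_mult_right)
  show "set_integrable lborel (cball 0 R) (lat_conv a K)"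
    using int by (simp add: set_integrable_def)
  define J where "J R n = (\<integral>x. u R n x \<partial>lborel)" for R n
  have I: "(LINT x:cball 0 R|lborel. lat_conv a K x) = (\<Sum>n\<in>disk (R + \<rho>). a n * J R n)" for R
    unfolding set_lebesgue_integral_def real_scaleR_def eqn J_def
    using iu by (subst Bochner_Integration.integral_sum) auto
  have full: "(\<integral>x. indicat_real K (- plane_point n + x) \<partial>lborel) = measure lborel K" for n
  proof -
    have "(\<integral>x. indicat_real K (- plane_point n + x) \<partial>lborel) = (\<integral>x. indicat_real K x \<partial>lborel)"
      using K(1) by (intro lborel_integral_translate) simp
    thus ?thesis using K(1) by simp
  qed
  have iKn: "integrable lborel (\<lambda>x. indicat_real K (- plane_point n + x))" for n
    by (rule lborel_integrable_translate[OF iK])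
  have J_le: "J R n \<le> measure lborel K" for R n
    unfolding J_def full[of n, symmetric] using iu iKn by (intro integral_mono) (auto simp: u_def indicator_def)
  have J0: "0 \<le> J R n" for R n unfolding J_def by (intro Bochner_Integration.integral_nonneg) (simp add: u_def)
  have J_eq: "J R n = measure lborel K" if "n \<in> disk (R - \<rho>)" for R n
  proof -
    have "u R n x = indicat_real K (- plane_point n + x)" for x
    proof (cases "- plane_point n + x \<in> K")
      case True
      hence "norm (- plane_point n + x) \<le> \<rho>" using K(2) by auto
      moreover have "norm x \<le> norm (- plane_point n + x) + norm (plane_point n)" 
        using norm_triangle_ineq[of "- plane_point n + x" "plane_point n"] by simp
      ultimately show ?thesis using that by (simp add: u_def disk_def)
    qed (simp add: u_def)
    hence "J R n = (\<integral>x. indicat_real K (- plane_point n + x) \<partial>lborel)" by (simp only: J_def)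
    thus ?thesis by (simp only: full)
  qed
  have upper: "(LINT x:cball 0 R|lborel. lat_conv a K x) \<le> lat_sum a (R + \<rho>) * measure lborel K" for R
    unfolding I lat_sum_def sum_distrib_right using J_le a by (intro sum_mono mult_left_mono)
  have lower: "lat_sum a (R + (- \<rho>)) * measure lborel K \<le> (LINT x:cball 0 R|lborel. lat_conv a K x)" for R
  proof -
    have "lat_sum a (R + (- \<rho>)) * measure lborel K = (\<Sum>n\<in>disk (R - \<rho>). a n * J R n)"
      unfolding lat_sum_def sum_distrib_right using J_eq by (intro sum.cong) auto
    also have "\<dots> \<le> (\<Sum>n\<in>disk (R + \<rho>). a n * J R n)"
      using \<rho> a J0 by (intro sum_mono2 disk_mono) auto
    finally show ?thesis unfolding I .
  qed
  have "((\<lambda>R. lat_sum a (R + (- \<rho>)) / (pi * R\<^sup>2) * measure lborel K) \<longlongrightarrow> \<alpha> * measure lborel K) at_top"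
    "((\<lambda>R. lat_sum a (R + \<rho>) / (pi * R\<^sup>2) * measure lborel K) \<longlongrightarrow> \<alpha> * measure lborel K) at_top"
    by (intro tendsto_mult_right lat_sum_shift mean)+
  thus "((\<lambda>R. (1 / (pi * R\<^sup>2)) * (LINT x:cball 0 R|lborel. lat_conv a K x)) \<longlongrightarrow> \<alpha> * measure lborel K) at_top"
  proof (rule tendsto_sandwich[rotated 2])
    show "\<forall>\<^sub>F R in at_top. lat_sum a (R + (- \<rho>)) / (pi * R\<^sup>2) * measure lborel K \<le> (1 / (pi * R\<^sup>2)) * (LINT x:cball 0 R|lborel. lat_conv a K x)"
    proof (intro always_eventually allI)
      fix R show "lat_sum a (R + (- \<rho>)) / (pi * R\<^sup>2) * measure lborel K \<le> (1 / (pi * R\<^sup>2)) * (LINT x:cball 0 R|lborel. lat_conv a K x)"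
        using mult_left_mono[OF lower[of R], of "1 / (pi * R\<^sup>2)"] by simp
    qed
    show "\<forall>\<^sub>F R in at_top. (1 / (pi * R\<^sup>2)) * (LINT x:cball 0 R|lborel. lat_conv a K x) \<le> lat_sum a (R + \<rho>) / (pi * R\<^sup>2) * measure lborel K"
    proof (intro always_eventually allI)
      fix R show "(1 / (pi * R\<^sup>2)) * (LINT x:cball 0 R|lborel. lat_conv a K x) \<le> lat_sum a (R + \<rho>) / (pi * R\<^sup>2) * measure lborel K"
        using mult_left_mono[OF upper[of R], of "1 / (pi * R\<^sup>2)"] by simp
    qed
  qed
qed

subsection \<open>The mean square as a lattice sum\<close>

text \<open>The square counts ordered pairs of visible points in the disc around \<open>x\<close>.
  Grouped by their difference \<open>m\<close>, a pair is given by its first point \<open>n\<close>,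
  and both points lie in the disc exactly when \<open>x - plane_point n\<close> is in
  \<open>K m\<close>; differences longer than \<open>2 * r\<close> do not occur.\<close>

lemma mean_visible_pair_lens:
  assumes r: "0 < r"
  defines "K m \<equiv> {y. norm y \<le> r \<and> norm (plane_point m + y) \<le> r}"
  shows "(real (G r x))\<^sup>2 = (\<Sum>m\<in>disk (2 * r). lat_conv (\<lambda>n. of_bool (n \<in> visible \<and> n - m \<in> visible)) (K m) x)"
    "real (G r x) = lat_conv (\<lambda>n. of_bool (n \<in> visible)) (cball 0 r) x"
proof -
  define N where "N = {n. norm (x - plane_point n) \<le> r}"
  have "N \<subseteq> disk (norm x + r)"
  proof
    fix n assume "n \<in> N"
    moreover have "norm (plane_point n) \<le> norm (x - plane_point n) + norm x"
      by (metis add.commute norm_minus_commute norm_triangle_sub)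
    ultimately show "n \<in> disk (norm x + r)" by (simp add: N_def disk_def)
  qed
  hence fN: "finite N" by (rule finite_subset) simp
  define lat_var where "lat_var = {n\<in>visible. n \<in> N}"
  have fV: "finite lat_var" using fN by (simp add: lat_var_def)
  have G: "G r x = card lat_var" by (simp add: G_def lat_var_def N_def)
  show "real (G r x) = lat_conv (\<lambda>n. of_bool (n \<in> visible)) (cball 0 r) x"
  proof -
    have "{n. x - plane_point n \<in> cball 0 r} = N" by (auto simp: N_def)
    moreover have "N \<inter> {n. n \<in> visible} = lat_var" by (auto simp: lat_var_def)
    ultimately show ?thesis using fN by (simp add: lat_conv_def G)
  qed
  have "(\<lambda>p. fst p - snd p) ` (lat_var \<times> lat_var) \<subseteq> disk (2 * r)"
  proof (clarsimp simp: disk_def plane_point_diff)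
    fix a b a' b' assume "(a, b) \<in> lat_var" "(a', b') \<in> lat_var"
    hence "norm (x - plane_point (a, b)) \<le> r" "norm (x - plane_point (a', b')) \<le> r" by (auto simp: lat_var_def N_def)
    moreover have "norm (plane_point ((a, b) - (a', b'))) \<le> norm (x - plane_point (a', b')) + norm (x - plane_point (a, b))"
      using norm_triangle_ineq4[of "x - plane_point (a', b')" "x - plane_point (a, b)"] by (simp only: plane_point_diff) simp
    ultimately show "norm (plane_point (a - a', b - b')) \<le> 2 * r" by simp
  qed
  hence "(\<Sum>p\<in>lat_var \<times> lat_var. 1 :: real) = (\<Sum>m\<in>disk (2 * r). \<Sum>p\<in>{p\<in>lat_var \<times> lat_var. fst p - snd p = m}. 1)"
    using fV by (intro sum.group[symmetric]) auto
  also have "\<dots> = (\<Sum>m\<in>disk (2 * r). lat_conv (\<lambda>n. of_bool (n \<in> visible \<and> n - m \<in> visible)) (K m) x)"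
  proof (rule sum.cong[OF refl])
    fix m
    have "card {p\<in>lat_var \<times> lat_var. fst p - snd p = m} = card {n\<in>lat_var. n - m \<in> lat_var}"
      by (rule bij_betw_same_card[of fst], rule bij_betw_byWitness[where f' = "\<lambda>n. (n, n - m)"]) auto
    also have "{n\<in>lat_var. n - m \<in> lat_var} = {n. x - plane_point n \<in> K m} \<inter> {n. n \<in> visible \<and> n - m \<in> visible}"
      by (auto simp: lat_var_def N_def K_def plane_point_diff algebra_simps)
    finally have c: "card {p\<in>lat_var \<times> lat_var. fst p - snd p = m} = card ({n. x - plane_point n \<in> K m} \<inter> {n. n \<in> visible \<and> n - m \<in> visible})" .
    have "finite {n. x - plane_point n \<in> K m}"
      by (rule finite_subset[OF _ fN]) (auto simp: K_def N_def)
    thus "(\<Sum>p\<in>{p\<in>lat_var \<times> lat_var. fst p - snd p = m}. 1) = lat_conv (\<lambda>n. of_bool (n \<in> visible \<and> n - m \<in> visible)) (K m) x"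
      by (simp add: lat_conv_def c)
  qed
  finally show "(real (G r x))\<^sup>2 = (\<Sum>m\<in>disk (2 * r). lat_conv (\<lambda>n. of_bool (n \<in> visible \<and> n - m \<in> visible)) (K m) x)"
    by (simp add: G card_cartesian_product power2_eq_square)
qed

text \<open>The sieve of Eratosthenes applied to the sum of inverse squares: the multiples of
  \<open>p\<close> in a set closed under multiplication and division by \<open>p\<close> carry the
  fraction 1/p^2 of its sum.\<close>

lemma prod_primes_inverse_squares:
  assumes S: "finite S" "\<And>p. p \<in> S \<Longrightarrow> prime p"
  shows "(\<Prod>p\<in>S. 1 - 1 / (real p)\<^sup>2) * (pi\<^sup>2 / 6) = (\<Sum>\<^sub>\<infinity>n\<in>{n. 1 \<le> n \<and> (\<forall>p\<in>S. \<not> p dvd n)}. 1 / (real n)\<^sup>2)"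
  using S
proof (induction S rule: finite_induct)
  case empty
  have "((\<lambda>n. 1 / (real (Suc n))\<^sup>2) has_sum (pi\<^sup>2 / 6)) UNIV"
    using inverse_squares_sums by (intro norm_summable_imp_has_sum) (auto simp: sums_iff add.commute)
  hence "((\<lambda>n. 1 / (real n)\<^sup>2) has_sum (pi\<^sup>2 / 6)) (range Suc)"
    by (subst has_sum_reindex) (auto simp: o_def)
  also have "range Suc = {n. 1 \<le> n}"
  proof (intro equalityI subsetI)
    fix n :: nat assume "n \<in> {n. 1 \<le> n}"
    thus "n \<in> range Suc" by (cases n) auto
  qed auto
  finally show ?case by (simp add: infsumI)
next
  case (insert p S)
  define A where "A = {n. 1 \<le> n \<and> (\<forall>q\<in>S. \<not> q dvd n)}"
  define A' where "A' = {n. 1 \<le> n \<and> (\<forall>q\<in>insert p S. \<not> q dvd n)}"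
  have p: "prime p" using insert by auto
  have A: "A = A' \<union> (*) p ` A"
  proof (intro equalityI subsetI)
    fix n assume n: "n \<in> A"
    show "n \<in> A' \<union> (*) p ` A"
    proof (cases "p dvd n")
      case True
      then obtain k where k: "n = p * k" by auto
      hence "k \<in> A" using n by (auto simp: A_def Suc_le_eq)
      thus ?thesis using k by blast
    qed (use n in \<open>auto simp: A_def A'_def\<close>)
  next
    fix n assume "n \<in> A' \<union> (*) p ` A"
    thus "n \<in> A"
    proof
      assume "n \<in> (*) p ` A"
      then obtain k where k: "n = p * k" "k \<in> A" by auto
      have "\<not> q dvd n" if q: "q \<in> S" for q
      proof
        assume "q dvd n"
        hence "q dvd p \<or> q dvd k" using k q insert.prems by (simp add: prime_dvd_mult_iff)
        moreover have "\<not> q dvd p" using q insert.prems insert.hyps p primes_dvd_imp_eq[of q p] by auto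
        ultimately show False using k q by (auto simp: A_def)
      qed
      thus ?thesis using k prime_gt_0_nat[OF p] by (auto simp: A_def Suc_le_eq)
    qed (auto simp: A_def A'_def)
  qed
  have disj: "A' \<inter> (*) p ` A = {}" by (auto simp: A'_def)
  let ?f = "\<lambda>n. 1 / (real n)\<^sup>2"
  have s: "?f summable_on B" for B
  proof -
    have "summable ?f" using inverse_power_summable[of 2] by (simp add: inverse_eq_divide)
    hence "?f summable_on UNIV" by (intro norm_summable_imp_summable_on) simp
    thus ?thesis by (rule summable_on_subset_banach) auto
  qed
  have inj: "inj_on ((*) p) A" using prime_gt_0_nat[OF p] by (auto simp: inj_on_def)
  have "infsum ?f A = infsum ?f A' + infsum ?f ((*) p ` A)"
    by (subst A) (intro infsum_Un_disjoint s disj)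
  also have "infsum ?f ((*) p ` A) = infsum (\<lambda>n. 1 / (real p)\<^sup>2 * ?f n) A"
    by (subst infsum_reindex[OF inj]) (simp add: o_def power_mult_distrib)
  also have "\<dots> = 1 / (real p)\<^sup>2 * infsum ?f A" by (rule infsum_cmult_right) (rule s)
  finally have "infsum ?f A' = (1 - 1 / (real p)\<^sup>2) * infsum ?f A" by (simp add: algebra_simps)
  moreover have "infsum ?f A = (\<Prod>p\<in>S. 1 - 1 / (real p)\<^sup>2) * (pi\<^sup>2 / 6)" using insert by (simp add: A_def)
  ultimately show ?case using insert.hyps by (simp add: A'_def)
qed

text \<open>After sieving by the primes up to \<open>P\<close>, only 1 and integers above
  \<open>P\<close> remain, so the remaining sum is 1 up to an error of 1/P.\<close>

lemma euler_product_zeta2: "(\<lambda>P. \<Prod>p\<in>primes_upto P. 1 - 1 / (real p)\<^sup>2) \<longlonglongrightarrow> 6 / pi\<^sup>2"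
proof -
  let ?f = "\<lambda>n. 1 / (real n)\<^sup>2"
  define E where "E P = (\<Prod>p\<in>primes_upto P. 1 - 1 / (real p)\<^sup>2) * (pi\<^sup>2 / 6)" for P
  have s: "?f summable_on B" for B
  proof -
    have "summable ?f" using inverse_power_summable[of 2] by (simp add: inverse_eq_divide)
    hence "?f summable_on UNIV" by (intro norm_summable_imp_summable_on) simp
    thus ?thesis by (rule summable_on_subset_banach) auto
  qed
  have E: "1 \<le> E P \<and> E P \<le> 1 + 1 / P" if P: "1 \<le> P" for P
  proof -
    define A where "A = {n. 1 \<le> n \<and> (\<forall>p\<in>primes_upto P. \<not> p dvd n)}"
    have EA: "E P = infsum ?f A"
      unfolding E_def A_def by (rule prod_primes_inverse_squares) (auto simp: primes_upto_def)
    have 1: "1 \<in> A" by (auto simp: A_def primes_upto_def)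
    have sub: "A - {1} \<subseteq> {P<..}"
    proof
      fix n assume n: "n \<in> A - {1}"
      then obtain q where q: "prime q" "q dvd n" using prime_factor_nat[of n] by auto
      hence "q \<le> n" using n dvd_imp_le[of q n] by (auto simp: A_def)
      moreover have "P < q" using q n by (auto simp: A_def primes_upto_def not_le)
      ultimately show "n \<in> {P<..}" by simp
    qed
    have "infsum ?f A = 1 + infsum ?f (A - {1})" using infsum_diff_finite[OF s, of "{1}" A] 1 by simp
    moreover have "0 \<le> infsum ?f (A - {1})" by (rule infsum_nonneg) simp
    moreover have "infsum ?f (A - {1}) \<le> 1 / P"
    proof (rule infsum_le_finite_sums[OF s])
      fix F assume F: "finite F" "F \<subseteq> A - {1}"
      have "sum ?f F \<le> sum ?f {P<..Max (insert 0 F)}"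
        using F sub by (intro sum_mono2) auto
      thus "sum ?f F \<le> 1 / P" using sum_inverse_squares_le[OF P, of "Max (insert 0 F)"] by linarith
    qed
    ultimately show ?thesis unfolding EA by simp
  qed
  have "E \<longlonglongrightarrow> 1"
  proof (rule tendsto_sandwich[of "\<lambda>_. 1" E sequentially "\<lambda>P. 1 + 1 / P"])
    show "\<forall>\<^sub>F P in sequentially. 1 \<le> E P" "\<forall>\<^sub>F P in sequentially. E P \<le> 1 + 1 / real P"
      using eventually_ge_at_top[of 1] by (eventually_elim, use E in blast)+
    show "(\<lambda>P. 1 + 1 / real P) \<longlonglongrightarrow> 1" using tendsto_add[OF tendsto_const lim_1_over_n, of 1] by simp
  qed simp
  from tendsto_mult_right[OF this, of "6 / pi\<^sup>2"] show ?thesis by (simp add: E_def)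
qed

lemma pair_limit_0: "pair_limit 0 = 6 / pi\<^sup>2"
proof -
  have "pair_density S 0 = (\<Prod>p\<in>S. 1 - 1 / (real p)\<^sup>2)" for S
    unfolding pair_density_def by (intro prod.cong refl) (simp add: dvd_point_def)
  thus ?thesis using pair_limit[of 0] euler_product_zeta2 LIMSEQ_unique by auto
qed

text \<open>The mean exists, so the limit operator in the definition of the mean returns its value.\<close>

lemma plane_mean_X_square:
  assumes r: "0 < r"
  shows "plane_mean (\<lambda>x. (X r x)\<^sup>2) = ((\<Sum>\<^sub>\<infinity>m. pair_limit m * lens r (plane_point m)) - 36 * r ^ 4 / pi\<^sup>2) / r\<^sup>2"
proof -
  define K where "K m = {y. norm y \<le> r \<and> norm (plane_point m + y) \<le> r}" for m
  define a where "a m n = (of_bool (n \<in> visible \<and> n - m \<in> visible) :: real)" for m n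
  define v where "v n = (of_bool (n \<in> visible) :: real)" for n
  have K: "K m \<in> sets borel" "K m \<subseteq> cball 0 r" for m
    by (auto simp: K_def lens_set_eq)
  have K_lens: "measure lborel (K m) = lens r (plane_point m)" for m by (simp add: K_def lens_def)
  have v: "lat_mean v (6 / pi\<^sup>2)"
    using lat_mean_visible_pair[of 0] by (simp add: v_def[abs_def] pair_limit_0)
  note G2 = mean_visible_pair_lens(1)[OF r, folded K_def a_def]
  note G1 = mean_visible_pair_lens(2)[OF r, folded v_def]
  have a0: "0 \<le> a m n" "0 \<le> v n" for m n by (auto simp: a_def v_def)
  have a_mean: "lat_mean (a m) (pair_limit m)" for m unfolding a_def[abs_def] by (rule lat_mean_visible_pair)
  note conv_a = mean_lat_conv[OF K less_imp_le[OF r] a0(1) a_mean]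
  have cb: "cball (0::real \<times> real) r \<in> sets borel" by simp
  note conv_v = mean_lat_conv[OF cb order.refl less_imp_le[OF r] a0(2) v]
  have X2: "(X r x)\<^sup>2 = (\<Sum>m\<in>disk (2 * r). lat_conv (a m) (K m) x) / r\<^sup>2 - 12 / pi * lat_conv v (cball 0 r) x + 36 * r\<^sup>2 / pi\<^sup>2" for x
  proof -
    have "(X r x)\<^sup>2 = (real (G r x))\<^sup>2 / r\<^sup>2 - 12 / pi * real (G r x) + 36 * r\<^sup>2 / pi\<^sup>2"
      using r by (simp add: X_def power2_eq_square field_simps)
    thus ?thesis by (subst (asm) G2) (simp only: G1)
  qed
  have int: "(LINT x:cball 0 R|lborel. (X r x)\<^sup>2) =
     (\<Sum>m\<in>disk (2 * r). LINT x:cball 0 R|lborel. lat_conv (a m) (K m) x) / r\<^sup>2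
       - 12 / pi * (LINT x:cball 0 R|lborel. lat_conv v (cball 0 r) x) + 36 * r\<^sup>2 / pi\<^sup>2 * measure lborel (cball (0::real \<times> real) R)" for R
  proof -
    define J where "J x = indicat_real (cball (0::real \<times> real) R) x" for x
    have ia: "integrable lborel (\<lambda>x. J x * lat_conv (a m) (K m) x)" for m
      using conv_a(1)[of R m] by (simp add: set_integrable_def J_def)
    have iv: "integrable lborel (\<lambda>x. J x * lat_conv v (cball 0 r) x)"
      using conv_v(1)[of R] by (simp add: set_integrable_def J_def)
    have iJ: "integrable lborel J" unfolding J_def[abs_def] by (intro integrable_real_indicator) auto
    have "(LINT x:cball 0 R|lborel. (X r x)\<^sup>2) = (\<integral>x. ((\<Sum>m\<in>disk (2 * r). J x * lat_conv (a m) (K m) x) / r\<^sup>2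
       - 12 / pi * (J x * lat_conv v (cball 0 r) x)) + 36 * r\<^sup>2 / pi\<^sup>2 * J x \<partial>lborel)"
      unfolding set_lebesgue_integral_def X2 J_def
      by (intro Bochner_Integration.integral_cong refl) (simp add: indicator_def)
    also have "\<dots> = (\<integral>x. (\<Sum>m\<in>disk (2 * r). J x * lat_conv (a m) (K m) x) / r\<^sup>2 \<partial>lborel)
       - (\<integral>x. 12 / pi * (J x * lat_conv v (cball 0 r) x) \<partial>lborel) + (\<integral>x. 36 * r\<^sup>2 / pi\<^sup>2 * J x \<partial>lborel)"
      using ia iv iJ by (simp add: Bochner_Integration.integral_add Bochner_Integration.integral_diff)
    also have "(\<integral>x. (\<Sum>m\<in>disk (2 * r). J x * lat_conv (a m) (K m) x) / r\<^sup>2 \<partial>lborel)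
       = (\<Sum>m\<in>disk (2 * r). \<integral>x. J x * lat_conv (a m) (K m) x \<partial>lborel) / r\<^sup>2"
      using ia by (simp add: Bochner_Integration.integral_sum)
    finally show ?thesis
      by (simp add: set_lebesgue_integral_def J_def[abs_def])
  qed
  have c1: "((\<lambda>R. \<Sum>m\<in>disk (2 * r). (1 / (pi * R\<^sup>2)) * (LINT x:cball 0 R|lborel. lat_conv (a m) (K m) x))
      \<longlongrightarrow> (\<Sum>m\<in>disk (2 * r). pair_limit m * lens r (plane_point m))) at_top"
    unfolding K_lens[symmetric] by (intro tendsto_sum conv_a(2))
  have c2: "((\<lambda>R. (1 / (pi * R\<^sup>2)) * (LINT x:cball 0 R|lborel. lat_conv v (cball 0 r) x))
      \<longlongrightarrow> 6 / pi\<^sup>2 * (pi * r\<^sup>2)) at_top"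
    using conv_v(2) r by (simp add: measure_disc)
  have c3: "((\<lambda>R::real. 36 * r\<^sup>2 / pi\<^sup>2) \<longlongrightarrow> 36 * r\<^sup>2 / pi\<^sup>2) at_top" by simp
  \<comment> \<open>The cross term is -72 r^2/pi^2; together with the last term it leaves -36
    r^2/pi^2, minus the squared mean of the count divided by r^2.\<close>
  let ?L = "(\<Sum>m\<in>disk (2 * r). pair_limit m * lens r (plane_point m)) / r\<^sup>2 - 12 / pi * (6 / pi\<^sup>2 * (pi * r\<^sup>2)) + 36 * r\<^sup>2 / pi\<^sup>2"
  have "((\<lambda>R. (\<Sum>m\<in>disk (2 * r). (1 / (pi * R\<^sup>2)) * (LINT x:cball 0 R|lborel. lat_conv (a m) (K m) x)) / r\<^sup>2
      - 12 / pi * ((1 / (pi * R\<^sup>2)) * (LINT x:cball 0 R|lborel. lat_conv v (cball 0 r) x)) + 36 * r\<^sup>2 / pi\<^sup>2) \<longlongrightarrow> ?L) at_top"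
    using r by (intro tendsto_add tendsto_diff tendsto_divide tendsto_mult tendsto_const c1 c2) auto
  moreover have "\<forall>\<^sub>F R in at_top. (\<Sum>m\<in>disk (2 * r). (1 / (pi * R\<^sup>2)) * (LINT x:cball 0 R|lborel. lat_conv (a m) (K m) x)) / r\<^sup>2
      - 12 / pi * ((1 / (pi * R\<^sup>2)) * (LINT x:cball 0 R|lborel. lat_conv v (cball 0 r) x)) + 36 * r\<^sup>2 / pi\<^sup>2
     = (1 / (pi * R\<^sup>2)) *\<^sub>R (LINT x:cball 0 R|lborel. (X r x)\<^sup>2)"
    using eventually_gt_at_top[of 0]
  proof eventually_elim
    case (elim R)
    define c where "c = 1 / (pi * R\<^sup>2)"
    define D k kk where "D = measure lborel (cball (0::real \<times> real) R)" and "k = 12 / pi" and "kk = 36 * r\<^sup>2 / pi\<^sup>2"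
    have "c * D = 1" using elim by (simp add: measure_disc c_def D_def)
    hence e: "c * (kk * D) = kk" by (simp add: mult.left_commute)
    show ?case unfolding int c_def[symmetric] real_scaleR_def D_def[symmetric] k_def[symmetric] kk_def[symmetric]
      by (simp add: distrib_left right_diff_distrib sum_distrib_left[symmetric] e mult.left_commute[of c k])
  qed
  ultimately have lim: "((\<lambda>R. (1 / (pi * R\<^sup>2)) *\<^sub>R (LINT x:cball 0 R|lborel. (X r x)\<^sup>2)) \<longlongrightarrow> ?L) at_top"
    by (rule Lim_transform_eventually)
  have "plane_mean (\<lambda>x. (X r x)\<^sup>2) = ?L"
    unfolding plane_mean_def by (rule tendsto_Lim[OF _ lim]) simp
  also have "(\<Sum>m\<in>disk (2 * r). pair_limit m * lens r (plane_point m)) = (\<Sum>\<^sub>\<infinity>m. pair_limit m * lens r (plane_point m))"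
  proof -
    have "(\<Sum>\<^sub>\<infinity>m\<in>disk (2 * r). pair_limit m * lens r (plane_point m)) = (\<Sum>\<^sub>\<infinity>m. pair_limit m * lens r (plane_point m))"
      by (rule infsum_cong_neutral) (auto simp: disk_def not_le lens_eq_0)
    thus ?thesis by simp
  qed
  finally show ?thesis using r by (simp add: field_simps power2_eq_square power4_eq_xxxx)
qed

subsection \<open>Expansion in the variance of the full lattice\<close>

lemma measure_scale_plane:
  assumes c: "0 < c" and A: "A \<in> sets borel" "A \<in> fmeasurable lborel"
  shows "measure lborel A = c\<^sup>2 * measure lborel {y :: real \<times> real. c *\<^sub>R y \<in> A}"
proof -
  have m: "(\<lambda>x::real \<times> real. 0 + c *\<^sub>R x) \<in> borel_measurable borel"
    by (intro borel_measurable_continuous_onI continuous_intros)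
  have B: "(\<lambda>x::real \<times> real. 0 + c *\<^sub>R x) -` A \<in> sets borel" using measurable_sets[OF m A(1)] by simp
  have "emeasure lborel A = emeasure (density (distr lborel borel (\<lambda>x::real \<times> real. 0 + c *\<^sub>R x)) (\<lambda>_. ennreal (\<bar>c\<bar> ^ DIM(real \<times> real)))) A"
    using lborel_affine[of c "0::real \<times> real"] c by simp
  also have "\<dots> = ennreal (c\<^sup>2) * emeasure lborel ((\<lambda>x::real \<times> real. 0 + c *\<^sub>R x) -` A)"
    using A c m by (subst emeasure_density_const) (auto simp: emeasure_distr power2_eq_square)
  finally show ?thesis
    using c by (simp add: measure_def enn2real_mult vimage_def)
qed

lemma lens_scale:
  assumes c: "0 < c"
  shows "lens r (c *\<^sub>R x) = c\<^sup>2 * lens (r / c) x"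
proof -
  have "{y. c *\<^sub>R y \<in> {y. norm y \<le> r \<and> norm (c *\<^sub>R x + y) \<le> r}} = {y. norm y \<le> r / c \<and> norm (x + y) \<le> r / c}"
  proof -
    have "norm (c *\<^sub>R x + c *\<^sub>R y) = c * norm (x + y)" for y
      using c by (simp add: scaleR_add_right[symmetric])
    thus ?thesis using c by (auto simp: field_simps)
  qed
  moreover have "measure lborel {y. norm y \<le> r \<and> norm (c *\<^sub>R x + y) \<le> r}
     = c\<^sup>2 * measure lborel {y. c *\<^sub>R y \<in> {y. norm y \<le> r \<and> norm (c *\<^sub>R x + y) \<le> r}}"
    unfolding lens_set_eq by (intro measure_scale_plane c fmeasurable.Int fmeasurable_cball) auto
  ultimately show ?thesis by (simp add: lens_def)
qed

lemma summable_on_lens: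
  fixes f :: "int \<times> int \<Rightarrow> real" shows "(\<lambda>m. f m * lens r (plane_point m)) summable_on A"
proof -
  have "(\<lambda>m. f m * lens r (plane_point m)) summable_on UNIV \<longleftrightarrow> (\<lambda>m. f m * lens r (plane_point m)) summable_on disk (2 * r)"
    by (rule summable_on_cong_neutral) (auto simp: disk_def not_le lens_eq_0)
  hence "(\<lambda>m. f m * lens r (plane_point m)) summable_on UNIV" by simp
  thus ?thesis by (rule summable_on_subset_banach) auto
qed

text \<open>In the full lattice every difference vector has pair density 1, so this is the mean
  square minus the squared mean of the number of lattice points in a random disc.\<close>

definition lat_var :: "real \<Rightarrow> real" where
  "lat_var r = (\<Sum>\<^sub>\<infinity>m. lens r (plane_point m)) - (pi * r\<^sup>2)\<^sup>2"

text \<open>These are the weights produced by iterating \<open>pair_var_insert\<close>; the value 0 at multiples of \<open>p\<^sup>2\<close> discards non-squarefree \<open>g\<close>.\<close>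

definition local_wt :: "nat \<Rightarrow> nat \<Rightarrow> real" where
  "local_wt p g = (if p\<^sup>2 dvd g then 0 else if p dvd g then 1 else 1 - 2 / (real p)\<^sup>2)"

definition euler_wt :: "nat set \<Rightarrow> nat \<Rightarrow> real" where
  "euler_wt S g = (\<Prod>p\<in>S. local_wt p g)"

text \<open>The same variance for the lattice points not divisible by any prime in \<open>S\<close>;
  the subtracted term is the square of their mean number. For empty \<open>S\<close> it is
  \<open>lat_var\<close>.\<close>

definition pair_var :: "nat set \<Rightarrow> real \<Rightarrow> real" where
  "pair_var S r = (\<Sum>\<^sub>\<infinity>m. pair_density S m * lens r (plane_point m)) - pi\<^sup>2 * r ^ 4 * (\<Prod>p\<in>S. 1 - 1 / (real p)\<^sup>2)\<^sup>2"

text \<open>The multiples of \<open>p\<close> form a copy of the lattice enlarged by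
  \<open>p\<close>; shrinking it back divides the radius by \<open>p\<close> and multiplies overlap
  areas by p^2.\<close>

lemma infsum_multiples_lens:
  assumes p: "1 \<le> p" and f: "\<And>m. f (int p * fst m, int p * snd m) = f m"
  shows "(\<Sum>\<^sub>\<infinity>m. of_bool (dvd_point p m) * f m * lens r (plane_point m)) = (real p)\<^sup>2 * (\<Sum>\<^sub>\<infinity>m. f m * lens (r / p) (plane_point m))"
proof -
  define h where "h m = (int p * fst m, int p * snd m)" for m :: "int \<times> int"
  have inj: "inj h" using p by (auto simp: inj_on_def h_def prod_eq_iff)
  have rng: "range h = {m. dvd_point p m}"
  proof (intro equalityI subsetI)
    fix m assume "m \<in> {m. dvd_point p m}"
    then obtain a b where "fst m = int p * a" "snd m = int p * b" by (auto simp: dvd_point_def dvd_def)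
    hence "m = h (a, b)" by (simp add: h_def prod_eq_iff)
    thus "m \<in> range h" by blast
  qed (auto simp: h_def dvd_point_def)
  have pp: "plane_point (h m) = real p *\<^sub>R plane_point m" for m by (simp add: h_def plane_point_def)
  have "(\<Sum>\<^sub>\<infinity>m. of_bool (dvd_point p m) * f m * lens r (plane_point m)) = (\<Sum>\<^sub>\<infinity>m\<in>range h. f m * lens r (plane_point m))"
    by (rule infsum_cong_neutral) (auto simp: rng)
  also have "\<dots> = (\<Sum>\<^sub>\<infinity>m. f (h m) * lens r (plane_point (h m)))"
    by (subst infsum_reindex[OF inj]) (simp add: o_def)
  also have "\<dots> = (\<Sum>\<^sub>\<infinity>m. (real p)\<^sup>2 * (f m * lens (r / p) (plane_point m)))"
  proof (intro infsum_cong)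
    fix m
    have "f (h m) = f m" using f by (simp add: h_def)
    thus "f (h m) * lens r (plane_point (h m)) = (real p)\<^sup>2 * (f m * lens (r / p) (plane_point m))"
      using p by (simp add: pp lens_scale)
  qed
  also have "\<dots> = (real p)\<^sup>2 * (\<Sum>\<^sub>\<infinity>m. f m * lens (r / p) (plane_point m))"
    by (rule infsum_cmult_right) (rule summable_on_lens)
  finally show ?thesis .
qed

text \<open>The part of the new Euler factor supported on multiples of \<open>p\<close> has weight
  1/p^2, which cancels the area factor of the rescaling. The subtracted term obeys the same
  recursion because (1 - 1/p^2)^2 = (1 - 2/p^2) + 1/p^4.\<close>

lemma pair_var_insert:
  assumes S: "finite S" "p \<notin> S" "\<And>q. q \<in> insert p S \<Longrightarrow> prime q"
  shows "pair_var (insert p S) r = (1 - 2 / (real p)\<^sup>2) * pair_var S r + pair_var S (r / p)"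
proof -
  have p: "prime p" "1 \<le> p" using S(3) prime_gt_0_nat[of p] by (auto simp: Suc_le_eq)
  have "pair_density S (int p * fst m, int p * snd m) = pair_density S m" for m
    unfolding pair_density_def
  proof (intro prod.cong refl)
    fix q assume q: "q \<in> S"
    have "coprime (int q) (int p)" using S(3) q S(2) by (metis coprime_int_iff insertCI primes_coprime)
    hence "dvd_point q (int p * fst m, int p * snd m) \<longleftrightarrow> dvd_point q m" by (simp add: dvd_point_def coprime_dvd_mult_right_iff)
    thus "1 - 2 / (real q)\<^sup>2 + of_bool (dvd_point q (int p * fst m, int p * snd m)) / (real q)\<^sup>2 = 1 - 2 / (real q)\<^sup>2 + of_bool (dvd_point q m) / (real q)\<^sup>2" by simp
  qed
  note mult = infsum_multiples_lens[where f = "pair_density S" and r = r, OF p(2) this]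
  define a where "a = 1 - 2 / (real p)\<^sup>2"
  define b where "b = 1 / (real p)\<^sup>2"
  have "pair_density (insert p S) m * lens r (plane_point m)
     = a * (pair_density S m * lens r (plane_point m)) + b * (of_bool (dvd_point p m) * pair_density S m * lens r (plane_point m))" for m
    using S by (simp add: pair_density_def a_def b_def algebra_simps)
  hence "(\<Sum>\<^sub>\<infinity>m. pair_density (insert p S) m * lens r (plane_point m))
    = (\<Sum>\<^sub>\<infinity>m. a * (pair_density S m * lens r (plane_point m))) + (\<Sum>\<^sub>\<infinity>m. b * (of_bool (dvd_point p m) * pair_density S m * lens r (plane_point m)))"
    by (simp only:) (intro infsum_add summable_on_cmult_right summable_on_lens)
  also have "\<dots> = a * (\<Sum>\<^sub>\<infinity>m. pair_density S m * lens r (plane_point m)) + b * (\<Sum>\<^sub>\<infinity>m. of_bool (dvd_point p m) * pair_density S m * lens r (plane_point m))"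
    by (intro arg_cong2[of _ _ _ _ "(+)"] infsum_cmult_right summable_on_lens)
  also have "\<dots> = a * (\<Sum>\<^sub>\<infinity>m. pair_density S m * lens r (plane_point m)) + (\<Sum>\<^sub>\<infinity>m. pair_density S m * lens (r / p) (plane_point m))"
    unfolding mult using p by (simp add: b_def)
  finally have 1: "(\<Sum>\<^sub>\<infinity>m. pair_density (insert p S) m * lens r (plane_point m)) = \<dots>" .
  define Q x where "Q = (\<Prod>p\<in>S. 1 - 1 / (real p)\<^sup>2)" and "x = real p"
  have x: "x \<noteq> 0" using p by (simp add: x_def)
  have Qins: "(\<Prod>p\<in>insert p S. 1 - 1 / (real p)\<^sup>2) = (1 - 1 / x\<^sup>2) * Q" using S by (simp add: Q_def x_def)
  have e2: "pi\<^sup>2 * r ^ 4 * ((1 - 1 / x\<^sup>2) * Q)\<^sup>2 = (1 - 2 / x\<^sup>2) * (pi\<^sup>2 * r ^ 4 * Q\<^sup>2) + pi\<^sup>2 * (r / x) ^ 4 * Q\<^sup>2"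
  proof -
    have "(1 - 1 / x\<^sup>2)\<^sup>2 = (1 - 2 / x\<^sup>2) + 1 / x ^ 4"
      by (simp add: power2_eq_square power4_eq_xxxx algebra_simps)
    hence e: "((1 - 1 / x\<^sup>2) * Q)\<^sup>2 = ((1 - 2 / x\<^sup>2) + 1 / x ^ 4) * Q\<^sup>2" by (simp only: power_mult_distrib)
    show ?thesis unfolding e power_divide by (simp add: algebra_simps)
  qed
  show ?thesis unfolding pair_var_def 1 Qins e2 Q_def[symmetric] a_def x_def[symmetric]
    by (simp add: algebra_simps)
qed

text \<open>Unfolding the recursion, each prime either divides the radius, with weight 1, or leaves
  the factor 1 - 2/p^2. The primes that divide the radius multiply to a divisor \<open>g\<close> of
  the product.\<close>

lemma pair_var_expand:
  assumes "finite S" "\<And>p. p \<in> S \<Longrightarrow> prime p"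
  shows "pair_var S r = (\<Sum>g\<in>{g. g dvd \<Prod>S}. euler_wt S g * lat_var (r / g))"
  using assms
proof (induction S arbitrary: r rule: finite_induct)
  case empty
  have "{g::nat. g dvd 1} = {1}" by auto
  thus ?case by (simp add: pair_var_def pair_density_def euler_wt_def lat_var_def power_mult_distrib flip: power_mult)
next
  case (insert p S)
  have p: "prime p" and pS: "\<And>q. q \<in> S \<Longrightarrow> prime q" using insert.prems by auto
  define n where "n = \<Prod>S"
  have pn: "\<not> p dvd n"
  proof
    assume "p dvd n"
    then obtain q where "q \<in> S" "p dvd q"
      unfolding n_def using prime_dvd_prod_iff[OF insert.hyps(1) p, of "\<lambda>q. q"] by auto
    thus False using primes_dvd_imp_eq[OF p pS, of q] insert.hyps by auto
  qed
  have n0: "n \<noteq> 0" unfolding n_def using insert.hyps pS[of 0] by (auto simp: prod_zero_iff)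
  have p0: "p \<noteq> 0" using p by auto
  have fin: "finite {g. g dvd n}" using n0 by (intro finite_divisors_nat) simp
  have div: "{g. g dvd p * n} = {g. g dvd n} \<union> (*) p ` {g. g dvd n}"
  proof (intro equalityI subsetI)
    fix g assume g: "g \<in> {g. g dvd p * n}"
    show "g \<in> {g. g dvd n} \<union> (*) p ` {g. g dvd n}"
    proof (cases "p dvd g")
      case True
      then obtain k where k: "g = p * k" by auto
      hence "k dvd n" using g p0 by simp
      thus ?thesis using k by blast
    next
      case False
      hence "coprime g p" using p by (metis coprime_commute prime_imp_coprime)
      thus ?thesis using g by (simp add: coprime_dvd_mult_right_iff)
    qed
  qed auto
  have w1: "euler_wt (insert p S) g = (1 - 2 / (real p)\<^sup>2) * euler_wt S g" if "g dvd n" for g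
  proof -
    have "\<not> p dvd g" using that pn dvd_trans by blast
    moreover have "\<not> p\<^sup>2 dvd g" using calculation by (metis dvd_trans dvd_triv_left power2_eq_square)
    ultimately have "local_wt p g = 1 - 2 / (real p)\<^sup>2" by (simp add: local_wt_def)
    thus ?thesis using insert.hyps by (simp add: euler_wt_def)
  qed
  have w2: "euler_wt (insert p S) (p * g) = euler_wt S g" if "g dvd n" for g
  proof -
    have pg: "\<not> p dvd g" using that pn dvd_trans by blast
    hence "\<not> p\<^sup>2 dvd p * g" using p0 by (simp add: power2_eq_square)
    hence "local_wt p (p * g) = 1" by (simp add: local_wt_def)
    moreover have "local_wt q (p * g) = local_wt q g" if q: "q \<in> S" for q
    proof -
      have "coprime q p" using q pS[OF q] p insert.hyps by (metis primes_coprime)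
      hence "coprime (q\<^sup>2) p" "coprime q p" by simp_all
      thus ?thesis by (simp add: local_wt_def coprime_dvd_mult_right_iff)
    qed
    ultimately show ?thesis using insert.hyps by (simp add: euler_wt_def)
  qed
  have disj: "{g. g dvd n} \<inter> (*) p ` {g. g dvd n} = {}" using pn dvd_trans by (auto dest: dvd_mult_left)
  have "pair_var (insert p S) r = (1 - 2 / (real p)\<^sup>2) * pair_var S r + pair_var S (r / p)"
    using insert.hyps insert.prems by (intro pair_var_insert) auto
  also have "\<dots> = (1 - 2 / (real p)\<^sup>2) * (\<Sum>g\<in>{g. g dvd n}. euler_wt S g * lat_var (r / g)) + (\<Sum>g\<in>{g. g dvd n}. euler_wt S g * lat_var (r / p / g))"
    using insert.IH pS by (simp add: n_def)
  also have "(1 - 2 / (real p)\<^sup>2) * (\<Sum>g\<in>{g. g dvd n}. euler_wt S g * lat_var (r / g)) = (\<Sum>g\<in>{g. g dvd n}. euler_wt (insert p S) g * lat_var (r / g))"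
    unfolding sum_distrib_left by (intro sum.cong refl) (simp add: w1)
  also have "(\<Sum>g\<in>{g. g dvd n}. euler_wt S g * lat_var (r / p / g)) = (\<Sum>g\<in>(*) p ` {g. g dvd n}. euler_wt (insert p S) g * lat_var (r / g))"
    using p0 by (subst sum.reindex) (auto simp: inj_on_def w2 intro!: sum.cong)
  also have "(\<Sum>g\<in>{g. g dvd n}. euler_wt (insert p S) g * lat_var (r / g)) + (\<Sum>g\<in>(*) p ` {g. g dvd n}. euler_wt (insert p S) g * lat_var (r / g))
    = (\<Sum>g\<in>{g. g dvd p * n}. euler_wt (insert p S) g * lat_var (r / g))"
    unfolding div using fin disj by (intro sum.union_disjoint[symmetric]) auto
  also have "p * n = \<Prod>(insert p S)" using insert.hyps by (simp add: n_def)
  finally show ?case .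
qed

section \<open>Fourier form and size of the lattice variance\<close>

definition bes_u :: "real \<Rightarrow> real" where "bes_u z = z ^ 3 * (bes z)\<^sup>2"

text \<open>Poisson summation with its frequency-zero term cancelled by the squared mean.
  Normalising \<open>bes\<close> by the cube of its argument 2 pi r |k| turns 4 r^4 into r/(2
  pi^3).\<close>

lemma lat_var_eq_bes:
  assumes r: "0 < r"
  shows "lat_var r = r / (2 * pi ^ 3) * (\<Sum>\<^sub>\<infinity>k\<in>UNIV - {(0, 0)}. norm (plane_point k) powi (-3) * bes_u (2 * pi * r * norm (plane_point k)))"
    "(\<lambda>k. norm (plane_point k) powi (-3) * bes_u (2 * pi * r * norm (plane_point k))) summable_on (UNIV - {(0, 0)})"
proof -
  define F where "F k = norm (plane_point k) powi (-3) * bes_u (2 * pi * r * norm (plane_point k))" for k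
  have F: "4 * r ^ 4 * (bes (2 * pi * r * norm (plane_point k)))\<^sup>2 = r / (2 * pi ^ 3) * F k" if k: "k \<in> UNIV - {(0, 0)}" for k
  proof -
    have "0 < norm (plane_point k)" using k by (cases k) (auto simp: plane_point_def zero_prod_def)
    thus ?thesis using r
      by (simp add: F_def bes_u_def power_mult_distrib power_int_minus field_simps power4_eq_xxxx power3_eq_cube)
  qed
  have s: "(\<lambda>k. r / (2 * pi ^ 3) * F k) summable_on (UNIV - {(0, 0)})"
    using lens_poisson(1)[OF r] by (subst summable_on_cong[OF F, symmetric])
  have "(\<lambda>k. (2 * pi ^ 3 / r) * (r / (2 * pi ^ 3) * F k)) summable_on (UNIV - {(0, 0)})"
    by (rule summable_on_cmult_right[OF s])
  thus sF: "(\<lambda>k. norm (plane_point k) powi (-3) * bes_u (2 * pi * r * norm (plane_point k))) summable_on (UNIV - {(0, 0)})"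
    using r by (simp add: F_def[abs_def])
  have "lat_var r = (\<Sum>\<^sub>\<infinity>k\<in>UNIV - {(0, 0)}. 4 * r ^ 4 * (bes (2 * pi * r * norm (plane_point k)))\<^sup>2)"
    using lens_poisson(2)[OF r] by (simp add: lat_var_def)
  also have "\<dots> = (\<Sum>\<^sub>\<infinity>k\<in>UNIV - {(0, 0)}. r / (2 * pi ^ 3) * F k)" by (rule infsum_cong) (rule F)
  also have "\<dots> = r / (2 * pi ^ 3) * (\<Sum>\<^sub>\<infinity>k\<in>UNIV - {(0, 0)}. F k)"
    using sF by (intro infsum_cmult_right) (simp add: F_def[abs_def])
  finally show "lat_var r = r / (2 * pi ^ 3) * (\<Sum>\<^sub>\<infinity>k\<in>UNIV - {(0, 0)}. norm (plane_point k) powi (-3) * bes_u (2 * pi * r * norm (plane_point k)))"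
    by (simp add: F_def)
qed

lemma bes_u_bound: "\<exists>C\<ge>0. \<forall>z>0. 0 \<le> bes_u z \<and> bes_u z \<le> C"
proof -
  obtain C where C: "\<And>z. z > 0 \<Longrightarrow> z ^ 3 * (bes z)\<^sup>2 \<le> C" using bes_bound by blast
  have "0 \<le> bes_u z" if "z > 0" for z using that by (simp add: bes_u_def)
  thus ?thesis using C by (intro exI[of _ "max 0 C"]) (auto simp: bes_u_def intro: order.trans[OF C])
qed

definition epstein_sum :: real where "epstein_sum = (\<Sum>\<^sub>\<infinity>k\<in>UNIV - {(0, 0)}. norm (plane_point k) powi (-3))"

text \<open>The linear bound comes from the Fourier side and governs \<open>g \<le> r\<close>. The
  quadratic bound is what makes the sums of \<open>lat_var (r / g)\<close> over all \<open>g\<close>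
  converge; for small radii it follows from the overlap areas themselves.\<close>

lemma lat_var_bounds: "\<exists>C\<ge>0. \<forall>r>0. 0 \<le> lat_var r \<and> lat_var r \<le> C * r \<and> lat_var r \<le> C * r\<^sup>2"
proof -
  obtain C where C: "C \<ge> 0" "\<And>z. z > 0 \<Longrightarrow> 0 \<le> bes_u z \<and> bes_u z \<le> C" using bes_u_bound by blast
  define C1 where "C1 = 1 / (2 * pi ^ 3) * (C * epstein_sum)"
  define C2 where "C2 = max C1 (card (disk 2) * pi)"
  have epstein_sum: "0 \<le> epstein_sum" unfolding epstein_sum_def by (rule infsum_nonneg) simp
  have lat_var: "0 \<le> lat_var r \<and> lat_var r \<le> C1 * r" if r: "0 < r" for r
  proof -
    let ?T = "\<Sum>\<^sub>\<infinity>k\<in>UNIV - {(0, 0)}. norm (plane_point k) powi (-3) * bes_u (2 * pi * r * norm (plane_point k))"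
    have b: "0 \<le> bes_u (2 * pi * r * norm (plane_point k)) \<and> bes_u (2 * pi * r * norm (plane_point k)) \<le> C" if k: "k \<in> UNIV - {(0, 0)}" for k
    proof -
      have "0 < norm (plane_point k)" using k by (cases k) (auto simp: plane_point_def zero_prod_def)
      thus ?thesis using r by (intro C(2)) simp
    qed
    have 0: "0 \<le> ?T" using b by (intro infsum_nonneg mult_nonneg_nonneg) auto
    have "?T \<le> (\<Sum>\<^sub>\<infinity>k\<in>UNIV - {(0, 0)}. norm (plane_point k) powi (-3) * C)"
      using b by (intro infsum_mono lat_var_eq_bes(2)[OF r] summable_on_cmult_left summable_on_norm_cube mult_left_mono) auto
    also have "\<dots> = epstein_sum * C" unfolding epstein_sum_def by (rule infsum_cmult_left) (rule summable_on_norm_cube)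
    finally have "r / (2 * pi ^ 3) * ?T \<le> r / (2 * pi ^ 3) * (epstein_sum * C)" using r by (intro mult_left_mono) auto
    moreover have "0 \<le> r / (2 * pi ^ 3) * ?T" using r 0 by simp
    ultimately show ?thesis unfolding lat_var_eq_bes(1)[OF r] C1_def by (simp add: mult_ac)
  qed
  show ?thesis
  proof (intro exI[of _ C2] conjI allI impI)
    show "0 \<le> C2" by (simp add: C2_def le_max_iff_disj)
    fix r :: real assume r: "0 < r"
    show "0 \<le> lat_var r" using lat_var[OF r] by simp
    have "C1 * r \<le> C2 * r" using r by (intro mult_right_mono) (auto simp: C2_def)
    thus 1: "lat_var r \<le> C2 * r" using lat_var[OF r] by linarith
    show "lat_var r \<le> C2 * r\<^sup>2"
    proof (cases "r \<le> 1")
      case False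
      have "r \<le> r\<^sup>2" using False by (simp add: power2_eq_square)
      hence "C2 * r \<le> C2 * r\<^sup>2" using \<open>0 \<le> C2\<close> by (intro mult_left_mono)
      thus ?thesis using 1 by linarith
    next
      case True
      \<comment> \<open>For radii up to 1 discs at distance more than 2 are disjoint, so a fixed
        finite set of vectors contributes, each at most the area of the disc.\<close>
      have "(\<Sum>\<^sub>\<infinity>m. lens r (plane_point m)) = (\<Sum>\<^sub>\<infinity>m\<in>disk 2. lens r (plane_point m))"
        using True by (intro infsum_cong_neutral) (auto simp: disk_def not_le intro!: lens_eq_0)
      also have "\<dots> \<le> (\<Sum>m\<in>disk 2. pi * r\<^sup>2)" using r lens_le[of r] by (simp only: infsum_finite finite_disk) (intro sum_mono, simp)
      also have "\<dots> \<le> C2 * r\<^sup>2" using mult_right_mono[of "card (disk 2) * pi" C2 "r\<^sup>2"] by (simp add: C2_def)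
      finally show ?thesis unfolding lat_var_def by (rule order.trans[rotated]) simp
    qed
  qed
qed

subsection \<open>Logarithmic averages of the variance\<close>

definition harm_real :: "real \<Rightarrow> real" where
  "harm_real r = (\<Sum>n\<in>{1..nat \<lfloor>r\<rfloor>}. 1 / real n)"

lemma harm_real_bounds:
  assumes r: "1 \<le> r" shows "ln r \<le> harm_real r" "harm_real r \<le> 1 + ln r"
proof -
  define N where "N = nat \<lfloor>r\<rfloor>"
  have N: "1 \<le> N" "real N \<le> r" "r < real N + 1" using r by (auto simp: N_def le_nat_iff le_floor_iff)
  have h: "harm_real r = harm N" by (simp add: harm_real_def harm_def N_def inverse_eq_divide)
  have "ln r \<le> ln (real N + 1)" using N r by simp
  also have "\<dots> \<le> harm N" by (rule ln_le_harm)
  finally show "ln r \<le> harm_real r" by (simp add: h)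
  obtain k where k: "N = Suc k" using N by (cases N) auto
  have "harm (Suc k) - ln (Suc k) \<le> harm (Suc 0) - ln (Suc 0)"
    using decseq_harm_diff_ln by (rule decseqD) simp
  hence "harm N \<le> 1 + ln N" by (simp add: k harm_def)
  also have "ln N \<le> ln r" using N by simp
  finally show "harm_real r \<le> 1 + ln r" by (simp add: h)
qed

text \<open>The asymptotics split \<open>bes_u\<close> into the constant pi, a sine and an error.
  The constant yields \<open>pi * ln r\<close> through the harmonic sum, the sine is negligible by
  \<open>sum_reciprocal_phase\<close>, and the error is small except at bounded arguments, which
  occur only for \<open>n\<close> of order \<open>r\<close>.\<close>

lemma bes_u_log_average:
  assumes c: "0 < c"
  shows "((\<lambda>r. (\<Sum>n\<in>{1..nat \<lfloor>r\<rfloor>}. bes_u (c * r / real n) / real n) / ln r) \<longlongrightarrow> pi) at_top"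
proof (rule tendstoI)
  fix e :: real assume e: "0 < e"
  define err where "err z = bes_u z - pi * (1 - sin (2 * z))" for z
  obtain C where C: "C \<ge> 0" "\<And>z. z > 0 \<Longrightarrow> 0 \<le> bes_u z \<and> bes_u z \<le> C" using bes_u_bound by blast
  define C' where "C' = C + pi * 2"
  have C'0: "0 \<le> C'" using C by (simp add: C'_def)
  have err_bd: "\<bar>err z\<bar> \<le> C'" if "z > 0" for z
  proof -
    have "0 \<le> 1 - sin (2 * z)" "1 - sin (2 * z) \<le> 2" using sin_le_one[of "2 * z"] sin_ge_minus_one[of "2 * z"] by linarith+
    hence "0 \<le> pi * (1 - sin (2 * z))" "pi * (1 - sin (2 * z)) \<le> pi * 2" by (auto intro: mult_left_mono)
    thus ?thesis using C(2)[OF that] C(1) unfolding err_def C'_def abs_le_iff by linarith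
  qed
  have "\<forall>\<^sub>F z in at_top. \<bar>err z\<bar> < e / 8"
    using tendstoD[OF bes_asymptotics, of "e / 8"] e by (simp add: err_def bes_u_def dist_real_def)
  then obtain Z0 where Z0: "\<And>z. z \<ge> Z0 \<Longrightarrow> \<bar>err z\<bar> < e / 8" by (auto simp: eventually_at_top_linorder)
  define Z where "Z = max 1 Z0"
  have Z: "0 < Z" "\<And>z. z \<ge> Z \<Longrightarrow> \<bar>err z\<bar> \<le> e / 8" using Z0 by (auto simp: Z_def intro: less_imp_le)
  obtain A where A: "\<And>r. r \<ge> 1 \<Longrightarrow> norm (\<Sum>n\<in>{1..nat \<lfloor>r\<rfloor>}. cis ((2 * c) * r / real n) / of_nat n) \<le> e / (8 * pi) * ln r + A"
    using sum_reciprocal_phase[of "2 * c" "e / (8 * pi)"] c e by auto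
  define B where "B = pi + pi * \<bar>A\<bar> + e / 8 + C' * Z / c"
  have B0: "0 \<le> B" using C'0 Z c e by (simp add: B_def)
  have main: "\<bar>(\<Sum>n\<in>{1..nat \<lfloor>r\<rfloor>}. bes_u (c * r / real n) / real n) - pi * ln r\<bar> \<le> e / 4 * ln r + B" if r: "1 \<le> r" for r
  proof -
    define I where "I = {1..nat \<lfloor>r\<rfloor>}"
    have I: "real n \<le> r" "1 \<le> n" if "n \<in> I" for n using that r by (auto simp: I_def le_nat_iff le_floor_iff)
    define sn where "sn = (\<Sum>n\<in>I. sin (2 * (c * r / real n)) / real n)"
    define er where "er = (\<Sum>n\<in>I. err (c * r / real n) / real n)"
    have "bes_u (c * r / real n) / real n = pi * (1 / real n) - pi * (sin (2 * (c * r / real n)) / real n) + err (c * r / real n) / real n" for n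
      by (simp add: err_def diff_divide_distrib right_diff_distrib)
    hence eq: "(\<Sum>n\<in>I. bes_u (c * r / real n) / real n) = pi * harm_real r - pi * sn + er"
      by (simp only: sum.distrib sum_subtractf sum_distrib_left[symmetric] harm_real_def I_def sn_def er_def)
    have "sn = Im (\<Sum>n\<in>I. cis ((2 * c) * r / real n) / of_nat n)"
      by (simp add: sn_def Im_divide_of_nat mult.assoc)
    hence "\<bar>sn\<bar> \<le> norm (\<Sum>n\<in>I. cis ((2 * c) * r / real n) / of_nat n)" by (simp only: abs_Im_le_cmod)
    also have "\<dots> \<le> e / (8 * pi) * ln r + A" unfolding I_def by (rule A[OF r])
    also have "\<dots> \<le> e / (8 * pi) * ln r + \<bar>A\<bar>" by simp
    finally have "pi * \<bar>sn\<bar> \<le> pi * (e / (8 * pi) * ln r + \<bar>A\<bar>)" by (intro mult_left_mono) auto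
    hence sn: "\<bar>pi * sn\<bar> \<le> e / 8 * ln r + pi * \<bar>A\<bar>" by (simp add: abs_mult distrib_left)
    have "\<bar>er\<bar> \<le> (\<Sum>n\<in>I. \<bar>err (c * r / real n) / real n\<bar>)" unfolding er_def by (rule sum_abs)
    also have "\<dots> \<le> (\<Sum>n\<in>I. e / 8 * (1 / real n) + C' * Z / (c * r))"
    proof (rule sum_mono)
      fix n assume n: "n \<in> I"
      note n = I[OF n]
      have z: "0 < c * r / real n" using c r n by simp
      show "\<bar>err (c * r / real n) / real n\<bar> \<le> e / 8 * (1 / real n) + C' * Z / (c * r)"
      proof (cases "Z \<le> c * r / real n")
        case True
        have "\<bar>err (c * r / real n)\<bar> / real n \<le> e / 8 / real n" using Z(2)[OF True] by (rule divide_right_mono) simp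
        moreover have "0 \<le> C' * Z / (c * r)" using C'0 Z c r by simp
        ultimately show ?thesis by (simp add: abs_divide)
      next
        case False
        \<comment> \<open>Arguments below \<open>Z\<close> force \<open>n > c * r / Z\<close>. At
          most \<open>r\<close> such terms of size \<open>C' * Z / (c * r)\<close> add up to a
          constant.\<close>
        hence "1 / real n \<le> Z / (c * r)" using n c r by (simp add: field_simps)
        hence "C' * (1 / real n) \<le> C' * (Z / (c * r))" using C'0 by (rule mult_left_mono)
        moreover have "\<bar>err (c * r / real n)\<bar> / real n \<le> C' / real n" using err_bd[OF z] by (rule divide_right_mono) simp
        moreover have "0 \<le> e / 8 * (1 / real n)" using e by simp
        ultimately show ?thesis by (simp add: abs_divide)
      qed
    qed
    also have "\<dots> = e / 8 * harm_real r + real (card I) * (C' * Z / (c * r))"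
      by (simp add: sum.distrib sum_distrib_left harm_real_def I_def)
    also have "real (card I) * (C' * Z / (c * r)) \<le> r * (C' * Z / (c * r))"
      using C'0 Z c r by (intro mult_right_mono) (auto simp: I_def)
    also have "r * (C' * Z / (c * r)) = C' * Z / c" using r by simp
    also have "e / 8 * harm_real r \<le> e / 8 * (1 + ln r)" using harm_real_bounds[OF r] e by (intro mult_left_mono) auto
    finally have er: "\<bar>er\<bar> \<le> e / 8 * (1 + ln r) + C' * Z / c" by simp
    have "\<bar>harm_real r - ln r\<bar> \<le> 1" using harm_real_bounds[OF r] by simp
    hence "pi * \<bar>harm_real r - ln r\<bar> \<le> pi * 1" by (intro mult_left_mono) auto
    hence "\<bar>pi * harm_real r - pi * ln r\<bar> \<le> pi" by (simp add: abs_mult right_diff_distrib[symmetric])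
    moreover have "e / 8 * (1 + ln r) = e / 8 + e / 8 * ln r" "e / 4 * ln r = 2 * (e / 8 * ln r)"
      by (simp_all add: algebra_simps)
    ultimately show ?thesis unfolding I_def[symmetric] eq B_def using sn er by linarith
  qed
  have "filterlim (ln :: real \<Rightarrow> real) at_top at_top" by (rule ln_at_top)
  hence "\<forall>\<^sub>F r::real in at_top. max 1 (2 * B / e) \<le> ln r" unfolding filterlim_at_top by blast
  thus "\<forall>\<^sub>F r in at_top. dist ((\<Sum>n\<in>{1..nat \<lfloor>r\<rfloor>}. bes_u (c * r / real n) / real n) / ln r) pi < e"
    using eventually_ge_at_top[of 1]
  proof eventually_elim
    case (elim r)
    define S where "S = (\<Sum>n\<in>{1..nat \<lfloor>r\<rfloor>}. bes_u (c * r / real n) / real n)"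
    have l: "1 \<le> ln r" "2 * B / e \<le> ln r" using elim by auto
    have "2 * B \<le> e * ln r" using l(2) e by (simp add: field_simps)
    hence "\<bar>S - pi * ln r\<bar> \<le> 3 / 4 * e * ln r" using main[OF elim(2)] by (simp add: S_def)
    also have "\<dots> < e * ln r" using e l(1) by simp
    finally have "\<bar>S - pi * ln r\<bar> / ln r < e" using l(1) by (subst pos_divide_less_eq) auto
    moreover have "S / ln r - pi = (S - pi * ln r) / ln r" using l(1) by (simp add: field_simps)
    ultimately show ?case using l(1) unfolding S_def[symmetric] dist_real_def by (simp add: abs_divide)
  qed
qed

section \<open>Sums of the lattice variance over the radii r/g\<close>

lemma summable_on_inverse_squares: "(\<lambda>n. 1 / (real n)\<^sup>2) summable_on B"
proof -
  have "summable (\<lambda>n. 1 / (real n)\<^sup>2)" using inverse_power_summable[of 2] by (simp add: inverse_eq_divide)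
  hence "(\<lambda>n. 1 / (real n)\<^sup>2) summable_on UNIV" by (intro norm_summable_imp_summable_on) simp
  thus ?thesis by (rule summable_on_subset_banach) auto
qed

lemma infsum_inverse_squares_tail: "1 \<le> N \<Longrightarrow> (\<Sum>\<^sub>\<infinity>n\<in>{1..} - {1..N}. 1 / (real n)\<^sup>2) \<le> 1 / N"
proof (rule infsum_le_finite_sums[OF summable_on_inverse_squares])
  fix F assume N: "1 \<le> N" and F: "finite F" "F \<subseteq> {1..} - {1..N}"
  have "(\<Sum>n\<in>F. 1 / (real n)\<^sup>2) \<le> (\<Sum>n\<in>{N<..Max (insert 0 F)}. 1 / (real n)\<^sup>2)"
    using F by (intro sum_mono2) auto
  also have "\<dots> \<le> 1 / N" by (rule sum_inverse_squares_le[OF N])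
  finally show "(\<Sum>n\<in>F. 1 / (real n)\<^sup>2) \<le> 1 / N" .
qed

lemma infsum_inverse_squares_le: "(\<Sum>\<^sub>\<infinity>n\<in>{1..}. 1 / (real n)\<^sup>2) \<le> 2"
  using infsum_diff_finite[OF summable_on_inverse_squares, of "{1..1}" "{1..}"] infsum_inverse_squares_tail[of 1] by simp

text \<open>The common majorant for all sums over \<open>g\<close>, whatever the bounded weight; it
  serves both summability and dominated convergence.\<close>

lemma lat_var_div_square_le:
  assumes C: "\<And>r. r > 0 \<Longrightarrow> 0 \<le> lat_var r \<and> lat_var r \<le> C * r \<and> lat_var r \<le> C * r\<^sup>2" and r: "0 < r"
    and \<phi>: "\<bar>\<phi>\<bar> \<le> 1" and g: "1 \<le> g"
  shows "\<bar>\<phi> * lat_var (r / real g)\<bar> \<le> C * r\<^sup>2 * (1 / (real g)\<^sup>2)"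
proof -
  have "\<bar>\<phi> * lat_var (r / real g)\<bar> \<le> 1 * lat_var (r / real g)"
    using C[of "r / real g"] r g \<phi> unfolding abs_mult by (intro mult_mono) auto
  also have "\<dots> \<le> C * (r / real g)\<^sup>2" using C[of "r / real g"] r g by simp
  finally show ?thesis by (simp add: power_divide)
qed

lemma summable_on_V:
  assumes r: "0 < r" and \<phi>: "\<And>g. 1 \<le> g \<Longrightarrow> \<bar>\<phi> g\<bar> \<le> 1"
  shows "(\<lambda>g::nat. \<phi> g * lat_var (r / real g)) summable_on {1..}"
proof -
  obtain C where C: "\<And>r. r > 0 \<Longrightarrow> 0 \<le> lat_var r \<and> lat_var r \<le> C * r \<and> lat_var r \<le> C * r\<^sup>2" using lat_var_bounds by blast
  have "(\<lambda>g. C * r\<^sup>2 * (1 / (real g)\<^sup>2)) summable_on {1..}"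
    by (rule summable_on_cmult_right[OF summable_on_inverse_squares])
  thus ?thesis by (rule abs_infsum_le(1)) (use lat_var_div_square_le[OF C r \<phi>] in auto)
qed

definition lat_var_sum :: "real \<Rightarrow> real" where "lat_var_sum r = (\<Sum>\<^sub>\<infinity>g\<in>{1::nat..}. lat_var (r / real g))"

lemma summable_on_V1: "0 < r \<Longrightarrow> (\<lambda>g::nat. lat_var (r / real g)) summable_on {1..}"
  using summable_on_V[of r "\<lambda>_. 1"] by simp

text \<open>Radii below 1 fall under the quadratic bound, and their total is \<open>O(r)\<close>, of
  lower order than \<open>r * ln r\<close>. The factor 2 comes from
  \<open>r \<le> 2 * N\<close>.\<close>

lemma lat_var_tail:
  assumes C: "\<And>r. r > 0 \<Longrightarrow> 0 \<le> lat_var r \<and> lat_var r \<le> C * r \<and> lat_var r \<le> C * r\<^sup>2" "0 \<le> C" and r: "1 \<le> r"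
  shows "0 \<le> lat_var_sum r - (\<Sum>g\<in>{1..nat \<lfloor>r\<rfloor>}. lat_var (r / real g))"
    "lat_var_sum r - (\<Sum>g\<in>{1..nat \<lfloor>r\<rfloor>}. lat_var (r / real g)) \<le> 2 * C * r"
proof -
  define N where "N = nat \<lfloor>r\<rfloor>"
  have N: "1 \<le> N" using r by (simp add: N_def le_nat_iff)
  have "r < real N + 1" using r by (simp add: N_def)
  hence N2: "r \<le> 2 * real N" using N by linarith
  have s: "(\<lambda>g::nat. lat_var (r / real g)) summable_on {1..}" using r by (intro summable_on_V1) simp
  have eq: "lat_var_sum r - (\<Sum>g\<in>{1..N}. lat_var (r / real g)) = (\<Sum>\<^sub>\<infinity>g\<in>{1..} - {1..N}. lat_var (r / real g))"
    unfolding lat_var_sum_def by (subst infsum_diff_finite[OF s, of "{1..N}"]) auto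
  show "0 \<le> lat_var_sum r - (\<Sum>g\<in>{1..nat \<lfloor>r\<rfloor>}. lat_var (r / real g))"
    unfolding N_def[symmetric] eq using C(1) r by (intro infsum_nonneg) auto
  have "(\<Sum>\<^sub>\<infinity>g\<in>{1..} - {1..N}. lat_var (r / real g)) \<le> (\<Sum>\<^sub>\<infinity>g\<in>{1..} - {1..N}. C * r\<^sup>2 * (1 / (real g)\<^sup>2))"
  proof (rule infsum_mono)
    show "(\<lambda>g. lat_var (r / real g)) summable_on {1..} - {1..N}" by (rule summable_on_subset_banach[OF s]) auto
    show "(\<lambda>g. C * r\<^sup>2 * (1 / (real g)\<^sup>2)) summable_on {1..} - {1..N}"
      by (rule summable_on_cmult_right[OF summable_on_inverse_squares])
    fix g assume "g \<in> {1..} - {1..N}"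
    thus "lat_var (r / real g) \<le> C * r\<^sup>2 * (1 / (real g)\<^sup>2)"
      using lat_var_div_square_le[OF C(1), of r 1 g] r by simp
  qed
  also have "\<dots> = C * r\<^sup>2 * (\<Sum>\<^sub>\<infinity>g\<in>{1..} - {1..N}. 1 / (real g)\<^sup>2)"
    by (rule infsum_cmult_right) (rule summable_on_inverse_squares)
  also have "\<dots> \<le> C * r\<^sup>2 * (1 / N)"
    using C(2) by (intro mult_left_mono infsum_inverse_squares_tail N) auto
  also have "\<dots> \<le> C * r\<^sup>2 * (2 / r)"
    using C(2) N N2 r by (intro mult_left_mono) (auto simp: field_simps)
  also have "\<dots> = 2 * C * r" using r by (simp add: power2_eq_square)
  finally show "lat_var_sum r - (\<Sum>g\<in>{1..nat \<lfloor>r\<rfloor>}. lat_var (r / real g)) \<le> 2 * C * r"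
    unfolding N_def[symmetric] eq .
qed

text \<open>The logarithm is taken of \<open>r\<close> and not of \<open>r / n\<close>, so that the
  bound remains valid for \<open>n > r\<close> and is proportional to 1/n. With
  \<open>n = q\<^sup>2\<close> it can then be summed over the primes that were left out.\<close>

lemma lat_var_sum_bound: "\<exists>C\<ge>0. \<forall>r\<ge>1. \<forall>n\<ge>1::nat. 0 \<le> lat_var_sum (r / n) \<and> lat_var_sum (r / n) \<le> C * (r / n) * (1 + ln r)"
proof -
  obtain C where C: "\<And>r. r > 0 \<Longrightarrow> 0 \<le> lat_var r \<and> lat_var r \<le> C * r \<and> lat_var r \<le> C * r\<^sup>2" "0 \<le> C" using lat_var_bounds by blast
  show ?thesis
  proof (intro exI[of _ "3 * C"] conjI allI impI)
    show "0 \<le> 3 * C" using C by simp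
    fix r :: real and n :: nat assume r: "1 \<le> r" and n: "1 \<le> n"
    define x where "x = r / n"
    have x: "0 < x" "x \<le> r" using r n by (auto simp: x_def field_simps)
    have "0 \<le> lat_var_sum x" unfolding lat_var_sum_def using C(1) x by (intro infsum_nonneg) auto
    thus "0 \<le> lat_var_sum (r / n)" by (simp add: x_def)
    have l: "0 \<le> ln r" using r by simp
    have "lat_var_sum x \<le> 3 * C * x * (1 + ln r)"
    proof (cases "1 \<le> x")
      case True
      have "(\<Sum>g\<in>{1..nat \<lfloor>x\<rfloor>}. lat_var (x / real g)) \<le> (\<Sum>g\<in>{1..nat \<lfloor>x\<rfloor>}. C * x * (1 / real g))"
      proof (rule sum_mono)
        fix g assume "g \<in> {1..nat \<lfloor>x\<rfloor>}"
        thus "lat_var (x / real g) \<le> C * x * (1 / real g)" using C(1)[of "x / real g"] x by simp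
      qed
      also have "\<dots> = C * x * harm_real x" by (simp add: harm_real_def sum_distrib_left)
      also have "\<dots> \<le> C * x * (1 + ln x)" using harm_real_bounds[OF True] C x by (intro mult_left_mono) auto
      also have "\<dots> \<le> C * x * (1 + ln r)" using C x True by (intro mult_left_mono) auto
      finally have "lat_var_sum x \<le> C * x * (1 + ln r) + 2 * C * x * 1" using lat_var_tail(2)[OF C True] by simp
      also have "2 * C * x * 1 \<le> 2 * C * x * (1 + ln r)" using C x l by (intro mult_left_mono) auto
      finally show ?thesis by (simp add: algebra_simps)
    next
      case False
      have "lat_var_sum x \<le> (\<Sum>\<^sub>\<infinity>g\<in>{1..}. C * x\<^sup>2 * (1 / (real g)\<^sup>2))" unfolding lat_var_sum_def
      proof (rule infsum_mono[OF summable_on_V1[OF x(1)] summable_on_cmult_right[OF summable_on_inverse_squares]])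
        fix g :: nat assume "g \<in> {1..}"
        thus "lat_var (x / real g) \<le> C * x\<^sup>2 * (1 / (real g)\<^sup>2)"
          using lat_var_div_square_le[OF C(1) x(1), of 1 g] by simp
      qed
      also have "\<dots> = C * x\<^sup>2 * (\<Sum>\<^sub>\<infinity>g\<in>{1..}. 1 / (real g)\<^sup>2)"
        by (rule infsum_cmult_right) (rule summable_on_inverse_squares)
      also have "\<dots> \<le> C * x\<^sup>2 * 2" using C infsum_inverse_squares_le by (intro mult_left_mono) auto
      also have "\<dots> \<le> C * x * 3"
      proof -
        have "x\<^sup>2 * 2 \<le> x * 3" using False x by (simp add: power2_eq_square)
        thus ?thesis using C mult_left_mono[of "x\<^sup>2 * 2" "x * 3" C] by (simp add: mult.assoc)
      qed
      also have "\<dots> \<le> C * x * 3 * (1 + ln r)" using C x l mult_left_mono[of 1 "1 + ln r" "C * x * 3"] by simp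
      finally show ?thesis by (simp add: mult_ac)
    qed
    thus "lat_var_sum (r / n) \<le> 3 * C * (r / n) * (1 + ln r)" by (simp add: x_def)
  qed
qed

lemma infsum_sum_swap:
  fixes f :: "'b \<Rightarrow> 'a \<Rightarrow> real"
  assumes "finite F" "\<And>g. g \<in> F \<Longrightarrow> f g summable_on A"
  shows "(\<Sum>\<^sub>\<infinity>k\<in>A. \<Sum>g\<in>F. f g k) = (\<Sum>g\<in>F. \<Sum>\<^sub>\<infinity>k\<in>A. f g k) \<and> (\<lambda>k. \<Sum>g\<in>F. f g k) summable_on A"
  using assms
proof (induction F rule: finite_induct)
  case (insert g F)
  thus ?case using infsum_add[of "f g" A "\<lambda>k. \<Sum>g\<in>F. f g k"] summable_on_add[of "f g" A "\<lambda>k. \<Sum>g\<in>F. f g k"] by simp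
qed simp

text \<open>The logarithmic mean of \<open>lat_var r / r\<close>: the factor 1/(2 pi^3) of the
  Fourier form times the mean pi of \<open>bes_u\<close>.\<close>

definition lat_var_mean :: real where "lat_var_mean = epstein_sum / (2 * pi\<^sup>2)"

text \<open>For each frequency the sum over \<open>g\<close> is a logarithmic average of
  \<open>bes_u\<close>. These limits come without uniformity in the frequency; boundedness of
  \<open>bes_u\<close> supplies a majorant \<open>O(|k|^-3)\<close>, so dominated convergence
  permits the interchange.\<close>

lemma lat_var_sum_asymptotics: "((\<lambda>r. lat_var_sum r / (r * ln r)) \<longlongrightarrow> lat_var_mean) at_top"
proof -
  obtain C where C: "\<And>r. r > 0 \<Longrightarrow> 0 \<le> lat_var r \<and> lat_var r \<le> C * r \<and> lat_var r \<le> C * r\<^sup>2" "0 \<le> C" using lat_var_bounds by blast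
  obtain D where D: "D \<ge> 0" "\<And>z. z > 0 \<Longrightarrow> 0 \<le> bes_u z \<and> bes_u z \<le> D" using bes_u_bound by blast
  define A where "A = UNIV - {(0::int, 0::int)}"
  define n3 where "n3 k = norm (plane_point k) powi (-3)" for k
  have nk: "0 < norm (plane_point k)" if "k \<in> A" for k
    using that by (cases k) (auto simp: A_def plane_point_def zero_prod_def)
  define L where "L r k = (\<Sum>g\<in>{1..nat \<lfloor>r\<rfloor>}. bes_u (2 * pi * norm (plane_point k) * r / real g) / real g) / ln r" for r k
  have n3s: "n3 summable_on A" using summable_on_norm_cube by (simp add: n3_def[abs_def] A_def)
  have n30: "0 \<le> n3 k" for k by (simp add: n3_def)
  have lim: "((\<lambda>r. \<Sum>\<^sub>\<infinity>k\<in>A. n3 k * L r k) \<longlongrightarrow> (\<Sum>\<^sub>\<infinity>k\<in>A. n3 k * pi)) at_top"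
  proof (rule tannery_infsum)
    show "(\<lambda>k. n3 k * (2 * D)) summable_on A" by (rule summable_on_cmult_left[OF n3s])
    have "\<forall>\<^sub>F r::real in at_top. 1 \<le> ln r" using ln_at_top unfolding filterlim_at_top by blast
    thus "\<forall>\<^sub>F r in at_top. \<forall>k\<in>A. \<bar>n3 k * L r k\<bar> \<le> n3 k * (2 * D)"
      using eventually_ge_at_top[of 1]
    proof eventually_elim
      case (elim r)
      show ?case
      proof
        fix k assume k: "k \<in> A"
        have pos: "0 < 2 * pi * norm (plane_point k) * r / real g" if "g \<in> {1..nat \<lfloor>r\<rfloor>}" for g
          using nk[OF k] elim that by simp
        have "(\<Sum>g\<in>{1..nat \<lfloor>r\<rfloor>}. bes_u (2 * pi * norm (plane_point k) * r / real g) / real g) \<le> (\<Sum>g\<in>{1..nat \<lfloor>r\<rfloor>}. D * (1 / real g))"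
          using D(2)[OF pos] by (intro sum_mono) (auto intro: divide_right_mono)
        also have "\<dots> = D * harm_real r" by (simp add: harm_real_def sum_distrib_left)
        also have "\<dots> \<le> D * (1 + ln r)" using harm_real_bounds[OF elim(2)] D(1) by (intro mult_left_mono) auto
        also have "\<dots> \<le> D * (2 * ln r)" using elim D(1) by (intro mult_left_mono) auto
        finally have le: "(\<Sum>g\<in>{1..nat \<lfloor>r\<rfloor>}. bes_u (2 * pi * norm (plane_point k) * r / real g) / real g) \<le> D * (2 * ln r)" .
        have "0 < ln r" using elim by linarith
        hence "L r k \<le> 2 * D" unfolding L_def using le by (simp only: pos_divide_le_eq mult.assoc mult.left_commute[of 2])
        moreover have "0 \<le> L r k" unfolding L_def using D(2)[OF pos] elim by (intro divide_nonneg_nonneg sum_nonneg) auto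
        ultimately show "\<bar>n3 k * L r k\<bar> \<le> n3 k * (2 * D)" using n30[of k] by (simp add: abs_mult mult_left_mono)
      qed
    qed
    fix k assume k: "k \<in> A"
    show "((\<lambda>r. n3 k * L r k) \<longlongrightarrow> n3 k * pi) at_top"
      unfolding L_def using nk[OF k] by (intro tendsto_mult_left bes_u_log_average) simp
  qed
  have "(\<Sum>\<^sub>\<infinity>k\<in>A. n3 k * pi) = epstein_sum * pi"
    unfolding epstein_sum_def A_def[symmetric] n3_def[symmetric] by (rule infsum_cmult_left) (rule n3s)
  with tendsto_mult_left[OF lim, of "1 / (2 * pi ^ 3)"]
  have lim2: "((\<lambda>r. 1 / (2 * pi ^ 3) * (\<Sum>\<^sub>\<infinity>k\<in>A. n3 k * L r k)) \<longlongrightarrow> lat_var_mean) at_top"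
    by (simp add: lat_var_mean_def power2_eq_square power3_eq_cube)
  define Vs where "Vs r = (\<Sum>g\<in>{1..nat \<lfloor>r\<rfloor>}. lat_var (r / real g))" for r
  have Vs: "Vs r / (r * ln r) = 1 / (2 * pi ^ 3) * (\<Sum>\<^sub>\<infinity>k\<in>A. n3 k * L r k)" if r: "1 < r" for r
  proof -
    define f where "f g k = n3 k * bes_u (2 * pi * norm (plane_point k) * r / real g) / real g" for g :: nat and k
    have f: "lat_var (r / real g) = r / (2 * pi ^ 3) * (\<Sum>\<^sub>\<infinity>k\<in>A. f g k)" "f g summable_on A" if g: "g \<in> {1..nat \<lfloor>r\<rfloor>}" for g
    proof -
      have rg: "0 < r / real g" using g r by simp
      have e: "2 * pi * (r / real g) * norm (plane_point k) = 2 * pi * norm (plane_point k) * r / real g" for k by simp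
      have s: "(\<lambda>k. n3 k * bes_u (2 * pi * norm (plane_point k) * r / real g)) summable_on A"
        using lat_var_eq_bes(2)[OF rg] unfolding e n3_def[symmetric] A_def[symmetric] .
      from summable_on_cmult_left[OF s, of "1 / real g"] show "f g summable_on A" by (simp add: f_def[abs_def])
      have "(\<Sum>\<^sub>\<infinity>k\<in>A. f g k) = (\<Sum>\<^sub>\<infinity>k\<in>A. n3 k * bes_u (2 * pi * norm (plane_point k) * r / real g)) * (1 / real g)"
        using infsum_cmult_left[OF s, of "1 / real g"] by (simp add: f_def)
      thus "lat_var (r / real g) = r / (2 * pi ^ 3) * (\<Sum>\<^sub>\<infinity>k\<in>A. f g k)"
        using lat_var_eq_bes(1)[OF rg] unfolding e n3_def[symmetric] A_def[symmetric] by simp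
    qed
    have "Vs r = (\<Sum>g\<in>{1..nat \<lfloor>r\<rfloor>}. r / (2 * pi ^ 3) * (\<Sum>\<^sub>\<infinity>k\<in>A. f g k))"
      unfolding Vs_def using f(1) by (intro sum.cong) auto
    also have "\<dots> = r / (2 * pi ^ 3) * (\<Sum>\<^sub>\<infinity>k\<in>A. \<Sum>g\<in>{1..nat \<lfloor>r\<rfloor>}. f g k)"
      using infsum_sum_swap[of "{1..nat \<lfloor>r\<rfloor>}" f A] f(2) by (simp add: sum_distrib_left)
    also have "(\<Sum>\<^sub>\<infinity>k\<in>A. \<Sum>g\<in>{1..nat \<lfloor>r\<rfloor>}. f g k) = (\<Sum>\<^sub>\<infinity>k\<in>A. ln r * (n3 k * L r k))"
    proof (intro infsum_cong)
      fix k
      have "ln r * (n3 k * L r k) = n3 k * (\<Sum>g\<in>{1..nat \<lfloor>r\<rfloor>}. bes_u (2 * pi * norm (plane_point k) * r / real g) / real g)"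
        using r by (simp add: L_def)
      thus "(\<Sum>g\<in>{1..nat \<lfloor>r\<rfloor>}. f g k) = ln r * (n3 k * L r k)" by (simp add: f_def sum_distrib_left)
    qed
    also have "\<dots> = ln r * (\<Sum>\<^sub>\<infinity>k\<in>A. n3 k * L r k)"
      by (rule infsum_cmult_right')
    finally show ?thesis using r by simp
  qed
  have ev: "\<forall>\<^sub>F r in at_top. 1 / (2 * pi ^ 3) * (\<Sum>\<^sub>\<infinity>k\<in>A. n3 k * L r k) = Vs r / (r * ln r)"
    using eventually_gt_at_top[of 1] by eventually_elim (simp only: Vs)
  have lim3: "((\<lambda>r. Vs r / (r * ln r)) \<longlongrightarrow> lat_var_mean) at_top"
    by (rule Lim_transform_eventually[OF lim2 ev])
  have "((\<lambda>r. (lat_var_sum r - Vs r) / (r * ln r)) \<longlongrightarrow> 0) at_top"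
  proof (rule Lim_null_comparison)
    show "\<forall>\<^sub>F r in at_top. norm ((lat_var_sum r - Vs r) / (r * ln r)) \<le> 2 * C * inverse (ln r)"
      using eventually_gt_at_top[of 1]
    proof eventually_elim
      case (elim r)
      have "0 \<le> lat_var_sum r - Vs r" "lat_var_sum r - Vs r \<le> 2 * C * r" using lat_var_tail[OF C, of r] elim by (auto simp: Vs_def)
      moreover have "0 < r * ln r" using elim by simp
      ultimately have "norm ((lat_var_sum r - Vs r) / (r * ln r)) \<le> 2 * C * r / (r * ln r)"
        using divide_right_mono[of "lat_var_sum r - Vs r" "2 * C * r" "r * ln r"] by simp
      thus ?case using elim by (simp add: field_simps)
    qed
    show "((\<lambda>r. 2 * C * inverse (ln r)) \<longlongrightarrow> 0) at_top"
      using tendsto_mult_left[OF tendsto_inverse_0_at_top[OF ln_at_top], of "2 * C"] by simp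
  qed
  from tendsto_add[OF this lim3] show ?thesis by (simp add: add_divide_distrib[symmetric])
qed

subsection \<open>Sums with Euler product weights\<close>

lemma local_wt_bounds: "prime p \<Longrightarrow> 0 \<le> local_wt p g \<and> local_wt p g \<le> 1"
  using prime_inverse_square_le[of p] by (auto simp: local_wt_def)

lemma euler_wt_bounds: "(\<And>p. p \<in> S \<Longrightarrow> prime p) \<Longrightarrow> 0 \<le> euler_wt S g \<and> euler_wt S g \<le> 1"
  unfolding euler_wt_def using local_wt_bounds by (auto intro!: prod_nonneg prod_le_1)

lemma one_minus_loc_le: "1 - local_wt p g \<le> 2 / (real p)\<^sup>2 + of_bool (p\<^sup>2 dvd g)"
  by (auto simp: local_wt_def)

lemma one_minus_prod_le:
  fixes f :: "'a \<Rightarrow> real"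
  assumes "finite R" "\<And>p. p \<in> R \<Longrightarrow> 0 \<le> f p \<and> f p \<le> 1"
  shows "1 - prod f R \<le> (\<Sum>p\<in>R. 1 - f p)"
  using assms
proof (induction R rule: finite_induct)
  case (insert p R)
  have P: "0 \<le> prod f R" "prod f R \<le> 1" using insert.prems by (auto intro!: prod_nonneg prod_le_1)
  have f: "0 \<le> f p" "f p \<le> 1" using insert.prems by auto
  have "1 - f p * prod f R = (1 - f p) + f p * (1 - prod f R)" by (simp add: algebra_simps)
  also have "f p * (1 - prod f R) \<le> 1 * (1 - prod f R)" using P f by (intro mult_right_mono) auto
  finally have "1 - f p * prod f R \<le> (1 - f p) + (1 - prod f R)" by simp
  moreover have "1 - prod f R \<le> (\<Sum>p\<in>R. 1 - f p)" using insert by auto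
  ultimately show ?case using insert.hyps by simp
qed simp

text \<open>One minus a product of numbers in the unit interval is at most the sum of their defects.
  Enlarging the sum from primes to all integers in the range makes the tail of the inverse squares
  available.\<close>

lemma euler_wt_diff_le:
  assumes "P \<le> P'"
  shows "\<bar>euler_wt (primes_upto P) g - euler_wt (primes_upto P') g\<bar> \<le> (\<Sum>q\<in>{P<..P'}. 2 / (real q)\<^sup>2 + of_bool (q\<^sup>2 dvd g))"
proof -
  let ?R = "primes_upto P' - primes_upto P"
  have pr: "prime p" if "p \<in> primes_upto N" for p N using that by (simp add: primes_upto_def)
  have "euler_wt (primes_upto P') g = euler_wt ?R g * euler_wt (primes_upto P) g"
    unfolding euler_wt_def using assms by (intro prod.subset_diff) (auto simp: primes_upto_def)
  hence "euler_wt (primes_upto P) g - euler_wt (primes_upto P') g = euler_wt (primes_upto P) g * (1 - euler_wt ?R g)"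
    by (simp add: algebra_simps)
  moreover have "0 \<le> 1 - euler_wt ?R g" using euler_wt_bounds[of ?R g] pr by auto
  moreover have "0 \<le> euler_wt (primes_upto P) g" "euler_wt (primes_upto P) g \<le> 1" using euler_wt_bounds[of "primes_upto P" g] pr by auto
  ultimately have "\<bar>euler_wt (primes_upto P) g - euler_wt (primes_upto P') g\<bar> \<le> 1 * (1 - euler_wt ?R g)"
    by (simp only: abs_mult) (intro mult_mono; simp)
  also have "1 * (1 - euler_wt ?R g) \<le> (\<Sum>p\<in>?R. 1 - local_wt p g)"
    unfolding euler_wt_def mult_1 using local_wt_bounds pr by (intro one_minus_prod_le) auto
  also have "\<dots> \<le> (\<Sum>p\<in>?R. 2 / (real p)\<^sup>2 + of_bool (p\<^sup>2 dvd g))" by (intro sum_mono one_minus_loc_le)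
  also have "\<dots> \<le> (\<Sum>q\<in>{P<..P'}. 2 / (real q)\<^sup>2 + of_bool (q\<^sup>2 dvd g))"
    by (intro sum_mono2) (auto simp: primes_upto_def)
  finally show ?thesis .
qed

definition euler_wt_lim :: "nat \<Rightarrow> real" where "euler_wt_lim g = lim (\<lambda>P. euler_wt (primes_upto P) g)"

lemma euler_wt_lim: "(\<lambda>P. euler_wt (primes_upto P) g) \<longlonglongrightarrow> euler_wt_lim g"
proof -
  have "decseq (\<lambda>P. euler_wt (primes_upto P) g)"
    unfolding decseq_def
  proof (intro allI impI)
    fix P P' :: nat assume PP: "P \<le> P'"
    have "euler_wt (primes_upto P') g = euler_wt (primes_upto P' - primes_upto P) g * euler_wt (primes_upto P) g"
      unfolding euler_wt_def using PP by (intro prod.subset_diff) (auto simp: primes_upto_def)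
    also have "\<dots> \<le> 1 * euler_wt (primes_upto P) g"
      using euler_wt_bounds[of "primes_upto P' - primes_upto P" g] euler_wt_bounds[of "primes_upto P" g]
      by (intro mult_right_mono) (auto simp: primes_upto_def)
    finally show "euler_wt (primes_upto P') g \<le> euler_wt (primes_upto P) g" by simp
  qed
  moreover have "0 \<le> euler_wt (primes_upto P) g" for P
    using euler_wt_bounds[of "primes_upto P" g] by (auto simp: primes_upto_def)
  ultimately obtain L where "(\<lambda>P. euler_wt (primes_upto P) g) \<longlonglongrightarrow> L"
    using decseq_convergent[of "\<lambda>P. euler_wt (primes_upto P) g" 0] by blast
  thus ?thesis unfolding euler_wt_lim_def by (simp add: limI)
qed

text \<open>For \<open>P \<ge> g\<close> a squarefree \<open>g\<close> divides the primorial and any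
  other \<open>g\<close> has weight 0, so the restriction to divisors in
  \<open>pair_var_expand\<close> disappears in the limit.\<close>

lemma primorial_or_wt_0:
  assumes g: "1 \<le> g" and P: "g \<le> P"
  shows "g dvd \<Prod>(primes_upto P) \<or> euler_wt (primes_upto P) g = 0"
proof (cases "\<exists>p. prime p \<and> p\<^sup>2 dvd g")
  case True
  then obtain p where p: "prime p" "p\<^sup>2 dvd g" by blast
  hence "p dvd g" by (metis dvd_trans dvd_triv_left power2_eq_square)
  hence "p \<le> P" using g P dvd_imp_le[of p g] by simp
  hence "p \<in> primes_upto P" using p by (simp add: primes_upto_def)
  moreover have "local_wt p g = 0" using p by (simp add: local_wt_def)
  ultimately show ?thesis unfolding euler_wt_def by (auto intro!: prod_zero)
next
  case False
  have "g = (\<Prod>p\<in>prime_factors g. p ^ multiplicity p g)"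
    using g by (intro prime_factorization_nat) simp
  also have "\<dots> = \<Prod>(prime_factors g)"
  proof (rule prod.cong[OF refl])
    fix p assume "p \<in> prime_factors g"
    hence p: "prime p" "p dvd g" by auto
    have "multiplicity p g < 2" using False p g by (intro multiplicity_lessI) auto
    moreover have "0 < multiplicity p g" using p g by (simp add: prime_multiplicity_gt_zero_iff)
    ultimately have "multiplicity p g = 1" by linarith
    thus "p ^ multiplicity p g = p" by simp
  qed
  finally have e: "g = \<Prod>(prime_factors g)" .
  have "prime_factors g \<subseteq> primes_upto P"
  proof
    fix p assume "p \<in> prime_factors g"
    thus "p \<in> primes_upto P" using g P dvd_imp_le[of p g] by (auto simp: primes_upto_def)
  qed
  hence "\<Prod>(prime_factors g) dvd \<Prod>(primes_upto P)" by (intro prod_dvd_prod_subset) auto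
  thus ?thesis using e by simp
qed

lemma pair_variance_eq:
  assumes r: "0 < r"
  shows "(\<Sum>\<^sub>\<infinity>m. pair_limit m * lens r (plane_point m)) - 36 * r ^ 4 / pi\<^sup>2 = (\<Sum>\<^sub>\<infinity>g\<in>{1..}. euler_wt_lim g * lat_var (r / real g))"
proof -
  have sum_eq: "(\<Sum>\<^sub>\<infinity>m. f m * lens r (plane_point m)) = (\<Sum>m\<in>disk (2 * r). f m * lens r (plane_point m))" for f :: "int \<times> int \<Rightarrow> real"
  proof -
    have "(\<Sum>\<^sub>\<infinity>m. f m * lens r (plane_point m)) = (\<Sum>\<^sub>\<infinity>m\<in>disk (2 * r). f m * lens r (plane_point m))"
      by (rule infsum_cong_neutral) (auto simp: disk_def not_le lens_eq_0)
    thus ?thesis by simp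
  qed
  have "(\<lambda>P. \<Sum>m\<in>disk (2 * r). pair_density (primes_upto P) m * lens r (plane_point m)) \<longlonglongrightarrow> (\<Sum>m\<in>disk (2 * r). pair_limit m * lens r (plane_point m))"
    by (intro tendsto_sum tendsto_mult_right pair_limit)
  moreover have "(\<lambda>P. pi\<^sup>2 * r ^ 4 * (\<Prod>p\<in>primes_upto P. 1 - 1 / (real p)\<^sup>2)\<^sup>2) \<longlonglongrightarrow> pi\<^sup>2 * r ^ 4 * (6 / pi\<^sup>2)\<^sup>2"
    by (intro tendsto_mult_left tendsto_power euler_product_zeta2)
  ultimately have "(\<lambda>P. pair_var (primes_upto P) r) \<longlonglongrightarrow> (\<Sum>\<^sub>\<infinity>m. pair_limit m * lens r (plane_point m)) - pi\<^sup>2 * r ^ 4 * (6 / pi\<^sup>2)\<^sup>2"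
    unfolding pair_var_def sum_eq by (rule tendsto_diff)
  also have "pi\<^sup>2 * r ^ 4 * (6 / pi\<^sup>2)\<^sup>2 = 36 * r ^ 4 / pi\<^sup>2"
    by (simp add: power_divide power2_eq_square)
  finally have lim1: "(\<lambda>P. pair_var (primes_upto P) r) \<longlonglongrightarrow> (\<Sum>\<^sub>\<infinity>m. pair_limit m * lens r (plane_point m)) - 36 * r ^ 4 / pi\<^sup>2" .
  \<comment> \<open>Extends the sum over divisors by zero, so that its index set no longer depends
    on \<open>P\<close>.\<close>
  define W where "W P g = of_bool (g dvd \<Prod>(primes_upto P)) * euler_wt (primes_upto P) g" for P g
  have W01: "\<bar>W P g\<bar> \<le> 1" for P g
    using euler_wt_bounds[of "primes_upto P" g] by (auto simp: W_def primes_upto_def)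
  have pv: "pair_var (primes_upto P) r = (\<Sum>\<^sub>\<infinity>g\<in>{1..}. W P g * lat_var (r / real g))" for P
  proof -
    have "0 \<notin> primes_upto P" by (simp add: primes_upto_def)
    hence n0: "\<Prod>(primes_upto P) \<noteq> 0" by (metis prod_zero_iff prod.infinite one_neq_zero)
    let ?D = "{g. g dvd \<Prod>(primes_upto P)}"
    have fin: "finite ?D" using n0 by (metis finite_divisors_nat gr0I)
    have "pair_var (primes_upto P) r = (\<Sum>g\<in>?D. euler_wt (primes_upto P) g * lat_var (r / real g))"
      by (rule pair_var_expand) (auto simp: primes_upto_def)
    also have "\<dots> = (\<Sum>\<^sub>\<infinity>g\<in>?D. euler_wt (primes_upto P) g * lat_var (r / real g))" using fin by simp
    also have "\<dots> = (\<Sum>\<^sub>\<infinity>g\<in>{1..}. W P g * lat_var (r / real g))"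
    proof (rule infsum_cong_neutral)
      fix g assume "g \<in> ?D - {1..}"
      hence "g = 0" by auto
      thus "euler_wt (primes_upto P) g * lat_var (r / real g) = 0" using n0 \<open>g \<in> ?D - {1..}\<close> by auto
    qed (auto simp: W_def)
    finally show ?thesis .
  qed
  obtain C where C: "\<And>r. r > 0 \<Longrightarrow> 0 \<le> lat_var r \<and> lat_var r \<le> C * r \<and> lat_var r \<le> C * r\<^sup>2" "0 \<le> C" using lat_var_bounds by blast
  have "(\<lambda>P. \<Sum>\<^sub>\<infinity>g\<in>{1..}. W P g * lat_var (r / real g)) \<longlonglongrightarrow> (\<Sum>\<^sub>\<infinity>g\<in>{1..}. euler_wt_lim g * lat_var (r / real g))"
  proof (rule tannery_infsum)
    show "(\<lambda>g. C * r\<^sup>2 * (1 / (real g)\<^sup>2)) summable_on {1..}"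
      by (rule summable_on_cmult_right[OF summable_on_inverse_squares])
    show "\<forall>\<^sub>F P in sequentially. \<forall>g\<in>{1..}. \<bar>W P g * lat_var (r / real g)\<bar> \<le> C * r\<^sup>2 * (1 / (real g)\<^sup>2)"
      by (intro always_eventually allI ballI lat_var_div_square_le[OF C(1) r W01]) auto
    fix g :: nat assume "g \<in> {1..}"
    hence g: "1 \<le> g" by simp
    have "\<forall>\<^sub>F P in sequentially. euler_wt (primes_upto P) g * lat_var (r / real g) = W P g * lat_var (r / real g)"
      using eventually_ge_at_top[of g]
    proof eventually_elim
      case (elim P)
      show ?case using primorial_or_wt_0[OF g elim] by (auto simp: W_def)
    qed
    with tendsto_mult_right[OF euler_wt_lim]
    show "(\<lambda>P. W P g * lat_var (r / real g)) \<longlonglongrightarrow> euler_wt_lim g * lat_var (r / real g)" by (rule Lim_transform_eventually)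
  qed
  with lim1 show ?thesis unfolding pv by (rule LIMSEQ_unique)
qed

section \<open>Weights truncated to finitely many primes\<close>

definition wt_var_sum :: "nat set \<Rightarrow> nat \<Rightarrow> real \<Rightarrow> real" where
  "wt_var_sum S e r = (\<Sum>\<^sub>\<infinity>g\<in>{1..}. of_bool (e dvd g) * euler_wt S g * lat_var (r / real g))"

lemma wt_var_sum_empty:
  assumes e: "1 \<le> e" shows "wt_var_sum {} e r = lat_var_sum (r / e)"
proof -
  have inj: "inj_on ((*) e) {1..}" using e by (auto simp: inj_on_def)
  have "lat_var_sum (r / e) = (\<Sum>\<^sub>\<infinity>g\<in>(*) e ` {1..}. lat_var (r / real g))"
    unfolding lat_var_sum_def by (subst infsum_reindex[OF inj]) (simp add: o_def)
  also have "\<dots> = wt_var_sum {} e r"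
    unfolding wt_var_sum_def euler_wt_def
  proof (rule infsum_cong_neutral)
    fix g :: nat assume g: "g \<in> {1..} - (*) e ` {1..}"
    have "\<not> e dvd g"
    proof
      assume "e dvd g"
      then obtain k where "g = e * k" by auto
      thus False using g by (cases "k = 0") (auto simp: Suc_le_eq)
    qed
    thus "of_bool (e dvd g) * prod (\<lambda>p. local_wt p g) {} * lat_var (r / real g) = 0" by simp
  qed (use e in \<open>auto simp: Suc_le_eq\<close>)
  finally show ?thesis ..
qed

lemma infsum_diff_real:
  fixes f g :: "'a \<Rightarrow> real"
  assumes "f summable_on A" "g summable_on A"
  shows "(\<Sum>\<^sub>\<infinity>x\<in>A. f x - g x) = (\<Sum>\<^sub>\<infinity>x\<in>A. f x) - (\<Sum>\<^sub>\<infinity>x\<in>A. g x)"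
  using infsum_add[of f A "\<lambda>x. - g x"] assms by (simp add: infsum_uminus summable_on_uminus)

text \<open>The local weight is a combination of divisibility conditions, (1 - 2/p^2) +
  (2/p^2)[p | g] - [p^2 | g], and each condition merges with \<open>e | g\<close> by
  coprimality.\<close>

lemma wt_var_sum_insert:
  assumes S: "finite S" "p \<notin> S" "\<And>q. q \<in> insert p S \<Longrightarrow> prime q" and e: "coprime e p" and r: "0 < r"
  shows "wt_var_sum (insert p S) e r = (1 - 2 / (real p)\<^sup>2) * wt_var_sum S e r + 2 / (real p)\<^sup>2 * wt_var_sum S (e * p) r - wt_var_sum S (e * p\<^sup>2) r"
proof -
  define f where "f d g = of_bool (d dvd g) * euler_wt S g * lat_var (r / real g)" for d g
  have s: "f d summable_on {1..}" for d
    unfolding f_def[abs_def] using euler_wt_bounds[of S] S(3) by (intro summable_on_V[OF r]) auto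
  have dvd1: "e * p dvd g \<longleftrightarrow> e dvd g \<and> p dvd g" for g
    using e by (auto intro: divides_mult dvd_mult_left dvd_mult_right)
  have dvd2: "e * p\<^sup>2 dvd g \<longleftrightarrow> e dvd g \<and> p\<^sup>2 dvd g" for g
    using e by (auto intro: divides_mult dvd_mult_left dvd_mult_right)
  have p2: "p\<^sup>2 dvd g \<Longrightarrow> p dvd g" for g by (metis dvd_trans dvd_triv_left power2_eq_square)
  have "of_bool (e dvd g) * euler_wt (insert p S) g * lat_var (r / real g)
     = (1 - 2 / (real p)\<^sup>2) * f e g + 2 / (real p)\<^sup>2 * f (e * p) g - f (e * p\<^sup>2) g" for g
  proof -
    have "euler_wt (insert p S) g = local_wt p g * euler_wt S g" using S by (simp add: euler_wt_def)
    moreover have "local_wt p g = (1 - 2 / (real p)\<^sup>2) + 2 / (real p)\<^sup>2 * of_bool (p dvd g) - of_bool (p\<^sup>2 dvd g)"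
      using p2[of g] by (auto simp: local_wt_def)
    ultimately have w: "euler_wt (insert p S) g = ((1 - 2 / (real p)\<^sup>2) + 2 / (real p)\<^sup>2 * of_bool (p dvd g) - of_bool (p\<^sup>2 dvd g)) * euler_wt S g" by simp
    show ?thesis unfolding f_def dvd1 dvd2 w of_bool_conj by (simp add: algebra_simps)
  qed
  hence "wt_var_sum (insert p S) e r = (\<Sum>\<^sub>\<infinity>g\<in>{1..}. (1 - 2 / (real p)\<^sup>2) * f e g + 2 / (real p)\<^sup>2 * f (e * p) g - f (e * p\<^sup>2) g)"
    unfolding wt_var_sum_def by simp
  also have "\<dots> = (\<Sum>\<^sub>\<infinity>g\<in>{1..}. (1 - 2 / (real p)\<^sup>2) * f e g + 2 / (real p)\<^sup>2 * f (e * p) g) - (\<Sum>\<^sub>\<infinity>g\<in>{1..}. f (e * p\<^sup>2) g)"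
    by (intro infsum_diff_real summable_on_add summable_on_cmult_right s)
  also have "(\<Sum>\<^sub>\<infinity>g\<in>{1..}. (1 - 2 / (real p)\<^sup>2) * f e g + 2 / (real p)\<^sup>2 * f (e * p) g)
     = (\<Sum>\<^sub>\<infinity>g\<in>{1..}. (1 - 2 / (real p)\<^sup>2) * f e g) + (\<Sum>\<^sub>\<infinity>g\<in>{1..}. 2 / (real p)\<^sup>2 * f (e * p) g)"
    by (intro infsum_add summable_on_cmult_right s)
  also have "\<dots> = (1 - 2 / (real p)\<^sup>2) * (\<Sum>\<^sub>\<infinity>g\<in>{1..}. f e g) + 2 / (real p)\<^sup>2 * (\<Sum>\<^sub>\<infinity>g\<in>{1..}. f (e * p) g)"
    by (simp only: infsum_cmult_right[OF s])
  finally show ?thesis by (simp only: wt_var_sum_def f_def)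
qed

text \<open>The mean value of \<open>euler_wt S\<close>: the conditions p | g and p^2 | g have
  densities 1/p and 1/p^2, and (1 - 2/p^2) + 2/p^3 - 1/p^2 is the factor displayed.\<close>

definition euler_cubic :: "nat set \<Rightarrow> real" where
  "euler_cubic S = (\<Prod>p\<in>S. 1 - 3 / (real p)\<^sup>2 + 2 / (real p) ^ 3)"

text \<open>The condition \<open>e dvd g\<close> is carried along to close the induction over
  primes. In the base case it only rescales \<open>r\<close> to \<open>r / e\<close>, and replacing
  \<open>ln (r / e)\<close> by \<open>ln r\<close> is harmless in the limit.\<close>

lemma wt_var_sum_asymptotics:
  assumes "finite S" "\<And>p. p \<in> S \<Longrightarrow> prime p" "1 \<le> e" "\<And>p. p \<in> S \<Longrightarrow> coprime e p"
  shows "((\<lambda>r. wt_var_sum S e r / (r * ln r)) \<longlongrightarrow> lat_var_mean / e * euler_cubic S) at_top"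
  using assms
proof (induction S arbitrary: e rule: finite_induct)
  case empty
  have e: "0 < real e" using empty by simp
  have "filterlim (\<lambda>r. r / real e) at_top at_top"
    unfolding filterlim_at_top
  proof
    fix Z
    show "\<forall>\<^sub>F r in at_top. Z \<le> r / real e"
      using eventually_ge_at_top[of "Z * e"] by eventually_elim (use e in \<open>simp add: field_simps\<close>)
  qed
  from filterlim_compose[OF lat_var_sum_asymptotics this]
  have 1: "((\<lambda>r. lat_var_sum (r / e) / ((r / e) * ln (r / e))) \<longlongrightarrow> lat_var_mean) at_top" .
  have "((\<lambda>r. 1 - ln (real e) * inverse (ln r)) \<longlongrightarrow> 1 - ln (real e) * 0) at_top"
    by (intro tendsto_intros tendsto_inverse_0_at_top ln_at_top)
  from tendsto_mult[OF 1 this] have "((\<lambda>r. lat_var_sum (r / e) / ((r / e) * ln (r / e)) * (1 - ln (real e) * inverse (ln r))) \<longlongrightarrow> lat_var_mean) at_top" by simp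
  from tendsto_mult_right[OF this, of "1 / e"]
  have 2: "((\<lambda>r. lat_var_sum (r / e) / ((r / e) * ln (r / e)) * (1 - ln (real e) * inverse (ln r)) * (1 / e)) \<longlongrightarrow> lat_var_mean / e * euler_cubic {}) at_top"
    by (simp add: euler_cubic_def)
  have "\<forall>\<^sub>F r in at_top. lat_var_sum (r / e) / ((r / e) * ln (r / e)) * (1 - ln (real e) * inverse (ln r)) * (1 / e) = wt_var_sum {} e r / (r * ln r)"
    using eventually_gt_at_top[of "max 1 (real e)"]
  proof eventually_elim
    case (elim r)
    have r: "1 < r" "real e < r" using elim by auto
    have l: "0 < ln r" "0 < ln (r / e)" "ln (r / e) = ln r - ln (real e)" using r e by (auto simp: ln_div)
    have "1 - ln (real e) * inverse (ln r) = ln (r / e) / ln r" using l(1) unfolding l(3) by (simp add: field_simps)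
    thus ?case using l(1,2) r e empty by (simp add: wt_var_sum_empty)
  qed
  with 2 show ?case by (rule Lim_transform_eventually)
next
  case (insert p S)
  have p: "prime p" "coprime e p" using insert.prems by auto
  have p1: "1 \<le> p" using prime_gt_0_nat[OF p(1)] by simp
  have cop: "coprime p q" if "q \<in> S" for q using insert that by (auto intro!: primes_coprime)
  have 1: "((\<lambda>r. wt_var_sum S e r / (r * ln r)) \<longlongrightarrow> lat_var_mean / e * euler_cubic S) at_top"
    using insert.prems by (intro insert.IH) auto
  have 2: "((\<lambda>r. wt_var_sum S (e * p) r / (r * ln r)) \<longlongrightarrow> lat_var_mean / real (e * p) * euler_cubic S) at_top"
    using insert.prems p1 cop by (intro insert.IH) (auto simp: Suc_le_eq)
  have 3: "((\<lambda>r. wt_var_sum S (e * p\<^sup>2) r / (r * ln r)) \<longlongrightarrow> lat_var_mean / real (e * p\<^sup>2) * euler_cubic S) at_top"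
    using insert.prems p1 cop by (intro insert.IH) (auto simp: Suc_le_eq)
  have "((\<lambda>r. (1 - 2 / (real p)\<^sup>2) * (wt_var_sum S e r / (r * ln r)) + 2 / (real p)\<^sup>2 * (wt_var_sum S (e * p) r / (r * ln r)) - wt_var_sum S (e * p\<^sup>2) r / (r * ln r))
     \<longlongrightarrow> (1 - 2 / (real p)\<^sup>2) * (lat_var_mean / e * euler_cubic S) + 2 / (real p)\<^sup>2 * (lat_var_mean / real (e * p) * euler_cubic S) - lat_var_mean / real (e * p\<^sup>2) * euler_cubic S) at_top"
    by (intro tendsto_diff tendsto_add tendsto_mult_left 1 2 3)
  moreover have "\<forall>\<^sub>F r in at_top. (1 - 2 / (real p)\<^sup>2) * (wt_var_sum S e r / (r * ln r)) + 2 / (real p)\<^sup>2 * (wt_var_sum S (e * p) r / (r * ln r)) - wt_var_sum S (e * p\<^sup>2) r / (r * ln r)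
     = wt_var_sum (insert p S) e r / (r * ln r)"
    using eventually_gt_at_top[of 0]
  proof eventually_elim
    case (elim r)
    have "wt_var_sum (insert p S) e r = (1 - 2 / (real p)\<^sup>2) * wt_var_sum S e r + 2 / (real p)\<^sup>2 * wt_var_sum S (e * p) r - wt_var_sum S (e * p\<^sup>2) r"
      using insert.hyps insert.prems p elim by (intro wt_var_sum_insert) auto
    thus ?case by (simp add: add_divide_distrib diff_divide_distrib)
  qed
  ultimately have lim: "((\<lambda>r. wt_var_sum (insert p S) e r / (r * ln r)) \<longlongrightarrow> (1 - 2 / (real p)\<^sup>2) * (lat_var_mean / e * euler_cubic S) + 2 / (real p)\<^sup>2 * (lat_var_mean / real (e * p) * euler_cubic S) - lat_var_mean / real (e * p\<^sup>2) * euler_cubic S) at_top"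
    by (rule Lim_transform_eventually)
  have "(1 - 2 / (real p)\<^sup>2) * (lat_var_mean / e * euler_cubic S) + 2 / (real p)\<^sup>2 * (lat_var_mean / real (e * p) * euler_cubic S) - lat_var_mean / real (e * p\<^sup>2) * euler_cubic S
     = lat_var_mean / e * euler_cubic (insert p S)"
  proof -
    define x Q N where "x = real p" and "Q = euler_cubic S" and "N = lat_var_mean / e"
    have pc: "euler_cubic (insert p S) = (1 - 3 / x\<^sup>2 + 2 / x ^ 3) * Q"
      using insert.hyps by (simp add: euler_cubic_def x_def Q_def)
    have d: "lat_var_mean / real (e * p) = N / x" "lat_var_mean / real (e * p\<^sup>2) = N / x\<^sup>2" by (simp_all add: N_def x_def)
    show ?thesis unfolding pc d x_def[symmetric] Q_def[symmetric] N_def[symmetric]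
      by (simp add: power2_eq_square power3_eq_cube algebra_simps)
  qed
  with lim show ?case by simp
qed

text \<open>The truncation error is \<open>O(1 / P)\<close> relative to
  \<open>r * (1 + ln r)\<close>, uniformly in \<open>r\<close>, so \<open>P\<close> can be fixed
  before \<open>r\<close> tends to infinity. Each omitted \<open>q\<close> costs twice 1/q^2 through
  the factor 1 - 2/q^2 and once 1/q^2 through the multiples of q^2, whence
  \<open>3 * D\<close>.\<close>

lemma euler_wt_lim_VT_le:
  "\<exists>C\<ge>0. \<forall>P\<ge>1. \<forall>r\<ge>1. \<bar>(\<Sum>\<^sub>\<infinity>g\<in>{1..}. euler_wt_lim g * lat_var (r / real g)) - wt_var_sum (primes_upto P) 1 r\<bar> \<le> C / P * (r * (1 + ln r))"
proof -
  obtain D where D: "D \<ge> 0" "\<And>r n. r \<ge> 1 \<Longrightarrow> n \<ge> 1 \<Longrightarrow> 0 \<le> lat_var_sum (r / real n) \<and> lat_var_sum (r / real n) \<le> D * (r / real n) * (1 + ln r)"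
    using lat_var_sum_bound by blast
  obtain C where C: "\<And>r. r > 0 \<Longrightarrow> 0 \<le> lat_var r \<and> lat_var r \<le> C * r \<and> lat_var r \<le> C * r\<^sup>2" "0 \<le> C" using lat_var_bounds by blast
  show ?thesis
  proof (intro exI[of _ "3 * D"] conjI allI impI)
    show "0 \<le> 3 * D" using D by simp
    fix P :: nat and r :: real assume P: "1 \<le> P" and r: "1 \<le> r"
    hence r0: "0 < r" by simp
    have l: "0 \<le> r * (1 + ln r)" using r by simp
    have wb: "\<bar>euler_wt (primes_upto P) g\<bar> \<le> 1" for P g
      using euler_wt_bounds[of "primes_upto P" g] by (auto simp: primes_upto_def)
    have bd: "\<bar>wt_var_sum (primes_upto P') 1 r - wt_var_sum (primes_upto P) 1 r\<bar> \<le> 3 * D / P * (r * (1 + ln r))" if PP: "P \<le> P'" for P'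
    proof -
      define h where "h q g = (2 / (real q)\<^sup>2) * lat_var (r / real g) + of_bool (q\<^sup>2 dvd g) * lat_var (r / real g)" for q g :: nat
      have s1: "(\<lambda>g::nat. (2 / (real q)\<^sup>2) * lat_var (r / real g)) summable_on {1..}" for q
        by (rule summable_on_cmult_right[OF summable_on_V1[OF r0]])
      have s2: "(\<lambda>g::nat. of_bool (q\<^sup>2 dvd g) * lat_var (r / real g)) summable_on {1..}" for q
        by (rule summable_on_V[OF r0]) simp
      have hs: "h q summable_on {1..}" for q unfolding h_def[abs_def] by (intro summable_on_add s1 s2)
      have hq: "(\<Sum>\<^sub>\<infinity>g\<in>{1..}. h q g) \<le> 3 * D * (r * (1 + ln r)) * (1 / (real q)\<^sup>2)" if q: "q \<in> {P<..P'}" for q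
      proof -
        have q1: "1 \<le> q\<^sup>2" using q P by simp
        have "(\<Sum>\<^sub>\<infinity>g\<in>{1..}. h q g) = (\<Sum>\<^sub>\<infinity>g\<in>{1..}. (2 / (real q)\<^sup>2) * lat_var (r / real g)) + (\<Sum>\<^sub>\<infinity>g\<in>{1..}. of_bool (q\<^sup>2 dvd g) * lat_var (r / real g))"
          unfolding h_def by (intro infsum_add s1 s2)
        also have "(\<Sum>\<^sub>\<infinity>g\<in>{1..}. (2 / (real q)\<^sup>2) * lat_var (r / real g)) = (2 / (real q)\<^sup>2) * lat_var_sum r"
          unfolding lat_var_sum_def by (rule infsum_cmult_right[OF summable_on_V1[OF r0]])
        also have "(\<Sum>\<^sub>\<infinity>g\<in>{1..}. of_bool (q\<^sup>2 dvd g) * lat_var (r / real g)) = lat_var_sum (r / real (q\<^sup>2))"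
          using wt_var_sum_empty[OF q1, of r] by (simp add: wt_var_sum_def euler_wt_def)
        also have "lat_var_sum (r / real (q\<^sup>2)) \<le> D * (r / real (q\<^sup>2)) * (1 + ln r)" using D(2)[OF r q1] by simp
        also have "(2 / (real q)\<^sup>2) * lat_var_sum r \<le> (2 / (real q)\<^sup>2) * (D * r * (1 + ln r))"
          using D(2)[OF r, of 1] by (intro mult_left_mono) auto
        finally have le: "(\<Sum>\<^sub>\<infinity>g\<in>{1..}. h q g) \<le> (2 / (real q)\<^sup>2) * (D * r * (1 + ln r)) + D * (r / real (q\<^sup>2)) * (1 + ln r)" by simp
        define y where "y = 1 / (real q)\<^sup>2"
        have y: "2 / (real q)\<^sup>2 = 2 * y" "r / real (q\<^sup>2) = r * y" by (simp_all add: y_def)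
        show ?thesis using le unfolding y y_def[symmetric] by (simp add: algebra_simps)
      qed
      have sP: "(\<lambda>g. of_bool (1 dvd g) * euler_wt (primes_upto Q) g * lat_var (r / real g)) summable_on {1..}" for Q
        using wb by (intro summable_on_V[OF r0]) simp
      have "wt_var_sum (primes_upto P') 1 r - wt_var_sum (primes_upto P) 1 r
        = (\<Sum>\<^sub>\<infinity>g\<in>{1..}. of_bool (1 dvd g) * euler_wt (primes_upto P') g * lat_var (r / real g) - of_bool (1 dvd g) * euler_wt (primes_upto P) g * lat_var (r / real g))"
        unfolding wt_var_sum_def by (rule infsum_diff_real[OF sP sP, symmetric])
      also have "\<bar>\<dots>\<bar> \<le> (\<Sum>\<^sub>\<infinity>g\<in>{1..}. \<Sum>q\<in>{P<..P'}. h q g)"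
      proof (rule abs_infsum_le(2))
        show "(\<lambda>g. \<Sum>q\<in>{P<..P'}. h q g) summable_on {1..}" using infsum_sum_swap[of "{P<..P'}" h] hs by simp
        fix g :: nat assume g: "g \<in> {1..}"
        have Vg: "0 \<le> lat_var (r / real g)" using C(1)[of "r / real g"] r0 g by simp
        have "of_bool (1 dvd g) * euler_wt (primes_upto P') g * lat_var (r / real g) - of_bool (1 dvd g) * euler_wt (primes_upto P) g * lat_var (r / real g)
          = - ((euler_wt (primes_upto P) g - euler_wt (primes_upto P') g) * lat_var (r / real g))" by (simp add: algebra_simps)
        also have "\<bar>\<dots>\<bar> = \<bar>euler_wt (primes_upto P) g - euler_wt (primes_upto P') g\<bar> * lat_var (r / real g)"
          using Vg by (simp add: abs_mult)
        also have "\<dots> \<le> (\<Sum>q\<in>{P<..P'}. 2 / (real q)\<^sup>2 + of_bool (q\<^sup>2 dvd g)) * lat_var (r / real g)"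
          by (intro mult_right_mono euler_wt_diff_le PP Vg)
        also have "\<dots> = (\<Sum>q\<in>{P<..P'}. h q g)" by (simp add: h_def sum_distrib_right distrib_right)
        finally show "\<bar>of_bool (1 dvd g) * euler_wt (primes_upto P') g * lat_var (r / real g) - of_bool (1 dvd g) * euler_wt (primes_upto P) g * lat_var (r / real g)\<bar> \<le> (\<Sum>q\<in>{P<..P'}. h q g)" .
      qed
      also have "\<dots> = (\<Sum>q\<in>{P<..P'}. \<Sum>\<^sub>\<infinity>g\<in>{1..}. h q g)" using infsum_sum_swap[of "{P<..P'}" h] hs by simp
      also have "\<dots> \<le> (\<Sum>q\<in>{P<..P'}. 3 * D * (r * (1 + ln r)) * (1 / (real q)\<^sup>2))" by (intro sum_mono hq)
      also have "\<dots> = 3 * D * (r * (1 + ln r)) * (\<Sum>q\<in>{P<..P'}. 1 / (real q)\<^sup>2)" by (simp add: sum_distrib_left)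
      also have "\<dots> \<le> 3 * D * (r * (1 + ln r)) * (1 / P)"
        using D(1) l by (intro mult_left_mono sum_inverse_squares_le P) auto
      finally show ?thesis by simp
    qed
    have "(\<lambda>P'. wt_var_sum (primes_upto P') 1 r) \<longlonglongrightarrow> (\<Sum>\<^sub>\<infinity>g\<in>{1..}. euler_wt_lim g * lat_var (r / real g))"
      unfolding wt_var_sum_def
    proof (rule tannery_infsum)
      show "(\<lambda>g. C * r\<^sup>2 * (1 / (real g)\<^sup>2)) summable_on {1..}"
        by (rule summable_on_cmult_right[OF summable_on_inverse_squares])
      show "\<forall>\<^sub>F P in sequentially. \<forall>g\<in>{1..}. \<bar>of_bool (1 dvd g) * euler_wt (primes_upto P) g * lat_var (r / real g)\<bar> \<le> C * r\<^sup>2 * (1 / (real g)\<^sup>2)"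
        using wb by (intro always_eventually allI ballI lat_var_div_square_le[OF C(1) r0]) auto
      fix g :: nat
      show "(\<lambda>P'. of_bool (1 dvd g) * euler_wt (primes_upto P') g * lat_var (r / real g)) \<longlonglongrightarrow> euler_wt_lim g * lat_var (r / real g)"
        using tendsto_mult_right[OF euler_wt_lim, of g] by simp
    qed
    hence "(\<lambda>P'. \<bar>wt_var_sum (primes_upto P') 1 r - wt_var_sum (primes_upto P) 1 r\<bar>) \<longlonglongrightarrow> \<bar>(\<Sum>\<^sub>\<infinity>g\<in>{1..}. euler_wt_lim g * lat_var (r / real g)) - wt_var_sum (primes_upto P) 1 r\<bar>"
      by (intro tendsto_intros)
    thus "\<bar>(\<Sum>\<^sub>\<infinity>g\<in>{1..}. euler_wt_lim g * lat_var (r / real g)) - wt_var_sum (primes_upto P) 1 r\<bar> \<le> 3 * D / P * (r * (1 + ln r))"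
      by (rule LIMSEQ_le_const2) (use bd in blast)
  qed
qed

text \<open>The factor 36/pi^4 is (6/pi^2)^2, split off so that the remaining product has the form
  required in \<open>sigma_sq\<close>.\<close>

definition euler_const :: real where
  "euler_const = 36 / pi ^ 4 * (\<Prod>p. if prime p then 1 - 1 / (real p + 1)\<^sup>2 else 1)"

text \<open>Factorwise, both (1 - 1/x^2)^2 (1 - 1/(x+1)^2) and 1 - 3/x^2 + 2/x^3 equal (x - 1)^2 (x
  + 2)/x^3. The squared factors multiply to the square of 6/pi^2.\<close>

lemma euler_cubic_tendsto: "(\<lambda>P. euler_cubic (primes_upto P)) \<longlonglongrightarrow> euler_const"
proof -
  define f where "f p = (if prime p then 1 - 1 / (real p + 1)\<^sup>2 else 1 :: real)" for p :: nat
  \<comment> \<open>Absolute convergence guarantees that \<open>prodinf f\<close> is the limit of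
    the partial products and not a default value.\<close>
  have "summable (\<lambda>p. norm (f p - 1))"
  proof (rule summable_comparison_test')
    show "summable (\<lambda>p. 1 / (real p + 1)\<^sup>2)" using inverse_squares_sums by (simp add: sums_iff add.commute)
    fix p :: nat assume "0 \<le> p"
    show "norm (norm (f p - 1)) \<le> 1 / (real p + 1)\<^sup>2" by (simp add: f_def)
  qed
  hence "convergent_prod f" by (intro abs_convergent_prod_imp_convergent_prod summable_imp_abs_convergent_prod)
  hence lim: "(\<lambda>P. \<Prod>p\<le>P. f p) \<longlonglongrightarrow> prodinf f" by (rule convergent_prod_LIMSEQ)
  have f_eq: "(\<Prod>p\<le>P. f p) = (\<Prod>p\<in>primes_upto P. 1 - 1 / (real p + 1)\<^sup>2)" for P
  proof -
    have "(\<Prod>p\<le>P. f p) = (\<Prod>p\<in>{p\<in>{..P}. prime p}. 1 - 1 / (real p + 1)\<^sup>2)"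
      unfolding f_def by (rule prod.inter_filter[symmetric]) simp
    also have "{p\<in>{..P}. prime p} = primes_upto P" by (auto simp: primes_upto_def)
    finally show ?thesis .
  qed
  have "euler_cubic (primes_upto P) = (\<Prod>p\<in>primes_upto P. 1 - 1 / (real p)\<^sup>2)\<^sup>2 * (\<Prod>p\<le>P. f p)" for P
    unfolding f_eq euler_cubic_def prod_power_distrib prod.distrib[symmetric]
  proof (rule prod.cong[OF refl])
    fix p assume "p \<in> primes_upto P"
    define x where "x = real p"
    have x: "x > 0" using \<open>p \<in> primes_upto P\<close> prime_gt_0_nat by (auto simp: x_def primes_upto_def)
    have 1: "1 - 1 / x\<^sup>2 = (x - 1) * (x + 1) / x\<^sup>2" using x by (simp add: field_simps power2_eq_square)
    have "x * (x + 2) = (x + 1)\<^sup>2 - 1" by (simp add: power2_eq_square algebra_simps)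
    hence 2: "1 - 1 / (x + 1)\<^sup>2 = x * (x + 2) / (x + 1)\<^sup>2" using x by (simp add: diff_divide_distrib)
    have c: "((x - 1) * u / x\<^sup>2)\<^sup>2 * (x * (x + 2) / u\<^sup>2) = (x - 1)\<^sup>2 * (x + 2) / x ^ 3" if "0 < u" for u
      using x that by (simp add: divide_simps power2_eq_square power3_eq_cube)
    have "(1 - 1 / x\<^sup>2)\<^sup>2 * (1 - 1 / (x + 1)\<^sup>2) = (x - 1)\<^sup>2 * (x + 2) / x ^ 3"
      unfolding 1 2 using x by (intro c) simp
    also have "\<dots> = 1 - 3 / x\<^sup>2 + 2 / x ^ 3"
      using x by (simp add: field_simps power2_eq_square power3_eq_cube)
    finally show "1 - 3 / (real p)\<^sup>2 + 2 / (real p) ^ 3 = (1 - 1 / (real p)\<^sup>2)\<^sup>2 * (1 - 1 / (real p + 1)\<^sup>2)"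
      by (simp add: x_def)
  qed
  moreover have "(\<lambda>P. (\<Prod>p\<in>primes_upto P. 1 - 1 / (real p)\<^sup>2)\<^sup>2 * (\<Prod>p\<le>P. f p)) \<longlonglongrightarrow> (6 / pi\<^sup>2)\<^sup>2 * prodinf f"
    by (intro tendsto_mult tendsto_power euler_product_zeta2 lim)
  moreover have "(6 / pi\<^sup>2)\<^sup>2 * prodinf f = euler_const"
    by (simp add: euler_const_def f_def[abs_def] power_divide flip: power_mult)
  ultimately show ?thesis by simp
qed

lemma variance_asymptotics:
  "((\<lambda>r. (\<Sum>\<^sub>\<infinity>g\<in>{1..}. euler_wt_lim g * lat_var (r / real g)) / (r * ln r)) \<longlongrightarrow> lat_var_mean * euler_const) at_top"
proof (rule tendstoI)
  fix e :: real assume e: "0 < e"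
  define F where "F r = (\<Sum>\<^sub>\<infinity>g\<in>{1..}. euler_wt_lim g * lat_var (r / real g))" for r
  obtain C where C: "C \<ge> 0" "\<And>P r. P \<ge> 1 \<Longrightarrow> r \<ge> 1 \<Longrightarrow> \<bar>F r - wt_var_sum (primes_upto P) 1 r\<bar> \<le> C / real P * (r * (1 + ln r))"
    using euler_wt_lim_VT_le unfolding F_def by blast
  have "\<forall>\<^sub>F P in sequentially. dist (lat_var_mean * euler_cubic (primes_upto P)) (lat_var_mean * euler_const) < e / 3"
    using e by (intro tendstoD tendsto_mult_left euler_cubic_tendsto) auto
  \<comment> \<open>Once \<open>ln r\<close> is at least 1, \<open>1 + ln r\<close> is at most
    \<open>2 * ln r\<close>; the truncation error relative to \<open>r * ln r\<close> is then at
    most \<open>2 * C / P\<close>, which this makes at most \<open>e / 3\<close>.\<close>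
  moreover have "\<forall>\<^sub>F P in sequentially. 6 * C / e \<le> real P"
    using filterlim_real_sequentially unfolding filterlim_at_top by blast
  moreover have "\<forall>\<^sub>F P in sequentially. (1::nat) \<le> P" by (rule eventually_ge_at_top)
  ultimately have "\<forall>\<^sub>F P in sequentially. dist (lat_var_mean * euler_cubic (primes_upto P)) (lat_var_mean * euler_const) < e / 3 \<and> 6 * C / e \<le> real P \<and> 1 \<le> P"
    by eventually_elim simp
  then obtain P where P: "dist (lat_var_mean * euler_cubic (primes_upto P)) (lat_var_mean * euler_const) < e / 3" "6 * C / e \<le> real P" "1 \<le> P"
    by (auto simp: eventually_sequentially)
  have "((\<lambda>r. wt_var_sum (primes_upto P) 1 r / (r * ln r)) \<longlongrightarrow> lat_var_mean / real 1 * euler_cubic (primes_upto P)) at_top"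
    by (rule wt_var_sum_asymptotics) (auto simp: primes_upto_def)
  hence "\<forall>\<^sub>F r in at_top. dist (wt_var_sum (primes_upto P) 1 r / (r * ln r)) (lat_var_mean * euler_cubic (primes_upto P)) < e / 3"
    using e by (intro tendstoD) auto
  moreover have "\<forall>\<^sub>F r::real in at_top. 1 \<le> ln r" using ln_at_top unfolding filterlim_at_top by blast
  ultimately show "\<forall>\<^sub>F r in at_top. dist (F r / (r * ln r)) (lat_var_mean * euler_const) < e"
    using eventually_ge_at_top[of 1]
  proof eventually_elim
    case (elim r)
    have pos: "0 < r * ln r" using elim by (intro mult_pos_pos) linarith+
    have "C / P * (r * (1 + ln r)) \<le> C / P * (r * (2 * ln r))"
      using elim C(1) by (intro mult_left_mono) auto
    also have "\<dots> = 2 * C / P * (r * ln r)" by simp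
    also have "\<dots> \<le> e / 3 * (r * ln r)"
      using pos P(2,3) e by (intro mult_right_mono) (auto simp: field_simps)
    finally have "\<bar>F r - wt_var_sum (primes_upto P) 1 r\<bar> \<le> e / 3 * (r * ln r)" using C(2)[OF P(3) elim(3)] by linarith
    hence "\<bar>F r - wt_var_sum (primes_upto P) 1 r\<bar> / (r * ln r) \<le> e / 3" using pos by (simp only: pos_divide_le_eq)
    hence "\<bar>F r / (r * ln r) - wt_var_sum (primes_upto P) 1 r / (r * ln r)\<bar> \<le> e / 3"
      using pos by (simp add: diff_divide_distrib[symmetric] abs_divide)
    hence "dist (F r / (r * ln r)) (wt_var_sum (primes_upto P) 1 r / (r * ln r)) \<le> e / 3" by (simp only: dist_real_def)
    moreover have "dist a d < e" if "dist a b \<le> e / 3" "dist b c < e / 3" "dist c d < e / 3" for a b c d :: real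
      using that dist_triangle[of a d b] dist_triangle[of b d c] by linarith
    ultimately show ?case using elim(1) P(1) by meson
  qed
qed

theorem proposition2p3:
  "(\<lambda>r::real. plane_mean (\<lambda>x. (X r x)\<^sup>2) - sigma_sq * (ln r / r))
     \<in> o[at_top](\<lambda>r. ln r / r)"
proof (rule smalloI_tendsto)
  \<comment> \<open>The constant 18/pi^6 is 1/(2 pi^2) from the lattice variance times 36/pi^4 from
    the weights.\<close>
  have "sigma_sq = lat_var_mean * euler_const"
    by (simp add: sigma_sq_def lat_var_mean_def euler_const_def epstein_sum_def power2_eq_square power4_eq_xxxx eval_nat_numeral)
  hence "((\<lambda>r. (\<Sum>\<^sub>\<infinity>g\<in>{1..}. euler_wt_lim g * lat_var (r / real g)) / (r * ln r) - sigma_sq) \<longlongrightarrow> 0) at_top"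
    using variance_asymptotics by (simp add: LIM_zero)
  moreover have "\<forall>\<^sub>F r in at_top. (\<Sum>\<^sub>\<infinity>g\<in>{1..}. euler_wt_lim g * lat_var (r / real g)) / (r * ln r) - sigma_sq
     = (plane_mean (\<lambda>x. (X r x)\<^sup>2) - sigma_sq * (ln r / r)) / (ln r / r)"
    using eventually_gt_at_top[of 1]
  proof eventually_elim
    case (elim r)
    have r: "0 < r" "0 < ln r" using elim by auto
    have "A / (r * ln r) - sigma_sq = (A / r\<^sup>2 - sigma_sq * (ln r / r)) / (ln r / r)" for A
    proof -
      have "A / r\<^sup>2 / (ln r / r) = A / (r * ln r)" using r by (simp add: power2_eq_square)
      moreover have "sigma_sq * (ln r / r) / (ln r / r) = sigma_sq" using r by simp
      ultimately show ?thesis by (simp only: diff_divide_distrib)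
    qed
    thus ?case by (simp only: plane_mean_X_square[OF r(1)] pair_variance_eq[OF r(1)])
  qed
  ultimately show "((\<lambda>r. (plane_mean (\<lambda>x. (X r x)\<^sup>2) - sigma_sq * (ln r / r)) / (ln r / r)) \<longlongrightarrow> 0) at_top"
    by (rule Lim_transform_eventually)
  show "\<forall>\<^sub>F r in at_top. ln r / r \<noteq> (0::real)"
    using eventually_gt_at_top[of 1] by eventually_elim simp
qed

end
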